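(* Let $(\mathcal E,\mathcal F)$ be a Dirichlet form on $L^2(A,\tau)$. The cone of potentials is contained in the standard cone: $\mathcal P_+\subset L^2_+(A,\tau)$.
   Context: Setting. $A$ is a separable C*-algebra with a densely defined, faithful, semifinite, lower semicontinuous positive trace $\tau$. $L^2(A,\tau)$ is its GNS Hilbert space, with inner product $(\cdot,\cdot)_2$ (linear in the second variable) and norm $\|\cdot\|_2$; $\mathcal M=L^\infty(A,\tau)$ is the von Neumann algebra generated by $A$ on $L^2(A,\tau)$, with unit $1_{\mathcal M}$. Elements $a\in\mathcal M$ with $\tau(a^*a)<\infty$ are identified with vectors of $L^2(A,\tau)$. $L^2_+(A,\tau)$ is the standard positive cone; $J$ is the antiunitary involution extending $a\mapsto a^*$; $L^2_h(A,\tau)=\{\xi: J\xi=\xi\}$. For $\xi\in L^2_h(A,\tau)$, $\xi\wedge 1$ is the Hilbert projection of $\xi$ onto the $L^2$-closure of $\{a=a^*\in A\cap L^2(A,\tau): a\le 1_{\mathcal M}\}$. Dirichlet form. $(\mathcal E,\mathcal F)$ is a closed, densely defined, nonnegative quadratic form on $L^2(A,\tau)$ such that: (real) $J\xi\in\mathcal F$ and $\mathcal E[J\xi]=\mathcal E[\xi]$ for $\xi\in\mathcal F$; (Markovian) $\xi\wedge1\in\mathcal F$ and $\mathcal E[\xi\wedge 1]\le\mathcal E[\xi]$ for $\xi\in\mathcal F\cap L^2_h(A,\tau)$; (complete) for each $n\ge1$ the form $\mathcal E_n[[\xi_{ij}]]=\sum_{i,j}\mathcal E[\xi_{ij}]$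 on $\mathbb M_n(\mathcal F)\subset L^2(\mathbb M_n(A),\tau\otimes tr_n)$ ($tr_n$ the normalized trace) is real and Markovian; (regular) $\mathcal B:=A\cap\mathcal F$ is norm dense in $A$ and is a form core. The associated sesquilinear form is also denoted $\mathcal E(\cdot,\cdot)$. $\mathcal F$ is a Hilbert space with $\langle\xi,\eta\rangle_{\mathcal F}=\mathcal E(\xi,\eta)+(\xi,\eta)_2$. Potentials. $\mathcal P_+$ is the set of potentials: $\xi\in\mathcal F$ with $\langle\xi,b\rangle_{\mathcal F}\ge0$ for all $b\in\mathcal B_+:=\mathcal B\cap L^2_+(A,\tau)$ (equivalently, for all $b\in\mathcal F_+:=\mathcal F\cap L^2_+(A,\tau)$). *)

theory Defs
  imports "HOL-Analysis.Analysis"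
begin

section \<open>C*-algebras and complex Hilbert spaces\<close>

class complex_vector = real_vector +
  fixes scaleC :: "complex \<Rightarrow> 'a \<Rightarrow> 'a"  (infixr \<open>*\<^sub>C\<close> 75)
  assumes scaleC_add_right: "c *\<^sub>C (x + y) = c *\<^sub>C x + c *\<^sub>C y"
    and scaleC_add_left: "(c + d) *\<^sub>C x = c *\<^sub>C x + d *\<^sub>C x"
    and scaleC_scaleC: "c *\<^sub>C d *\<^sub>C x = (c * d) *\<^sub>C x"
    and scaleR_scaleC: "r *\<^sub>R x = complex_of_real r *\<^sub>C x"

text \<open>No unit is required.\<close>

class cstar_algebra = complex_vector + real_normed_algebra + complete_space +
  fixes star :: "'a \<Rightarrow> 'a"
  assumes norm_scaleC: "norm (c *\<^sub>C x) = cmod c * norm x"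
    and scaleC_mult_left: "(c *\<^sub>C x) * y = c *\<^sub>C (x * y)"
    and scaleC_mult_right: "x * (c *\<^sub>C y) = c *\<^sub>C (x * y)"
    and star_add: "star (x + y) = star x + star y"
    and star_scaleC: "star (c *\<^sub>C x) = cnj c *\<^sub>C star x"
    and star_mult: "star (x * y) = star y * star x"
    and star_star: "star (star x) = x"
    and cstar_identity: "norm (star x * x) = (norm x)\<^sup>2"

text \<open>The inner product is linear in the second variable.\<close>

class chilbert_space = complex_vector + real_inner + complete_space +
  fixes cinner :: "'a \<Rightarrow> 'a \<Rightarrow> complex"
  assumes cinner_add_right: "cinner x (y + z) = cinner x y + cinner x z"
    and cinner_scaleC_right: "cinner x (c *\<^sub>C y) = c * cinner x y"
    and cinner_commute: "cinner x y = cnj (cinner y x)"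
    and inner_eq_Re_cinner: "inner x y = Re (cinner x y)"


section \<open>Traces\<close>

definition cstar_pos :: "'a::cstar_algebra set" where
  "cstar_pos = {star b * b | b. True}"

text \<open>A trace is a function on the positive cone; the values of \<open>\<tau>\<close> elsewhere play no role.
  In the extended nonnegative reals, \<open>0 * \<infinity> = 0\<close>.\<close>

definition positive_trace :: "('a::cstar_algebra \<Rightarrow> ennreal) \<Rightarrow> bool" where
  "positive_trace \<tau> \<longleftrightarrow>
     (\<forall>a\<in>cstar_pos. \<forall>b\<in>cstar_pos. \<tau> (a + b) = \<tau> a + \<tau> b) \<and>
     (\<forall>a\<in>cstar_pos. \<forall>r\<ge>0. \<tau> (r *\<^sub>R a) = ennreal r * \<tau> a) \<and>
     (\<forall>a. \<tau> (star a * a) = \<tau> (a * star a))"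

definition trace_finite_pos :: "('a::cstar_algebra \<Rightarrow> ennreal) \<Rightarrow> 'a set" where
  "trace_finite_pos \<tau> = {a \<in> cstar_pos. \<tau> a < \<infinity>}"

definition densely_defined_trace :: "('a::cstar_algebra \<Rightarrow> ennreal) \<Rightarrow> bool" where
  "densely_defined_trace \<tau> \<longleftrightarrow> cstar_pos \<subseteq> closure (trace_finite_pos \<tau>)"

definition faithful_trace :: "('a::cstar_algebra \<Rightarrow> ennreal) \<Rightarrow> bool" where
  "faithful_trace \<tau> \<longleftrightarrow> (\<forall>a\<in>cstar_pos. \<tau> a = 0 \<longrightarrow> a = 0)"

definition semifinite_trace :: "('a::cstar_algebra \<Rightarrow> ennreal) \<Rightarrow> bool" where
  "semifinite_trace \<tau> \<longleftrightarrow>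
     (\<forall>a\<in>cstar_pos. \<tau> a = (SUP b\<in>{b \<in> trace_finite_pos \<tau>. a - b \<in> cstar_pos}. \<tau> b))"

definition lsc_trace :: "('a::cstar_algebra \<Rightarrow> ennreal) \<Rightarrow> bool" where
  "lsc_trace \<tau> \<longleftrightarrow>
     (\<forall>x. \<forall>a\<in>cstar_pos. (\<forall>n. x n \<in> cstar_pos) \<longrightarrow> x \<longlonglongrightarrow> a \<longrightarrow>
        \<tau> a \<le> liminf (\<lambda>n. \<tau> (x n)))"

text \<open>The linear extension of \<open>\<tau>\<close> to the linear span of the positive elements of finite trace.\<close>

definition trace_ext :: "('a::cstar_algebra \<Rightarrow> ennreal) \<Rightarrow> 'a \<Rightarrow> complex" where
  "trace_ext \<tau> x = (THE z. \<exists>p\<in>trace_finite_pos \<tau>. \<exists>q\<in>trace_finite_pos \<tau>.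
      \<exists>r\<in>trace_finite_pos \<tau>. \<exists>s\<in>trace_finite_pos \<tau>.
        x = (p - q) + \<i> *\<^sub>C (r - s) \<and>
        z = Complex (enn2real (\<tau> p) - enn2real (\<tau> q)) (enn2real (\<tau> r) - enn2real (\<tau> s)))"


section \<open>The GNS space\<close>

definition trace_L2 :: "('a::cstar_algebra \<Rightarrow> ennreal) \<Rightarrow> 'a set" where
  "trace_L2 \<tau> = {a. \<tau> (star a * a) < \<infinity>}"

text \<open>\<open>gns_map \<tau> \<Lambda>\<close> says that the Hilbert space \<open>'h\<close> is \<open>L\<^sup>2(A,\<tau>)\<close>: it is the completion of
  \<open>trace_L2 \<tau>\<close> for \<open>(a,b)\<^sub>2 = \<tau>(a\<^sup>*b)\<close>, where \<open>\<Lambda> a\<close> is \<open>a\<close> viewed as a vector. This determines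
  \<open>('h, \<Lambda>)\<close> up to a unique unitary. Thus \<open>A \<inter> L\<^sup>2(A,\<tau>)\<close> is \<open>trace_L2 \<tau>\<close>, as a subset of \<open>A\<close>, or
  \<open>\<Lambda> ` trace_L2 \<tau>\<close>, as a subset of \<open>'h\<close>. Values of \<open>\<Lambda>\<close> off \<open>trace_L2 \<tau>\<close> play no role.\<close>

definition gns_map :: "('a::cstar_algebra \<Rightarrow> ennreal) \<Rightarrow> ('a \<Rightarrow> 'h::chilbert_space) \<Rightarrow> bool" where
  "gns_map \<tau> \<Lambda> \<longleftrightarrow>
     (\<forall>a\<in>trace_L2 \<tau>. \<forall>b\<in>trace_L2 \<tau>. \<Lambda> (a + b) = \<Lambda> a + \<Lambda> b) \<and>
     (\<forall>c. \<forall>a\<in>trace_L2 \<tau>. \<Lambda> (c *\<^sub>C a) = c *\<^sub>C \<Lambda> a) \<and>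
     (\<forall>a\<in>trace_L2 \<tau>. \<forall>b\<in>trace_L2 \<tau>. cinner (\<Lambda> a) (\<Lambda> b) = trace_ext \<tau> (star a * b)) \<and>
     closure (\<Lambda> ` trace_L2 \<tau>) = UNIV"

definition L2_pos :: "('a::cstar_algebra \<Rightarrow> ennreal) \<Rightarrow> ('a \<Rightarrow> 'h::chilbert_space) \<Rightarrow> 'h set" where
  "L2_pos \<tau> \<Lambda> = closure (\<Lambda> ` (cstar_pos \<inter> trace_L2 \<tau>))"

definition antiunitary_involution :: "('h::chilbert_space \<Rightarrow> 'h) \<Rightarrow> bool" where
  "antiunitary_involution J \<longleftrightarrow>
     (\<forall>\<xi> \<eta>. J (\<xi> + \<eta>) = J \<xi> + J \<eta>) \<and> (\<forall>c \<xi>. J (c *\<^sub>C \<xi>) = cnj c *\<^sub>C J \<xi>) \<and>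
     (\<forall>\<xi> \<eta>. cinner (J \<xi>) (J \<eta>) = cinner \<eta> \<xi>) \<and> (\<forall>\<xi>. J (J \<xi>) = \<xi>)"

definition gns_conj ::
  "('a::cstar_algebra \<Rightarrow> ennreal) \<Rightarrow> ('a \<Rightarrow> 'h::chilbert_space) \<Rightarrow> 'h \<Rightarrow> 'h" where
  "gns_conj \<tau> \<Lambda> =
     (THE J. antiunitary_involution J \<and> (\<forall>a\<in>trace_L2 \<tau>. J (\<Lambda> a) = \<Lambda> (star a)))"

definition lmult ::
  "('a::cstar_algebra \<Rightarrow> ennreal) \<Rightarrow> ('a \<Rightarrow> 'h::chilbert_space) \<Rightarrow> 'a \<Rightarrow> 'h \<Rightarrow> 'h" where
  "lmult \<tau> \<Lambda> a = (THE T. bounded_linear T \<and> (\<forall>c \<xi>. T (c *\<^sub>C \<xi>) = c *\<^sub>C T \<xi>) \<and>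
                      (\<forall>b\<in>trace_L2 \<tau>. T (\<Lambda> b) = \<Lambda> (a * b)))"

text \<open>The order of the von Neumann algebra \<open>\<M>\<close> generated by the operators \<open>lmult \<tau> \<Lambda> a\<close> is the
  order of operators on \<open>'h\<close>, and its unit is the identity of \<open>'h\<close>. So \<open>a \<le> 1\<^sub>\<M>\<close> means that
  \<open>\<xi> \<mapsto> \<xi> - a\<xi>\<close> is a positive operator.\<close>

definition le_unit :: "('a::cstar_algebra \<Rightarrow> ennreal) \<Rightarrow> ('a \<Rightarrow> 'h::chilbert_space) \<Rightarrow> 'a \<Rightarrow> bool" where
  "le_unit \<tau> \<Lambda> a \<longleftrightarrow> (\<forall>\<xi>. cinner \<xi> (\<xi> - lmult \<tau> \<Lambda> a \<xi>) \<in> \<real>\<^sub>\<ge>\<^sub>0)"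

text \<open>\<open>nearest d C x\<close>: the point of \<open>C\<close> nearest to \<open>x\<close>. For \<open>C\<close> closed, convex and nonempty in a
  Hilbert space it exists and is unique.\<close>

definition nearest :: "('v \<Rightarrow> 'v \<Rightarrow> real) \<Rightarrow> 'v set \<Rightarrow> 'v \<Rightarrow> 'v" where
  "nearest d C x = (THE y. y \<in> C \<and> (\<forall>z\<in>C. d x y \<le> d x z))"

definition wedge_unit ::
  "('a::cstar_algebra \<Rightarrow> ennreal) \<Rightarrow> ('a \<Rightarrow> 'h::chilbert_space) \<Rightarrow> 'h \<Rightarrow> 'h" where
  "wedge_unit \<tau> \<Lambda> =
     nearest dist (closure (\<Lambda> ` {a \<in> trace_L2 \<tau>. star a = a \<and> le_unit \<tau> \<Lambda> a}))"


section \<open>Matrix amplifications\<close>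

text \<open>An \<open>n \<times> n\<close> matrix is a function of two indices vanishing unless both are below \<open>n\<close>.
  \<open>L\<^sup>2(M\<^sub>n(A), \<tau> \<otimes> tr\<^sub>n)\<close> is \<open>M\<^sub>n(L\<^sup>2(A,\<tau>))\<close> with GNS map \<open>\<Lambda>\<close> applied entrywise; since
  \<open>tr\<^sub>n\<close> is normalized, \<open>(\<tau> \<otimes> tr\<^sub>n)(a\<^sup>*b) = 1/n * (\<Sum>i j. \<tau>(a\<^sub>i\<^sub>j\<^sup>*b\<^sub>i\<^sub>j))\<close>.\<close>

definition mats :: "nat \<Rightarrow> 'v::zero set \<Rightarrow> (nat \<Rightarrow> nat \<Rightarrow> 'v) set" where
  "mats n S = {x. (\<forall>i<n. \<forall>j<n. x i j \<in> S) \<and> (\<forall>i j. \<not> (i < n \<and> j < n) \<longrightarrow> x i j = 0)}"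

definition mat_mult ::
  "nat \<Rightarrow> (nat \<Rightarrow> nat \<Rightarrow> 'a::cstar_algebra) \<Rightarrow> (nat \<Rightarrow> nat \<Rightarrow> 'a) \<Rightarrow> nat \<Rightarrow> nat \<Rightarrow> 'a" where
  "mat_mult n a b = (\<lambda>i k. \<Sum>j<n. a i j * b j k)"

definition mat_star :: "(nat \<Rightarrow> nat \<Rightarrow> 'a::cstar_algebra) \<Rightarrow> nat \<Rightarrow> nat \<Rightarrow> 'a" where
  "mat_star a = (\<lambda>i j. star (a j i))"

definition mat_trace ::
  "nat \<Rightarrow> ('a::cstar_algebra \<Rightarrow> ennreal) \<Rightarrow> (nat \<Rightarrow> nat \<Rightarrow> 'a) \<Rightarrow> ennreal" where
  "mat_trace n \<tau> a = (\<Sum>i<n. \<tau> (a i i)) / of_nat n"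

definition mat_trace_L2 ::
  "nat \<Rightarrow> ('a::cstar_algebra \<Rightarrow> ennreal) \<Rightarrow> (nat \<Rightarrow> nat \<Rightarrow> 'a) set" where
  "mat_trace_L2 n \<tau> = {a \<in> mats n UNIV. mat_trace n \<tau> (mat_mult n (mat_star a) a) < \<infinity>}"

definition mat_gns ::
  "nat \<Rightarrow> ('a \<Rightarrow> 'h::zero) \<Rightarrow> (nat \<Rightarrow> nat \<Rightarrow> 'a) \<Rightarrow> nat \<Rightarrow> nat \<Rightarrow> 'h" where
  "mat_gns n \<Lambda> a = (\<lambda>i j. if i < n \<and> j < n then \<Lambda> (a i j) else 0)"

definition mat_cinner ::
  "nat \<Rightarrow> (nat \<Rightarrow> nat \<Rightarrow> 'h::chilbert_space) \<Rightarrow> (nat \<Rightarrow> nat \<Rightarrow> 'h) \<Rightarrow> complex" where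
  "mat_cinner n \<xi> \<eta> = (\<Sum>i<n. \<Sum>j<n. cinner (\<xi> i j) (\<eta> i j)) / of_nat n"

definition mat_dist ::
  "nat \<Rightarrow> (nat \<Rightarrow> nat \<Rightarrow> 'h::chilbert_space) \<Rightarrow> (nat \<Rightarrow> nat \<Rightarrow> 'h) \<Rightarrow> real" where
  "mat_dist n \<xi> \<eta> =
     sqrt (Re (mat_cinner n (\<lambda>i j. \<xi> i j - \<eta> i j) (\<lambda>i j. \<xi> i j - \<eta> i j)))"

definition mat_closure ::
  "nat \<Rightarrow> (nat \<Rightarrow> nat \<Rightarrow> 'h::chilbert_space) set \<Rightarrow> (nat \<Rightarrow> nat \<Rightarrow> 'h) set" where
  "mat_closure n S = {\<xi> \<in> mats n UNIV. \<forall>e>0. \<exists>\<eta>\<in>S. mat_dist n \<eta> \<xi> < e}"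

definition mat_conj :: "('h \<Rightarrow> 'h) \<Rightarrow> (nat \<Rightarrow> nat \<Rightarrow> 'h) \<Rightarrow> nat \<Rightarrow> nat \<Rightarrow> 'h" where
  "mat_conj J \<xi> = (\<lambda>i j. J (\<xi> j i))"

definition mat_lmult ::
  "nat \<Rightarrow> ('a::cstar_algebra \<Rightarrow> ennreal) \<Rightarrow> ('a \<Rightarrow> 'h::chilbert_space) \<Rightarrow>
   (nat \<Rightarrow> nat \<Rightarrow> 'a) \<Rightarrow> (nat \<Rightarrow> nat \<Rightarrow> 'h) \<Rightarrow> nat \<Rightarrow> nat \<Rightarrow> 'h" where
  "mat_lmult n \<tau> \<Lambda> a \<xi> = (\<lambda>i k. \<Sum>j<n. lmult \<tau> \<Lambda> (a i j) (\<xi> j k))"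

definition mat_le_unit ::
  "nat \<Rightarrow> ('a::cstar_algebra \<Rightarrow> ennreal) \<Rightarrow> ('a \<Rightarrow> 'h::chilbert_space) \<Rightarrow>
   (nat \<Rightarrow> nat \<Rightarrow> 'a) \<Rightarrow> bool" where
  "mat_le_unit n \<tau> \<Lambda> a \<longleftrightarrow>
     (\<forall>\<xi>\<in>mats n UNIV.
        mat_cinner n \<xi> (\<lambda>i k. \<xi> i k - mat_lmult n \<tau> \<Lambda> a \<xi> i k) \<in> \<real>\<^sub>\<ge>\<^sub>0)"

definition mat_wedge_unit ::
  "nat \<Rightarrow> ('a::cstar_algebra \<Rightarrow> ennreal) \<Rightarrow> ('a \<Rightarrow> 'h::chilbert_space) \<Rightarrow>
   (nat \<Rightarrow> nat \<Rightarrow> 'h) \<Rightarrow> nat \<Rightarrow> nat \<Rightarrow> 'h" where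
  "mat_wedge_unit n \<tau> \<Lambda> =
     nearest (mat_dist n)
       (mat_closure n
         (mat_gns n \<Lambda> ` {a \<in> mat_trace_L2 n \<tau>. mat_star a = a \<and> mat_le_unit n \<tau> \<Lambda> a}))"


section \<open>Dirichlet forms and potentials\<close>

text \<open>A quadratic form is given by its domain \<open>F\<close> and its sesquilinear form \<open>E\<close>, with
  \<open>\<E>[\<xi>] = E \<xi> \<xi>\<close>. Nonnegativity makes \<open>E\<close> Hermitian by polarization. Values of \<open>E\<close>
  outside \<open>F\<close> play no role.\<close>

definition nonneg_form :: "'h::chilbert_space set \<Rightarrow> ('h \<Rightarrow> 'h \<Rightarrow> complex) \<Rightarrow> bool" where
  "nonneg_form F E \<longleftrightarrow>
     0 \<in> F \<and> (\<forall>\<xi>\<in>F. \<forall>\<eta>\<in>F. \<xi> + \<eta> \<in> F) \<and> (\<forall>c. \<forall>\<xi>\<in>F. c *\<^sub>C \<xi> \<in> F) \<and>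
     (\<forall>\<xi>\<in>F. \<forall>\<eta>\<in>F. \<forall>\<zeta>\<in>F. E \<xi> (\<eta> + \<zeta>) = E \<xi> \<eta> + E \<xi> \<zeta> \<and> E (\<eta> + \<zeta>) \<xi> = E \<eta> \<xi> + E \<zeta> \<xi>) \<and>
     (\<forall>c. \<forall>\<xi>\<in>F. \<forall>\<eta>\<in>F. E \<xi> (c *\<^sub>C \<eta>) = c * E \<xi> \<eta> \<and> E (c *\<^sub>C \<xi>) \<eta> = cnj c * E \<xi> \<eta>) \<and>
     (\<forall>\<xi>\<in>F. E \<xi> \<xi> \<in> \<real>\<^sub>\<ge>\<^sub>0)"

definition energy :: "('h::chilbert_space \<Rightarrow> 'h \<Rightarrow> complex) \<Rightarrow> 'h \<Rightarrow> real" where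
  "energy E \<xi> = Re (E \<xi> \<xi>)"

definition form_inner :: "('h::chilbert_space \<Rightarrow> 'h \<Rightarrow> complex) \<Rightarrow> 'h \<Rightarrow> 'h \<Rightarrow> complex" where
  "form_inner E \<xi> \<eta> = E \<xi> \<eta> + cinner \<xi> \<eta>"

definition form_norm :: "('h::chilbert_space \<Rightarrow> 'h \<Rightarrow> complex) \<Rightarrow> 'h \<Rightarrow> real" where
  "form_norm E \<xi> = sqrt (Re (form_inner E \<xi> \<xi>))"

definition closed_form :: "'h::chilbert_space set \<Rightarrow> ('h \<Rightarrow> 'h \<Rightarrow> complex) \<Rightarrow> bool" where
  "closed_form F E \<longleftrightarrow>
     (\<forall>x. (\<forall>n. x n \<in> F) \<and>
          (\<forall>e>0. \<exists>N::nat. \<forall>m\<ge>N. \<forall>n\<ge>N. form_norm E (x m - x n) < e) \<longrightarrow>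
          (\<exists>\<xi>\<in>F. (\<lambda>n. form_norm E (x n - \<xi>)) \<longlonglongrightarrow> 0))"

definition real_form :: "('v \<Rightarrow> 'v) \<Rightarrow> 'v set \<Rightarrow> ('v \<Rightarrow> real) \<Rightarrow> bool" where
  "real_form J D Q \<longleftrightarrow> (\<forall>\<xi>\<in>D. J \<xi> \<in> D \<and> Q (J \<xi>) = Q \<xi>)"

text \<open>\<open>W\<close> is the operation \<open>\<xi> \<mapsto> \<xi> \<and> 1\<close>.\<close>

definition markovian_form ::
  "('v \<Rightarrow> 'v) \<Rightarrow> ('v \<Rightarrow> 'v) \<Rightarrow> 'v set \<Rightarrow> ('v \<Rightarrow> real) \<Rightarrow> bool" where
  "markovian_form J W D Q \<longleftrightarrow> (\<forall>\<xi>\<in>D. J \<xi> = \<xi> \<longrightarrow> W \<xi> \<in> D \<and> Q (W \<xi>) \<le> Q \<xi>)"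

definition mat_energy ::
  "nat \<Rightarrow> ('h::chilbert_space \<Rightarrow> 'h \<Rightarrow> complex) \<Rightarrow> (nat \<Rightarrow> nat \<Rightarrow> 'h) \<Rightarrow> real" where
  "mat_energy n E \<xi> = (\<Sum>i<n. \<Sum>j<n. energy E (\<xi> i j))"

definition complete_form ::
  "('a::cstar_algebra \<Rightarrow> ennreal) \<Rightarrow> ('a \<Rightarrow> 'h::chilbert_space) \<Rightarrow>
   'h set \<Rightarrow> ('h \<Rightarrow> 'h \<Rightarrow> complex) \<Rightarrow> bool" where
  "complete_form \<tau> \<Lambda> F E \<longleftrightarrow>
     (\<forall>n\<ge>1. real_form (mat_conj (gns_conj \<tau> \<Lambda>)) (mats n F) (mat_energy n E) \<and>
        markovian_form (mat_conj (gns_conj \<tau> \<Lambda>)) (mat_wedge_unit n \<tau> \<Lambda>)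
          (mats n F) (mat_energy n E))"

text \<open>\<open>\<B> = A \<inter> \<F>\<close>, as a subset of \<open>A\<close>.\<close>

definition dirichlet_alg ::
  "('a::cstar_algebra \<Rightarrow> ennreal) \<Rightarrow> ('a \<Rightarrow> 'h::chilbert_space) \<Rightarrow> 'h set \<Rightarrow> 'a set" where
  "dirichlet_alg \<tau> \<Lambda> F = {a \<in> trace_L2 \<tau>. \<Lambda> a \<in> F}"

definition regular_form ::
  "('a::cstar_algebra \<Rightarrow> ennreal) \<Rightarrow> ('a \<Rightarrow> 'h::chilbert_space) \<Rightarrow>
   'h set \<Rightarrow> ('h \<Rightarrow> 'h \<Rightarrow> complex) \<Rightarrow> bool" where
  "regular_form \<tau> \<Lambda> F E \<longleftrightarrow>
     closure (dirichlet_alg \<tau> \<Lambda> F) = UNIV \<and>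
     (\<forall>\<xi>\<in>F. \<forall>e>0. \<exists>b\<in>dirichlet_alg \<tau> \<Lambda> F. form_norm E (\<xi> - \<Lambda> b) < e)"

definition dirichlet_form ::
  "('a::cstar_algebra \<Rightarrow> ennreal) \<Rightarrow> ('a \<Rightarrow> 'h::chilbert_space) \<Rightarrow>
   'h set \<Rightarrow> ('h \<Rightarrow> 'h \<Rightarrow> complex) \<Rightarrow> bool" where
  "dirichlet_form \<tau> \<Lambda> F E \<longleftrightarrow>
     nonneg_form F E \<and> closure F = UNIV \<and> closed_form F E \<and>
     real_form (gns_conj \<tau> \<Lambda>) F (energy E) \<and>
     markovian_form (gns_conj \<tau> \<Lambda>) (wedge_unit \<tau> \<Lambda>) F (energy E) \<and>
     complete_form \<tau> \<Lambda> F E \<and>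
     regular_form \<tau> \<Lambda> F E"

text \<open>Membership in \<open>\<real>\<^sub>\<ge>\<^sub>0\<close> says that the complex number is real and nonnegative.\<close>

definition potentials ::
  "('a::cstar_algebra \<Rightarrow> ennreal) \<Rightarrow> ('a \<Rightarrow> 'h::chilbert_space) \<Rightarrow>
   'h set \<Rightarrow> ('h \<Rightarrow> 'h \<Rightarrow> complex) \<Rightarrow> 'h set" where
  "potentials \<tau> \<Lambda> F E =
     {\<xi> \<in> F. \<forall>b\<in>\<Lambda> ` dirichlet_alg \<tau> \<Lambda> F \<inter> L2_pos \<tau> \<Lambda>. form_inner E \<xi> b \<in> \<real>\<^sub>\<ge>\<^sub>0}"

end

theory Submission
  imports Defs
begin

text \<open>
  The theorem holds for the reason it holds for classical Dirichlet forms. Let \<open>\<xi>\<close> be a potential.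
  First, \<open>J \<xi> = \<xi>\<close>, because \<open>\<xi>\<close> has real pairing with the positive elements of the Dirichlet
  algebra and these span it. Let \<open>\<xi>\<^sub>+\<close> be the Hilbert projection of \<open>\<xi>\<close> onto the cone \<open>L\<^sup>2\<^sub>+\<close>, and
  \<open>\<xi>\<^sub>- = \<xi>\<^sub>+ - \<xi>\<close>, which again lies in the cone. The projection lowers the norm and the energy, so
  \<open>\<xi>\<^sub>+ = \<xi> + \<xi>\<^sub>-\<close> is no longer than \<open>\<xi>\<close> in the Hilbert space \<open>F\<close>. But \<open>\<xi>\<close> pairs nonnegatively with
  \<open>\<xi>\<^sub>-\<close>, so expanding the square gives
  \<open>\<parallel>\<xi> + \<xi>\<^sub>-\<parallel>\<^sup>2 \<ge> \<parallel>\<xi>\<parallel>\<^sup>2 + \<parallel>\<xi>\<^sub>-\<parallel>\<^sup>2\<close>. Hence \<open>\<xi>\<^sub>- = 0\<close> and \<open>\<xi> = \<xi>\<^sub>+\<close> is in the cone (\<open>potentials_subset_K\<close>).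

  Three facts carry this argument.

  \<^item> Projecting onto the cone lowers the energy (\<open>pos_part_energy\<close>). The Markov property concerns the
  projection onto the set \<open>C\<close> of elements below the unit. By scaling it passes to \<open>\<epsilon> C\<close>. As
  \<open>\<epsilon>\<close> decreases to \<open>0\<close> these sets shrink to the negative cone (\<open>Inter_Cn\<close>), the projections
  converge, and the energy is lower semicontinuous.

  \<^item> A potential pairs nonnegatively with the whole of \<open>F \<inter> L\<^sup>2\<^sub>+\<close> (\<open>potential_finner_nonneg\<close>). Approximate
  an element in form norm by self-adjoint elements of the Dirichlet algebra. Their positive parts stay
  in the algebra, are bounded in energy, and converge in \<open>L\<^sup>2\<close>; hence convex combinations of
  them converge in form norm (\<open>weak_closure\<close>).

  \<^item> The cone is self-dual, and on a self-adjoint element of the algebra the Hilbert projection is the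
  algebraic positive part (\<open>K_selfdual\<close>, \<open>positive_part\<close>).

  The last fact needs the decomposition of a self-adjoint element into two orthogonal positive parts.
  Instead of Gelfand theory, the proof uses a quadratic iteration for square roots
  (\<open>affine_sqrt\<close>) and norm estimates for left multiplication. That sums of elements \<open>c\<^sup>*c\<close> have again this
  form is deduced from the faithful trace (\<open>pos_le_two_if_cstar_pos\<close>), and lower semicontinuity of the
  trace gives the density of the squares \<open>u\<^sup>*u\<close> with \<open>u\<close> square integrable
  (\<open>squares_dense_in_pos\<close>).
\<close>

section \<open>Involution and norm\<close>

lemma scaleC_zero_right [simp]: "c *\<^sub>C (0::'v::complex_vector) = 0"
  using scaleC_add_right[of c 0 "0::'v"] by simp

lemma scaleC_minus_right: "c *\<^sub>C (- x) = - (c *\<^sub>C (x::'v::complex_vector))"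
  using scaleC_add_right[of c x "- x"] by (simp add: eq_neg_iff_add_eq_0 add.commute)

lemma scaleC_one [simp]: "1 *\<^sub>C x = (x::'v::complex_vector)"
  using scaleR_scaleC[of 1 x] by simp

lemma scaleC_zero_left [simp]: "0 *\<^sub>C x = (0::'v::complex_vector)"
  using scaleR_scaleC[of 0 x] by simp

lemma scaleC_minus_left: "(- c) *\<^sub>C x = - (c *\<^sub>C (x::'v::complex_vector))"
  using scaleC_add_left[of c "- c" x] by (simp add: eq_neg_iff_add_eq_0 add.commute)

lemma star_zero [simp]: "star 0 = (0::'a::cstar_algebra)"
  using star_add[of 0 "0::'a"] by simp

lemma star_minus: "star (- x) = - star (x::'a::cstar_algebra)"
  using star_add[of x "- x"] by (simp add: eq_neg_iff_add_eq_0 add.commute)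

lemma star_diff: "star (x - y) = star x - star (y::'a::cstar_algebra)"
  using star_add[of x "- y"] by (simp add: star_minus)

lemma star_scaleR: "star (r *\<^sub>R x) = r *\<^sub>R star (x::'a::cstar_algebra)"
  by (simp add: scaleR_scaleC star_scaleC)

lemmas star_simps = star_add star_diff star_minus star_scaleR star_mult star_star

lemma norm_le_norm_star: "norm x \<le> norm (star (x::'a::cstar_algebra))"
proof (cases "x = 0")
  case False
  have "norm x * norm x \<le> norm (star x) * norm x"
    using cstar_identity[of x] norm_mult_ineq[of "star x" x] by (simp add: power2_eq_square)
  then show ?thesis using False by simp
qed simp

lemma norm_star [simp]: "norm (star x) = norm (x::'a::cstar_algebra)"
  using norm_le_norm_star[of x] norm_le_norm_star[of "star x"] by (simp add: star_star)

lemma norm_selfadjoint_square: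
  fixes a :: "'a::cstar_algebra"
  assumes "star a = a"
  shows "norm (a * a) = (norm a)\<^sup>2"
  using cstar_identity[of a] assms by simp

lemma bounded_linear_star: "bounded_linear (star :: 'a::cstar_algebra \<Rightarrow> 'a)"
  by (rule bounded_linear_intro[where K=1]) (simp_all add: star_add star_scaleR)

lemmas tendsto_star = bounded_linear.tendsto[OF bounded_linear_star]

text \<open>Left multiplication is isometric, so operator bounds are norm bounds.\<close>

lemma norm_le_of_left_mult_le:
  fixes a :: "'a::cstar_algebra"
  assumes "\<And>x. norm (a * x) \<le> c * norm x" and "c \<ge> 0"
  shows "norm a \<le> c"
proof (cases "a = 0")
  case False
  have "norm a * norm a = norm (a * star a)"
    using cstar_identity[of "star a"] by (simp add: star_star power2_eq_square)
  also have "\<dots> \<le> c * norm a" using assms(1)[of "star a"] by simp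
  finally show ?thesis using False by simp
qed (simp add: assms)

section \<open>Square roots by iteration\<close>

text \<open>The pair \<open>(\<kappa>, t)\<close> stands for the element \<open>\<kappa> + t\<close> of the unitization, represented by the operator
  \<open>x \<mapsto> \<kappa>x + tx\<close> on the algebra. If it is a contraction \<open>T\<close>, then the pair \<open>R = (k, a)\<close> obtained here
  satisfies \<open>2R = T + R\<^sup>2\<close>, so \<open>1 - R\<close> is a square root of \<open>1 - T\<close>. It is the limit of the iteration
  \<open>R \<mapsto> (T + R\<^sup>2)/2\<close> started at \<open>0\<close>. The steps are dominated by those of the same iteration for the
  number \<open>1\<close>, which increases to a limit.\<close>

lemma affine_sqrt:
  fixes t :: "'a::cstar_algebra" and \<kappa> :: real
  assumes T: "\<And>x. norm (\<kappa> *\<^sub>R x + t * x) \<le> norm x" and \<kappa>: "\<bar>\<kappa>\<bar> \<le> 1"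
  obtains k and a :: 'a where "\<bar>k\<bar> \<le> 1" "2 * k = \<kappa> + k\<^sup>2"
    "2 *\<^sub>R a = t + (2 * k) *\<^sub>R a + a * a"
    "\<And>x. norm (k *\<^sub>R x + a * x) \<le> norm x"
    "\<And>c. c * t = t * c \<Longrightarrow> c * a = a * c"
    "star t = t \<Longrightarrow> star a = a"
proof -
  define s :: "nat \<Rightarrow> real \<times> 'a" where
    "s = rec_nat (0, 0) (\<lambda>_ (k, a). ((\<kappa> + k\<^sup>2) / 2, (1/2) *\<^sub>R (t + (2 * k) *\<^sub>R a + a * a)))"
  define k where "k = (\<lambda>n. fst (s n))"
  define a where "a = (\<lambda>n. snd (s n))"
  \<comment> \<open>The majorant: the same iteration for \<open>T = 1\<close> in the real numbers.\<close>
  define \<rho> :: "nat \<Rightarrow> real" where "\<rho> = rec_nat 0 (\<lambda>_ r. (1 + r\<^sup>2) / 2)"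
  have k0: "k 0 = 0" and a0: "a 0 = 0" and \<rho>0: "\<rho> 0 = 0"
    by (simp_all add: k_def a_def s_def \<rho>_def)
  have kS: "k (Suc n) = (\<kappa> + (k n)\<^sup>2) / 2" for n
    by (simp add: k_def s_def split: prod.split)
  have aS: "a (Suc n) = (1/2) *\<^sub>R (t + (2 * k n) *\<^sub>R a n + a n * a n)" for n
    by (simp add: k_def a_def s_def split: prod.split)
  have \<rho>S: "\<rho> (Suc n) = (1 + (\<rho> n)\<^sup>2) / 2" for n by (simp add: \<rho>_def)
  have \<rho>_bd: "0 \<le> \<rho> n \<and> \<rho> n \<le> 1" for n
  proof (induction n)
    case (Suc n)
    then have "(\<rho> n)\<^sup>2 \<le> 1" by (simp add: power_le_one)
    then show ?case by (simp add: \<rho>S)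
  qed (simp add: \<rho>0)
  have \<rho>_inc: "\<rho> n \<le> \<rho> (Suc n)" for n
    using zero_le_power2[of "1 - \<rho> n"] by (simp add: \<rho>S power2_eq_square algebra_simps)
  have "convergent \<rho>"
  proof (rule Bseq_mono_convergent)
    show "Bseq \<rho>" by (rule BseqI'[where K=1]) (use \<rho>_bd in simp)
    show "\<forall>m n. m \<le> n \<longrightarrow> \<rho> m \<le> \<rho> n"
      using lift_Suc_mono_le[of \<rho>, OF \<rho>_inc] by blast
  qed
  define R where "R = (\<lambda>n x. k n *\<^sub>R x + a n * x)"
  have Rdiff: "R n (x - y) = R n x - R n y" for n x y
    by (simp add: R_def algebra_simps)
  have RS: "R (Suc n) x = (1/2) *\<^sub>R ((\<kappa> *\<^sub>R x + t * x) + R n (R n x))" for n x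
    by (simp add: R_def kS aS algebra_simps power2_eq_square add_divide_distrib,
        simp add: scaleR_left_distrib[symmetric])
  have Rbd: "norm (R n x) \<le> \<rho> n * norm x" for n x
  proof (induction n arbitrary: x)
    case (Suc n)
    have "norm (R n (R n x)) \<le> \<rho> n * (\<rho> n * norm x)"
      using Suc[of "R n x"] mult_left_mono[OF Suc[of x], of "\<rho> n"] \<rho>_bd[of n] by linarith
    then have "norm ((\<kappa> *\<^sub>R x + t * x) + R n (R n x)) \<le> norm x + \<rho> n * (\<rho> n * norm x)"
      using norm_triangle_ineq[of "\<kappa> *\<^sub>R x + t * x" "R n (R n x)"] T[of x] by linarith
    then show ?case
      unfolding RS norm_scaleR by (simp add: \<rho>S power2_eq_square algebra_simps)
  qed (simp add: R_def k0 a0 \<rho>0)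
  have Rinc: "norm (R (Suc n) x - R n x) \<le> (\<rho> (Suc n) - \<rho> n) * norm x" for n x
  proof (induction n arbitrary: x)
    case 0
    show ?case using Rbd[of "Suc 0" x] by (simp add: \<rho>0 R_def k0 a0)
  next
    case (Suc n)
    let ?d = "\<rho> (Suc n) - \<rho> n"
    have eq: "R (Suc (Suc n)) x - R (Suc n) x =
        (1/2) *\<^sub>R ((R (Suc n) (R (Suc n) x - R n x)) + (R (Suc n) (R n x) - R n (R n x)))"
      unfolding Rdiff RS[of "Suc n"] RS[of n x] by (simp add: algebra_simps)
    have 1: "norm (R (Suc n) (R (Suc n) x - R n x)) \<le> \<rho> (Suc n) * (?d * norm x)"
      using Rbd[of "Suc n" "R (Suc n) x - R n x"] mult_left_mono[OF Suc[of x], of "\<rho> (Suc n)"]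
        \<rho>_bd[of "Suc n"] by linarith
    have 2: "norm (R (Suc n) (R n x) - R n (R n x)) \<le> ?d * (\<rho> n * norm x)"
      using Suc[of "R n x"] mult_left_mono[OF Rbd[of n x], of ?d] \<rho>_inc[of n] by linarith
    have "norm (R (Suc (Suc n)) x - R (Suc n) x) \<le> (1/2) * (\<rho> (Suc n) * (?d * norm x) + ?d * (\<rho> n * norm x))"
      unfolding eq norm_scaleR
      using norm_triangle_ineq[of "R (Suc n) (R (Suc n) x - R n x)" "R (Suc n) (R n x) - R n (R n x)"] 1 2
      by simp
    also have "\<dots> = (\<rho> (Suc (Suc n)) - \<rho> (Suc n)) * norm x"
      unfolding \<rho>S[of "Suc n"] using \<rho>S[of n] by (simp add: power2_eq_square field_simps)
    finally show ?case .
  qed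
  have k_abs: "\<bar>k n\<bar> \<le> \<rho> n" for n
  proof (induction n)
    case (Suc n)
    have "(k n)\<^sup>2 \<le> (\<rho> n)\<^sup>2" using Suc \<rho>_bd[of n] abs_le_square_iff[of "k n" "\<rho> n"] by simp
    then have "\<kappa> + (k n)\<^sup>2 \<le> 1 + (\<rho> n)\<^sup>2"
      using abs_le_D1[OF \<kappa>] by linarith
    moreover have "- (\<kappa> + (k n)\<^sup>2) \<le> 1 + (\<rho> n)\<^sup>2"
      using abs_le_D2[OF \<kappa>] zero_le_power2[of "k n"] zero_le_power2[of "\<rho> n"] by linarith
    ultimately have "\<bar>\<kappa> + (k n)\<^sup>2\<bar> \<le> 1 + (\<rho> n)\<^sup>2" by (rule abs_leI)
    then show ?case unfolding kS \<rho>S abs_divide by simp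
  qed (simp add: k0 \<rho>0)
  have k_inc: "\<bar>k (Suc n) - k n\<bar> \<le> \<rho> (Suc n) - \<rho> n" for n
  proof (induction n)
    case 0 show ?case using k_abs[of "Suc 0"] by (simp add: k0 \<rho>0)
  next
    case (Suc n)
    have "k (Suc (Suc n)) - k (Suc n) = (1/2) * ((k (Suc n) - k n) * (k (Suc n) + k n))"
      unfolding kS[of "Suc n"] using kS[of n] by (simp add: power2_eq_square field_simps)
    then have "\<bar>k (Suc (Suc n)) - k (Suc n)\<bar> = (1/2) * (\<bar>k (Suc n) - k n\<bar> * \<bar>k (Suc n) + k n\<bar>)"
      by (simp only: abs_mult)
    also have "\<dots> \<le> (1/2) * ((\<rho> (Suc n) - \<rho> n) * (\<rho> (Suc n) + \<rho> n))"
      using k_abs[of n] k_abs[of "Suc n"] by (intro mult_left_mono mult_mono Suc) (use \<rho>_inc[of n] in auto)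
    also have "\<dots> = \<rho> (Suc (Suc n)) - \<rho> (Suc n)"
      unfolding \<rho>S[of "Suc n"] using \<rho>S[of n] by (simp add: power2_eq_square field_simps)
    finally show ?case .
  qed
  have a_inc: "norm (a (Suc n) - a n) \<le> 2 * (\<rho> (Suc n) - \<rho> n)" for n
  proof (rule norm_le_of_left_mult_le)
    fix x
    have "(a (Suc n) - a n) * x = (R (Suc n) x - R n x) - (k (Suc n) - k n) *\<^sub>R x"
      by (simp add: R_def algebra_simps)
    then have "norm ((a (Suc n) - a n) * x) \<le> norm (R (Suc n) x - R n x) + \<bar>k (Suc n) - k n\<bar> * norm x"
      by (metis norm_scaleR norm_triangle_ineq4)
    also have "\<dots> \<le> (\<rho> (Suc n) - \<rho> n) * norm x + (\<rho> (Suc n) - \<rho> n) * norm x"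
      by (intro add_mono Rinc mult_right_mono k_inc) simp
    finally show "norm ((a (Suc n) - a n) * x) \<le> 2 * (\<rho> (Suc n) - \<rho> n) * norm x"
      by (simp add: algebra_simps)
  qed (use \<rho>_inc[of n] in simp)
  have conv: "convergent f" if inc: "\<And>n. norm (f (Suc n) - f n) \<le> 2 * (\<rho> (Suc n) - \<rho> n)"
    for f :: "nat \<Rightarrow> 'b::{real_normed_vector,complete_space}"
  proof -
    have d: "norm (f (m + j) - f m) \<le> 2 * (\<rho> (m + j) - \<rho> m)" for m j
    proof (induction j)
      case (Suc j)
      have "norm (f (m + Suc j) - f m) \<le> norm (f (Suc (m+j)) - f (m+j)) + norm (f (m + j) - f m)"
        using norm_triangle_ineq[of "f (Suc (m+j)) - f (m+j)" "f (m + j) - f m"] by simp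
      then show ?case using Suc inc[of "m+j"] by simp
    qed simp
    have "Cauchy f"
      unfolding Cauchy_altdef2
    proof (intro allI impI)
      fix e :: real assume "e > 0"
      then obtain N where N: "\<forall>n\<ge>N. dist (\<rho> n) (\<rho> N) < e / 2"
        using convergent_Cauchy[OF \<open>convergent \<rho>\<close>] unfolding Cauchy_altdef2 by (meson half_gt_zero)
      have "dist (f n) (f N) < e" if "n \<ge> N" for n
        using d[of N "n - N"] N that abs_ge_self[of "\<rho> n - \<rho> N"] by (auto simp: dist_norm dest!: spec[of _ n])
      then show "\<exists>N. \<forall>n\<ge>N. dist (f n) (f N) < e" by blast
    qed
    then show ?thesis by (rule Cauchy_convergent)
  qed
  have "norm (k (Suc n) - k n) \<le> 2 * (\<rho> (Suc n) - \<rho> n)" for n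
    using k_inc[of n] \<rho>_inc[of n] by simp
  then obtain K where K: "k \<longlonglongrightarrow> K" using conv[of k] by (auto simp: convergent_def)
  obtain A where A: "a \<longlonglongrightarrow> A" using conv[OF a_inc] by (auto simp: convergent_def)
  note KS = LIMSEQ_Suc[OF K] and AS = LIMSEQ_Suc[OF A]
  have "(\<lambda>n. k (Suc n)) \<longlonglongrightarrow> (\<kappa> + K\<^sup>2) / 2"
    unfolding kS by (intro tendsto_intros K) simp
  then have Keq: "K = (\<kappa> + K\<^sup>2) / 2" using KS LIMSEQ_unique by blast
  have "(\<lambda>n. a (Suc n)) \<longlonglongrightarrow> (1/2) *\<^sub>R (t + (2 * K) *\<^sub>R A + A * A)"
    unfolding aS by (intro tendsto_intros K A)
  then have Aeq: "A = (1/2) *\<^sub>R (t + (2 * K) *\<^sub>R A + A * A)" using AS LIMSEQ_unique by blast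
  show ?thesis
  proof (rule that[of K A])
    show "\<bar>K\<bar> \<le> 1"
      using Lim_bounded[OF tendsto_rabs[OF K], of 0 1] k_abs \<rho>_bd order_trans by blast
    show "2 * K = \<kappa> + K\<^sup>2" using Keq by simp
    show "2 *\<^sub>R A = t + (2 * K) *\<^sub>R A + A * A" by (subst Aeq) simp
    show "norm (K *\<^sub>R x + A * x) \<le> norm x" for x
    proof (rule Lim_bounded)
      show "(\<lambda>n. norm (k n *\<^sub>R x + a n * x)) \<longlonglongrightarrow> norm (K *\<^sub>R x + A * x)"
        by (intro tendsto_intros K A)
      show "\<forall>n\<ge>0. norm (k n *\<^sub>R x + a n * x) \<le> norm x"
        using Rbd[of _ x] \<rho>_bd mult_left_le_one_le[of "norm x"] unfolding R_def
        by (meson norm_ge_zero order_trans)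
    qed
    show "c * A = A * c" if "c * t = t * c" for c
    proof -
      have "c * a n = a n * c" for n
      proof (induction n)
        case (Suc n)
        have "c * (a n * a n) = (a n * a n) * c" by (metis Suc mult.assoc)
        then show ?case using that Suc by (simp add: aS algebra_simps)
      qed (simp add: a0)
      moreover have "(\<lambda>n. c * a n) \<longlonglongrightarrow> c * A" "(\<lambda>n. a n * c) \<longlonglongrightarrow> A * c"
        by (intro tendsto_intros A)+
      ultimately show ?thesis using LIMSEQ_unique by auto
    qed
    show "star A = A" if "star t = t"
    proof -
      have "star (a n) = a n" for n
        by (induction n) (simp_all add: a0 aS star_simps that)
      then have "(\<lambda>n. a n) \<longlonglongrightarrow> star A" using tendsto_star[OF A] by simp
      then show ?thesis using A LIMSEQ_unique by blast
    qed
  qed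
qed

section \<open>Orthogonal decomposition of self-adjoint elements\<close>

text \<open>
  The self-adjoint elements with spectrum in \<open>[0, 2]\<close>, described without the spectrum: \<open>1 - y\<close> is a
  contraction.
\<close>

definition pos_le_two :: "'a::cstar_algebra \<Rightarrow> bool" where
  "pos_le_two y \<longleftrightarrow> star y = y \<and> (\<forall>x. norm (x - y * x) \<le> norm x)"

lemma pos_le_two_sqrt:
  assumes "pos_le_two y"
  obtains h where "pos_le_two h" "h * h = y" "\<And>c. c * y = y * c \<Longrightarrow> c * h = h * c"
proof -
  have y: "star y = y" "\<And>x. norm (1 *\<^sub>R x + (- y) * x) \<le> norm x"
    using assms by (simp_all add: pos_le_two_def)
  obtain k a where k: "2 * k = 1 + k\<^sup>2"
    and a: "2 *\<^sub>R a = - y + (2 * k) *\<^sub>R a + a * a"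
      "\<And>x. norm (k *\<^sub>R x + a * x) \<le> norm x"
      "\<And>c. c * - y = - y * c \<Longrightarrow> c * a = a * c" "star (- y) = - y \<Longrightarrow> star a = a"
    using affine_sqrt[of 1 "- y"] y(2) by (metis abs_1 order_refl)
  have "(k - 1)\<^sup>2 = 0" using k by (simp add: power2_diff)
  then have k1: "k = 1" by simp
  show ?thesis
  proof (rule that[of "- a"])
    show "pos_le_two (- a)"
      using a(2,4) y by (simp add: pos_le_two_def k1 star_minus)
    show "- a * - a = y" using a(1) k1 by (simp add: eq_neg_iff_add_eq_0 add.commute)
    show "c * - a = - a * c" if "c * y = y * c" for c
      using a(3)[of c] that by simp
  qed
qed

text \<open>Let \<open>s\<close> be the operator \<open>\<surd>(1 - b\<^sup>2)\<close> given by the iteration. Then \<open>b + \<i>s\<close> and \<open>b - \<i>s\<close> act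
  isometrically, since \<open>b\<^sup>2 + s\<^sup>2 = 1\<close>. So \<open>s\<close>, a multiple of their difference, is a contraction, and
  so is \<open>s\<^sup>2 = 1 - b\<^sup>2\<close>.\<close>

lemma pos_le_two_square:
  fixes b :: "'a::cstar_algebra"
  assumes b: "star b = b" "norm b \<le> 1"
  shows "pos_le_two (b * b)"
proof -
  have "norm (0 *\<^sub>R x + (b * b) * x) \<le> norm x" for x
  proof -
    have "norm (b * b * x) \<le> norm (b * b) * norm x" by (rule norm_mult_ineq)
    also have "\<dots> \<le> 1 * norm x"
      using b by (intro mult_right_mono) (simp_all add: norm_selfadjoint_square power_le_one)
    finally show ?thesis by simp
  qed
  then obtain k a where k: "\<bar>k\<bar> \<le> 1" "2 * k = 0 + k\<^sup>2"
    and a: "2 *\<^sub>R a = b * b + (2 * k) *\<^sub>R a + a * a"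
      "\<And>c. c * (b * b) = b * b * c \<Longrightarrow> c * a = a * c" "star (b * b) = b * b \<Longrightarrow> star a = a"
    using affine_sqrt[of 0 "b * b"] by (metis abs_zero zero_le_one)
  have "k * (2 - k) = 0" using k(2) by (simp add: algebra_simps power2_eq_square)
  then have k0: "k = 0" using k(1) by auto
  have ba: "b * a = a * b" by (rule a(2)) (simp add: mult.assoc)
  have sa: "star a = a" by (rule a(3)) (simp add: star_mult b)
  have bb: "b * b = 2 *\<^sub>R a - a * a" using a(1) by (simp add: k0)
  define s where "s = (\<lambda>x. x - a * x)"
  have ss: "s (s x) = x - b * b * x" for x
    by (simp add: s_def bb algebra_simps scaleR_2)
  have iso: "norm (b * x + c *\<^sub>C s x) = norm x" if c: "c = \<i> \<or> c = - \<i>" for c x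
  proof -
    have cc: "cnj c * c = 1" "cnj c = - c" using c by auto
    have 1: "star (b * x) * (b * x) + star (s x) * s x = star x * x"
    proof -
      have "star (s x) * s x = star x * (s (s x))"
        by (simp add: s_def star_simps sa algebra_simps)
      moreover have "star (b * x) * (b * x) = star x * (b * b * x)"
        by (simp add: star_mult b mult.assoc)
      ultimately show ?thesis by (simp add: ss algebra_simps)
    qed
    have 2: "star (b * x) * s x = star (s x) * (b * x)"
    proof -
      have "star (b * x) * s x = star x * (b * x) - star x * (b * a * x)"
        by (simp add: s_def star_simps b algebra_simps)
      also have "\<dots> = star (s x) * (b * x)"
        by (simp add: ba s_def star_simps sa algebra_simps)
      finally show ?thesis .
    qed
    have "star (b * x + c *\<^sub>C s x) * (b * x + c *\<^sub>C s x) =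
        star (b * x) * (b * x) + (cnj c * c) *\<^sub>C (star (s x) * s x) +
        c *\<^sub>C (star (b * x) * s x) + cnj c *\<^sub>C (star (s x) * (b * x))"
      by (simp add: star_add star_scaleC distrib_left distrib_right scaleC_mult_left
          scaleC_mult_right scaleC_scaleC scaleC_add_right mult.commute)
    also have "\<dots> = star x * x"
      by (simp only: cc(1) 2) (simp add: cc(2) scaleC_minus_left 1[symmetric])
    finally have "norm (star (b * x + c *\<^sub>C s x) * (b * x + c *\<^sub>C s x)) = norm (star x * x)"
      by simp
    then show ?thesis by (simp only: cstar_identity) simp
  qed
  have sbd: "norm (s x) \<le> norm x" for x
  proof -
    have "(b * x + \<i> *\<^sub>C s x) - (b * x + (- \<i>) *\<^sub>C s x) = (2 * \<i>) *\<^sub>C s x"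
      by (simp add: scaleC_minus_left scaleC_add_left[symmetric])
    then have "2 * norm (s x) = norm ((b * x + \<i> *\<^sub>C s x) - (b * x + (- \<i>) *\<^sub>C s x))"
      by (simp add: norm_scaleC norm_mult)
    also have "\<dots> \<le> norm x + norm x"
      using norm_triangle_ineq4 iso by metis
    finally show ?thesis by simp
  qed
  show ?thesis
    unfolding pos_le_two_def ss[symmetric]
    using order_trans[OF sbd sbd] by (auto simp: star_mult b)
qed

text \<open>Used with \<open>y\<close> the positive or negative part of some \<open>b\<close> and \<open>h = |b|\<close>. The hypothesis \<open>y\<^sup>2 = yh\<close> gives
  \<open>(1 - y)\<^sup>m = 1 - y(1 + r + \<dots> + r\<^bsup>m-1\<^esup>)\<close> with the contraction \<open>r = 1 - h\<close>, so the powers of \<open>1 - y\<close>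
  grow at most linearly. For a self-adjoint operator the C*-identity turns this into norm at most \<open>1\<close>:
  squaring the operator squares its norm, and a norm above \<open>1\<close> would force exponential growth.\<close>

lemma pos_le_two_if_square_eq:
  fixes y h :: "'a::cstar_algebra"
  assumes y: "star y = y" and h: "pos_le_two h" and yh: "y * y = y * h"
  shows "pos_le_two y"
proof -
  define T where "T = (\<lambda>x. x - y * x)"
  define S :: "nat \<Rightarrow> 'a \<Rightarrow> 'a" where
    "S = (\<lambda>m x. rec_nat 0 (\<lambda>_ s. x + (s - h * s)) m)"
  have S0: "S 0 x = 0" and SS: "S (Suc m) x = x + (S m x - h * S m x)" for m x
    by (simp_all add: S_def)
  have S_bd: "norm (S m x) \<le> m * norm x" for m x
  proof (induction m)
    case (Suc m)
    have "norm (S (Suc m) x) \<le> norm x + norm (S m x - h * S m x)"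
      unfolding SS by (rule norm_triangle_ineq)
    also have "\<dots> \<le> norm x + norm (S m x)" using h by (simp add: pos_le_two_def)
    finally show ?case using Suc by (simp add: algebra_simps)
  qed (simp add: S0)
  have T_S: "(T ^^ m) x = x - y * S m x" for m x
  proof (induction m)
    case (Suc m)
    have "y * (y * S m x) = y * (h * S m x)" by (metis yh mult.assoc)
    moreover have "(T ^^ Suc m) x = T (x - y * S m x)" by (simp add: Suc)
    ultimately show ?case by (simp add: T_def SS algebra_simps)
  qed (simp add: S0)
  have T_bd: "norm ((T ^^ m) x) \<le> (1 + m * norm y) * norm x" for m x
  proof -
    have "norm ((T ^^ m) x) \<le> norm x + norm y * norm (S m x)"
      unfolding T_S using norm_triangle_ineq4[of x "y * S m x"] norm_mult_ineq[of y "S m x"] by linarith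
    also have "\<dots> \<le> norm x + norm y * (m * norm x)"
      by (intro add_left_mono mult_left_mono S_bd) simp
    finally show ?thesis by (simp add: algebra_simps)
  qed
  have T_adj: "star ((T ^^ m) u) * v = star u * (T ^^ m) v" for m u v
  proof (induction m arbitrary: u v)
    case (Suc m)
    have 1: "star (T u) * v = star u * T v" for u v
      by (simp add: T_def star_simps y algebra_simps)
    show ?case by (simp add: 1 Suc funpow_swap1)
  qed simp
  have T_double: "(norm ((T ^^ m) x))\<^sup>2 \<le> norm x * norm ((T ^^ (2 * m)) x)" for m x
  proof -
    have "(norm ((T ^^ m) x))\<^sup>2 = norm (star x * (T ^^ m) ((T ^^ m) x))"
      by (simp add: cstar_identity[symmetric] T_adj)
    also have "(T ^^ m) ((T ^^ m) x) = (T ^^ (2 * m)) x"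
      by (simp add: mult_2 funpow_add)
    finally show ?thesis using norm_mult_ineq[of "star x"] by simp
  qed
  have "norm (T x) \<le> norm x" for x
  proof (cases "x = 0")
    case False
    define q where "q = norm (T x) / norm x"
    have q_pow: "q ^ (2 ^ k) \<le> norm ((T ^^ (2 ^ k)) x) / norm x" for k
    proof (induction k)
      case (Suc k)
      have "q ^ (2 ^ Suc k) = (q ^ (2 ^ k))\<^sup>2" by (simp add: power_mult[symmetric] mult.commute)
      also have "\<dots> \<le> (norm ((T ^^ (2 ^ k)) x) / norm x)\<^sup>2"
        by (intro power_mono Suc) (simp add: q_def)
      also have "\<dots> \<le> (norm x * norm ((T ^^ (2 * 2 ^ k)) x)) / (norm x)\<^sup>2"
        unfolding power_divide by (intro divide_right_mono T_double) simp
      finally show ?case using False by (simp add: power2_eq_square)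
    qed (simp add: q_def)
    have "q \<le> 1"
    proof (rule ccontr)
      assume "\<not> q \<le> 1"
      define d where "d = q - 1"
      have d: "d > 0" using \<open>\<not> q \<le> 1\<close> by (simp add: d_def)
      obtain j :: nat where j: "2 * norm y / d\<^sup>2 < j" using reals_Archimedean2 by blast
      \<comment> \<open>Bernoulli alone gives linear growth; squaring it once gives the quadratic growth that contradicts \<open>T_bd\<close>.\<close>
      define m :: nat where "m = 2 ^ j"
      have mj: "j < m" by (simp add: m_def)
      have "1 + m * d \<le> q ^ m"
        using Bernoulli_inequality[of d m] d by (simp add: d_def)
      then have "(1 + m * d)\<^sup>2 \<le> (q ^ m)\<^sup>2" using d by (intro power_mono) auto
      also have "\<dots> = q ^ (2 ^ Suc j)" by (simp add: m_def power_mult[symmetric] mult.commute)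
      also have "\<dots> \<le> norm ((T ^^ (2 ^ Suc j)) x) / norm x" by (rule q_pow)
      also have "\<dots> \<le> 1 + 2 * m * norm y"
        using T_bd[of "2 ^ Suc j" x] False by (simp add: m_def divide_le_eq)
      finally have "m * (m * d\<^sup>2) \<le> m * (2 * norm y)"
        using d by (simp add: power2_eq_square algebra_simps) (smt (verit) mult_nonneg_nonneg of_nat_0_le_iff)
      then have "m * d\<^sup>2 \<le> 2 * norm y" by (simp add: m_def)
      moreover have "2 * norm y < j * d\<^sup>2" using j d by (simp add: divide_less_eq)
      moreover have "j * d\<^sup>2 \<le> m * d\<^sup>2" using mj by (intro mult_right_mono) simp_all
      ultimately show False by linarith
    qed
    then show ?thesis using False by (simp add: q_def divide_le_eq)
  qed (simp add: T_def)
  then show ?thesis using y by (simp add: pos_le_two_def T_def)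
qed

text \<open>With \<open>h = |b|\<close>, the square root of \<open>b\<^sup>2\<close>, the parts are \<open>(h + b)/2\<close> and \<open>(h - b)/2\<close>. They are orthogonal
  because \<open>h\<^sup>2 = b\<^sup>2\<close> and \<open>h\<close> commutes with \<open>b\<close>.\<close>

lemma orthogonal_decomposition_unit_ball:
  fixes b :: "'a::cstar_algebra"
  assumes b: "star b = b" "norm b \<le> 1"
  obtains y z where "b = y - z" "y * z = 0" "z * y = 0" "pos_le_two y" "pos_le_two z"
proof -
  obtain h where h: "pos_le_two h" "h * h = b * b" and hc: "\<And>c. c * (b * b) = b * b * c \<Longrightarrow> c * h = h * c"
    using pos_le_two_sqrt[OF pos_le_two_square[OF b]] by metis
  have bh: "b * h = h * b" by (rule hc) (simp add: mult.assoc)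
  have sh: "star h = h" using h by (simp add: pos_le_two_def)
  define y z where "y = (1/2) *\<^sub>R (h + b)" and "z = (1/2) *\<^sub>R (h - b)"
  have yz: "y * z = 0" "z * y = 0"
    by (simp_all add: y_def z_def algebra_simps h(2) bh)
  have sum: "h = y + z" by (simp add: y_def z_def algebra_simps scaleR_add_left[symmetric])
  have sa: "star y = y" "star z = z" by (simp_all add: y_def z_def star_simps sh b)
  show ?thesis
  proof (rule that[OF _ yz])
    show "b = y - z" by (simp add: y_def z_def algebra_simps scaleR_add_left[symmetric])
    show "pos_le_two y"
      by (rule pos_le_two_if_square_eq[OF sa(1) h(1)]) (simp add: sum distrib_left yz)
    show "pos_le_two z"
      by (rule pos_le_two_if_square_eq[OF sa(2) h(1)]) (simp add: sum distrib_left yz)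
  qed
qed

lemma pos_le_two_convex:
  assumes "pos_le_two x" "pos_le_two y" "0 \<le> s" "0 \<le> t" "s + t = 1"
  shows "pos_le_two (s *\<^sub>R x + t *\<^sub>R y)"
proof -
  have "norm (v - (s *\<^sub>R x + t *\<^sub>R y) * v) \<le> norm v" for v
  proof -
    have "s *\<^sub>R (v - x * v) + t *\<^sub>R (v - y * v) = (s + t) *\<^sub>R v - (s *\<^sub>R x + t *\<^sub>R y) * v"
      by (simp add: algebra_simps)
    then have "v - (s *\<^sub>R x + t *\<^sub>R y) * v = s *\<^sub>R (v - x * v) + t *\<^sub>R (v - y * v)"
      using assms(5) by simp
    also have "norm \<dots> \<le> s * norm (v - x * v) + t * norm (v - y * v)"
      using norm_triangle_ineq[of "s *\<^sub>R (v - x * v)" "t *\<^sub>R (v - y * v)"] assms by simp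
    also have "\<dots> \<le> s * norm v + t * norm v"
      using assms by (intro add_mono mult_left_mono) (auto simp: pos_le_two_def)
    also have "\<dots> = norm v" using assms(5) by (metis distrib_right mult_1)
    finally show ?thesis .
  qed
  then show ?thesis using assms by (simp add: pos_le_two_def star_simps)
qed

lemma pos_le_two_cstar_pos: "pos_le_two y \<Longrightarrow> y \<in> cstar_pos"
  unfolding cstar_pos_def pos_le_two_def by (smt (verit) mem_Collect_eq pos_le_two_def pos_le_two_sqrt)

lemma cstar_pos_scaleR:
  assumes "x \<in> cstar_pos" "0 \<le> r"
  shows "r *\<^sub>R x \<in> (cstar_pos :: 'a::cstar_algebra set)"
proof -
  obtain b where "x = star b * b" using assms by (auto simp: cstar_pos_def)
  then have "r *\<^sub>R x = star (sqrt r *\<^sub>R b) * (sqrt r *\<^sub>R b)" using assms by (simp add: star_scaleR)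
  then show ?thesis unfolding cstar_pos_def by blast
qed

lemma cstar_pos_star: "x \<in> cstar_pos \<Longrightarrow> star x = x"
  by (auto simp: cstar_pos_def star_simps)

lemma square_cstar_pos: "star b = b \<Longrightarrow> b * b \<in> cstar_pos"
  unfolding cstar_pos_def by (intro CollectI exI[of _ b]) simp

lemma orthogonal_decomposition:
  fixes b :: "'a::cstar_algebra"
  assumes b: "star b = b"
  obtains y z where "b = y - z" "y * z = 0" "z * y = 0" "y \<in> cstar_pos" "z \<in> cstar_pos"
proof (cases "b = 0")
  case True
  have "(0::'a) \<in> cstar_pos" using square_cstar_pos[of 0] by simp
  then show ?thesis using that[of 0 0] True by simp
next
  case False
  define c where "c = (1 / norm b) *\<^sub>R b"
  have c: "star c = c" "norm c \<le> 1" "b = norm b *\<^sub>R c" using False b by (simp_all add: c_def star_scaleR)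
  obtain y z where yz: "c = y - z" "y * z = 0" "z * y = 0" "pos_le_two y" "pos_le_two z"
    using orthogonal_decomposition_unit_ball c by metis
  show ?thesis
  proof (rule that[of "norm b *\<^sub>R y" "norm b *\<^sub>R z"])
    show "b = norm b *\<^sub>R y - norm b *\<^sub>R z" using c(3) yz(1) by (simp add: scaleR_diff_right)
  qed (use yz in \<open>simp_all add: cstar_pos_scaleR pos_le_two_cstar_pos\<close>)
qed

section \<open>Projections onto closed convex sets\<close>

lemma cinner_add_left: "cinner (x + y) z = cinner x z + cinner y (z::'h::chilbert_space)"
  by (subst (1 2 3) cinner_commute) (simp add: cinner_add_right)

lemma cinner_scaleC_left: "cinner (c *\<^sub>C x) y = cnj c * cinner x (y::'h::chilbert_space)"
  by (subst (1 2) cinner_commute) (simp add: cinner_scaleC_right)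

lemma cinner_self: "cinner x x = complex_of_real ((norm (x::'h::chilbert_space))\<^sup>2)"
proof (rule complex_eqI)
  show "Re (cinner x x) = Re (complex_of_real ((norm x)\<^sup>2))"
    by (simp add: inner_eq_Re_cinner[symmetric] power2_norm_eq_inner)
  show "Im (cinner x x) = Im (complex_of_real ((norm x)\<^sup>2))"
    using arg_cong[OF cinner_commute[of x x], of Im] by simp
qed

lemma norm_scaleC_hilbert: "norm (c *\<^sub>C x) = cmod c * norm (x::'h::chilbert_space)"
proof -
  have "complex_of_real ((norm (c *\<^sub>C x))\<^sup>2) = complex_of_real ((cmod c * norm x)\<^sup>2)"
    unfolding cinner_self[symmetric] cinner_scaleC_left cinner_scaleC_right
    unfolding power_mult_distrib of_real_mult complex_norm_square by (simp add: cinner_self)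
  then have "(norm (c *\<^sub>C x))\<^sup>2 = (cmod c * norm x)\<^sup>2" by (simp only: of_real_eq_iff)
  then show ?thesis by (simp add: power2_eq_iff_nonneg)
qed

lemma bounded_linear_scaleC: "bounded_linear (\<lambda>x::'h::chilbert_space. c *\<^sub>C x)"
  by (rule bounded_linear_intro[where K="cmod c"])
    (simp_all add: scaleC_add_right norm_scaleC_hilbert scaleR_scaleC scaleC_scaleC mult.commute)

text \<open>The parallelogram law makes almost minimal elements of decreasing midpoint-convex sets close to each
  other. The quadratic form is kept abstract so that this serves both for the norm, to obtain
  projections, and for the form norm, which lives only on the domain of a form.\<close>

lemma minimizing_sequence_Cauchy:
  fixes q :: "'v::real_vector \<Rightarrow> real" and D :: "nat \<Rightarrow> 'v set"
  assumes nonneg: "\<And>x. x \<in> D 0 \<Longrightarrow> 0 \<le> q x"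
    and par: "\<And>x y. x \<in> D 0 \<Longrightarrow> y \<in> D 0 \<Longrightarrow> q (x - y) = 2 * q x + 2 * q y - 4 * q ((1/2) *\<^sub>R (x + y))"
    and mid: "\<And>n x y. x \<in> D n \<Longrightarrow> y \<in> D n \<Longrightarrow> (1/2) *\<^sub>R (x + y) \<in> D n"
    and dec: "\<And>m n. m \<le> n \<Longrightarrow> D n \<subseteq> D m"
    and bdd: "\<And>n. \<exists>x\<in>D n. q x \<le> M"
  obtains y where "\<And>n. y n \<in> D n" "\<And>n z. z \<in> D n \<Longrightarrow> q (y n) \<le> q z + 1 / Suc n"
    "\<And>e. e > 0 \<Longrightarrow> \<exists>K. \<forall>m\<ge>K. \<forall>n\<ge>K. q (y m - y n) < e"
proof -
  define \<alpha> where "\<alpha> = (\<lambda>n. Inf (q ` D n))"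
  have D0: "x \<in> D 0" if "x \<in> D n" for x n using that dec[of 0 n] by auto
  have bb: "bdd_below (q ` D n)" for n using nonneg D0 by (intro bdd_belowI2[where m=0]) blast
  have ne: "q ` D n \<noteq> {}" for n using bdd[of n] by auto
  have \<alpha>_le: "\<alpha> n \<le> q x" if "x \<in> D n" for n x
    unfolding \<alpha>_def using that bb by (intro cInf_lower) auto
  have \<alpha>_M: "\<alpha> n \<le> M" for n using bdd[of n] \<alpha>_le order_trans by blast
  have \<alpha>_mono: "\<alpha> m \<le> \<alpha> n" if "m \<le> n" for m n
    unfolding \<alpha>_def using dec[OF that] by (intro cInf_superset_mono ne bb) auto
  have "\<exists>x\<in>D n. q x < \<alpha> n + 1 / Suc n" for n
    using cInf_lessD[OF ne[of n], of "\<alpha> n + 1 / Suc n"] unfolding \<alpha>_def by auto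
  then obtain y where y: "\<And>n. y n \<in> D n" "\<And>n. q (y n) < \<alpha> n + 1 / Suc n" by metis
  have inc: "incseq \<alpha>" using \<alpha>_mono by (simp add: incseq_def)
  obtain A where A: "\<alpha> \<longlonglongrightarrow> A" "\<And>n. \<alpha> n \<le> A"
    using incseq_convergent[OF inc, of M] \<alpha>_M by blast
  show ?thesis
  proof (rule that[OF y(1)])
    show "q (y n) \<le> q z + 1 / Suc n" if "z \<in> D n" for n z
      using \<alpha>_le[OF that] y(2)[of n] by linarith
    fix e :: real assume e: "e > 0"
    have "(\<lambda>n. 4 * (A - \<alpha> n) + 4 * (1 / Suc n)) \<longlonglongrightarrow> 4 * (A - A) + 4 * 0"
      by (intro tendsto_intros A(1) LIMSEQ_Suc[OF lim_1_over_n])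
    then have "eventually (\<lambda>n. 4 * (A - \<alpha> n) + 4 * (1 / Suc n) < e) sequentially"
      using e by (simp add: order_tendstoD(2))
    then obtain K where K: "4 * (A - \<alpha> K) + 4 * (1 / Suc K) < e"
      by (auto simp: eventually_sequentially)
    have "q (y m - y n) < e" if mn: "m \<ge> K" "n \<ge> K" for m n
    proof -
      have "y m \<in> D K" "y n \<in> D K" using y(1) dec mn by blast+
      then have "\<alpha> K \<le> q ((1/2) *\<^sub>R (y m + y n))" by (intro \<alpha>_le mid)
      moreover have "q (y m - y n) = 2 * q (y m) + 2 * q (y n) - 4 * q ((1/2) *\<^sub>R (y m + y n))"
        using y(1) D0 by (intro par) blast+
      moreover have "1 / real (Suc m) \<le> 1 / Suc K" "1 / real (Suc n) \<le> 1 / Suc K"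
        using mn by (simp_all add: frac_le)
      ultimately have "q (y m - y n) < 2 * (A + 1 / Suc K) + 2 * (A + 1 / Suc K) - 4 * \<alpha> K"
        using y(2)[of m] y(2)[of n] A(2)[of m] A(2)[of n] by argo
      then show ?thesis using K by argo
    qed
    then show "\<exists>K. \<forall>m\<ge>K. \<forall>n\<ge>K. q (y m - y n) < e" by blast
  qed
qed

lemma nearest_props:
  fixes C :: "'h::{real_inner,complete_space} set"
  assumes C: "closed C" "convex C" "C \<noteq> {}"
  shows nearest_in: "nearest dist C x \<in> C"
    and nearest_dot: "z \<in> C \<Longrightarrow> inner (x - nearest dist C x) (z - nearest dist C x) \<le> 0"
proof -
  obtain c0 where c0: "c0 \<in> C" using C by auto
  define D where "D = (\<lambda>_::nat. (\<lambda>c. x - c) ` C)"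
  have nn: "0 \<le> (norm v)\<^sup>2" if "v \<in> D 0" for v by simp
  have par: "(norm (u - v))\<^sup>2 = 2 * (norm u)\<^sup>2 + 2 * (norm v)\<^sup>2 - 4 * (norm ((1 / 2) *\<^sub>R (u + v)))\<^sup>2"
    if "u \<in> D 0" "v \<in> D 0" for u v
  proof -
    have "(norm (u - v))\<^sup>2 + (norm (u + v))\<^sup>2 = 2 * (norm u)\<^sup>2 + 2 * (norm v)\<^sup>2"
      by (simp add: power2_norm_eq_inner inner_simps inner_commute)
    moreover have "4 * (norm ((1 / 2) *\<^sub>R (u + v)))\<^sup>2 = (norm (u + v))\<^sup>2"
      by (simp only: norm_scaleR power_mult_distrib) (simp add: power2_eq_square)
    ultimately show ?thesis by linarith
  qed
  have mid: "(1/2) *\<^sub>R (u + v) \<in> D n" if uv: "u \<in> D n" "v \<in> D n" for n u v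
  proof -
    obtain a b where ab: "a \<in> C" "b \<in> C" "u = x - a" "v = x - b"
      using uv unfolding D_def by blast
    have "(1/2) *\<^sub>R a + (1/2) *\<^sub>R b \<in> C" using C(2) ab by (intro convexD) auto
    moreover have "(1/2) *\<^sub>R (u + v) = x - ((1/2) *\<^sub>R a + (1/2) *\<^sub>R b)"
      unfolding ab by (simp add: algebra_simps scaleR_left_distrib[symmetric])
    ultimately show ?thesis by (auto simp: D_def)
  qed
  have dec: "D n \<subseteq> D m" if "m \<le> n" for m n by (simp add: D_def)
  have bdd: "\<exists>v\<in>D n. (norm v)\<^sup>2 \<le> (norm (x - c0))\<^sup>2" for n
    by (rule bexI[of _ "x - c0"]) (use c0 in \<open>simp_all add: D_def\<close>)
  obtain y where y: "\<And>n. y n \<in> D n" "\<And>n z. z \<in> D n \<Longrightarrow> (norm (y n))\<^sup>2 \<le> (norm z)\<^sup>2 + 1 / Suc n"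
    and cau: "\<And>e. e > 0 \<Longrightarrow> \<exists>K. \<forall>m\<ge>K. \<forall>n\<ge>K. (norm (y m - y n))\<^sup>2 < e"
    using minimizing_sequence_Cauchy[of D "\<lambda>v. (norm v)\<^sup>2", OF nn par mid dec bdd] by blast
  have "Cauchy y"
    unfolding Cauchy_altdef2
  proof (intro allI impI)
    fix e :: real assume "e > 0"
    then have "e\<^sup>2 > 0" by simp
    from cau[OF this] obtain K where K: "\<forall>m\<ge>K. \<forall>n\<ge>K. (norm (y m - y n))\<^sup>2 < e\<^sup>2" by blast
    have "dist (y n) (y K) < e" if "n \<ge> K" for n
      unfolding dist_norm
      by (rule power2_less_imp_less) (use K that \<open>e > 0\<close> in simp_all)
    then show "\<exists>N. \<forall>n\<ge>N. dist (y n) (y N) < e" by blast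
  qed
  then obtain l where l: "y \<longlonglongrightarrow> l" using Cauchy_convergent convergent_def by blast
  have "x - y n \<in> C" for n
    using y(1)[of n] unfolding D_def by force
  then have pC: "x - l \<in> C"
    using closed_sequentially[OF C(1), of "\<lambda>n. x - y n"] tendsto_diff[OF tendsto_const l] by blast
  have pmin: "\<forall>z\<in>C. dist x (x - l) \<le> dist x z"
  proof
    fix z assume "z \<in> C"
    have "(norm l)\<^sup>2 \<le> (norm (x - z))\<^sup>2 + 0"
    proof (rule LIMSEQ_le)
      show "(\<lambda>n. (norm (y n))\<^sup>2) \<longlonglongrightarrow> (norm l)\<^sup>2" by (intro tendsto_intros l)
      show "(\<lambda>n. (norm (x - z))\<^sup>2 + 1 / Suc n) \<longlonglongrightarrow> (norm (x - z))\<^sup>2 + 0"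
        by (rule tendsto_add[OF tendsto_const LIMSEQ_Suc[OF lim_1_over_n]])
      show "\<exists>N. \<forall>n\<ge>N. (norm (y n))\<^sup>2 \<le> (norm (x - z))\<^sup>2 + 1 / Suc n"
      proof -
        have "x - z \<in> D n" for n using \<open>z \<in> C\<close> by (simp add: D_def)
        then show ?thesis using y(2) by blast
      qed
    qed
    then have "norm l \<le> norm (x - z)" using power2_le_imp_le[of "norm l" "norm (x - z)"] by simp
    then show "dist x (x - l) \<le> dist x z" by (simp add: dist_norm)
  qed
  have eq: "nearest dist C x = x - l"
    unfolding nearest_def
  proof (rule the_equality)
    show "x - l \<in> C \<and> (\<forall>z\<in>C. dist x (x - l) \<le> dist x z)" using pC pmin by blast
  next
    fix y assume "y \<in> C \<and> (\<forall>z\<in>C. dist x y \<le> dist x z)"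
    then have "y \<in> C" "\<forall>z\<in>C. dist x y \<le> dist x z" by simp_all
    then show "y = x - l" using any_closest_point_unique[OF C(2,1) _ pC _ pmin] by simp
  qed
  show "nearest dist C x \<in> C" using eq pC by simp
  show "inner (x - nearest dist C x) (z - nearest dist C x) \<le> 0" if "z \<in> C"
    unfolding eq by (rule any_closest_point_dot[OF C(2,1) pC that pmin])
qed

lemma nearest_eqI:
  fixes C :: "'h::{real_inner,complete_space} set"
  assumes C: "closed C" "convex C" and p: "p \<in> C" "\<And>z. z \<in> C \<Longrightarrow> inner (x - p) (z - p) \<le> 0"
  shows "nearest dist C x = p"
proof -
  let ?n = "nearest dist C x"
  have ne: "C \<noteq> {}" using p by auto
  have "inner (x - ?n) (p - ?n) \<le> 0" "inner (x - p) (?n - p) \<le> 0"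
    using nearest_dot[OF C ne p(1)] p(2) nearest_in[OF C ne] by blast+
  then have "inner (?n - p) (?n - p) \<le> 0" by (simp add: inner_simps inner_commute algebra_simps)
  then show ?thesis using inner_ge_zero[of "?n - p"] by (simp add: order_antisym)
qed

lemma nearest_nonexpansive:
  fixes C :: "'h::{real_inner,complete_space} set"
  assumes C: "closed C" "convex C" "C \<noteq> {}"
  shows "norm (nearest dist C x - nearest dist C y) \<le> norm (x - y)"
proof -
  let ?p = "nearest dist C x" and ?q = "nearest dist C y"
  have "inner (x - ?p) (?q - ?p) \<le> 0" "inner (y - ?q) (?p - ?q) \<le> 0"
    using nearest_dot[OF C] nearest_in[OF C] by blast+
  then have "inner (?p - ?q) (?p - ?q) \<le> inner (x - y) (?p - ?q)"
    by (simp add: inner_simps inner_commute algebra_simps)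
  also have "\<dots> \<le> norm (x - y) * norm (?p - ?q)" by (rule norm_cauchy_schwarz)
  finally have "norm (?p - ?q) * norm (?p - ?q) \<le> norm (x - y) * norm (?p - ?q)"
    by (simp add: power2_norm_eq_inner[symmetric] power2_eq_square)
  then show ?thesis by (cases "norm (?p - ?q) = 0") (auto simp: mult_le_cancel_right)
qed

lemma nearest_tendsto:
  fixes C :: "'h::{real_inner,complete_space} set"
  assumes C: "closed C" "convex C" "C \<noteq> {}" and lim: "(f \<longlongrightarrow> x) G"
  shows "((\<lambda>n. nearest dist C (f n)) \<longlongrightarrow> nearest dist C x) G"
proof (rule LIM_zero_cancel, rule Lim_null_comparison)
  show "\<forall>\<^sub>F n in G. norm (nearest dist C (f n) - nearest dist C x) \<le> norm (f n - x)"
    by (simp add: nearest_nonexpansive[OF C])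
  show "((\<lambda>n. norm (f n - x)) \<longlongrightarrow> 0) G"
    using tendsto_norm_zero[OF LIM_zero[OF lim]] .
qed

text \<open>The distances to the sets increase to a finite limit, and the obtuse-angle inequality bounds the
  distance of two projections by the difference of the squared distances.\<close>

lemma nearest_Inter_tendsto:
  fixes C :: "nat \<Rightarrow> 'h::{real_inner,complete_space} set"
  assumes C: "\<And>n. closed (C n)" "\<And>n. convex (C n)" and dec: "\<And>m n. m \<le> n \<Longrightarrow> C n \<subseteq> C m"
    and ne: "(\<Inter>n. C n) \<noteq> {}"
  shows "(\<lambda>n. nearest dist (C n) x) \<longlonglongrightarrow> nearest dist (\<Inter>n. C n) x"
proof -
  obtain c where c: "\<And>n. c \<in> C n" using ne by auto
  have ne': "C n \<noteq> {}" for n using c by auto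
  define p where "p = (\<lambda>n. nearest dist (C n) x)"
  have pC: "p n \<in> C n" for n unfolding p_def by (intro nearest_in C ne')
  have pdot: "inner (x - p n) (z - p n) \<le> 0" if "z \<in> C n" for n z
    unfolding p_def using that by (intro nearest_dot C ne')
  have ineq: "(norm (z - p n))\<^sup>2 \<le> (norm (x - z))\<^sup>2 - (norm (x - p n))\<^sup>2" if "z \<in> C n" for n z
    using pdot[OF that] by (simp add: power2_norm_eq_inner inner_simps inner_commute algebra_simps)
  define a where "a = (\<lambda>n. (norm (x - p n))\<^sup>2)"
  have ineq': "(norm (p m - p n))\<^sup>2 \<le> a m - a n" if "n \<le> m" for m n
    unfolding a_def using ineq[of "p m" n] pC dec[OF that] by blast
  have "a n \<le> a m" if "n \<le> m" for m n
    using ineq'[OF that] zero_le_power2[of "norm (p m - p n)"] by linarith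
  then have "incseq a" by (simp add: incseq_def)
  moreover have "a n \<le> (norm (x - c))\<^sup>2" for n
    using ineq[OF c[of n]] zero_le_power2[of "norm (c - p n)"] unfolding a_def by linarith
  ultimately have "convergent a"
    using incseq_convergent[of a "(norm (x - c))\<^sup>2"] unfolding convergent_def by blast
  have "Cauchy p"
    unfolding Cauchy_altdef2
  proof (intro allI impI)
    fix e :: real assume "e > 0"
    then obtain N where N: "\<forall>n\<ge>N. dist (a n) (a N) < e\<^sup>2"
      using convergent_Cauchy[OF \<open>convergent a\<close>] unfolding Cauchy_altdef2 by (meson zero_less_power)
    have "dist (p n) (p N) < e" if "n \<ge> N" for n
    proof -
      have "(norm (p n - p N))\<^sup>2 < e\<^sup>2" using ineq'[OF that] N[rule_format, OF that] by (simp add: dist_real_def)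
      then show ?thesis using \<open>e > 0\<close> by (simp add: dist_norm power2_less_imp_less)
    qed
    then show "\<exists>N. \<forall>n\<ge>N. dist (p n) (p N) < e" by blast
  qed
  then obtain l where l: "p \<longlonglongrightarrow> l" using Cauchy_convergent convergent_def by blast
  have "nearest dist (\<Inter>n. C n) x = l"
  proof (rule nearest_eqI)
    show "closed (\<Inter>n. C n)" "convex (\<Inter>n. C n)" using C by (auto intro: convex_INT)
    have "l \<in> C n" for n
    proof (rule closed_sequentially[OF C(1)])
      show "(\<lambda>m. p (m + n)) \<longlonglongrightarrow> l" using l by (rule LIMSEQ_ignore_initial_segment)
      show "p (m + n) \<in> C n" for m using pC[of "m+n"] dec[of n "m+n"] by auto
    qed
    then show "l \<in> (\<Inter>n. C n)" by blast
    fix z assume z: "z \<in> (\<Inter>n. C n)"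
    have "(\<lambda>n. inner (x - p n) (z - p n)) \<longlonglongrightarrow> inner (x - l) (z - l)" by (intro tendsto_intros l)
    then show "inner (x - l) (z - l) \<le> 0"
      by (rule Lim_bounded) (use pdot z in blast)
  qed
  then show ?thesis using l by (simp add: p_def)
qed

lemma nearest_scaleR:
  fixes C :: "'h::{real_inner,complete_space} set"
  assumes C: "closed C" "convex C" "C \<noteq> {}" and r: "r \<noteq> 0"
  shows "nearest dist ((\<lambda>v. r *\<^sub>R v) ` C) x = r *\<^sub>R nearest dist C ((1/r) *\<^sub>R x)"
proof (rule nearest_eqI)
  let ?p = "nearest dist C ((1/r) *\<^sub>R x)"
  show "closed ((\<lambda>v. r *\<^sub>R v) ` C)" using C by (intro closed_scaling)
  show "convex ((\<lambda>v. r *\<^sub>R v) ` C)" using C by (intro convex_scaling)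
  show "r *\<^sub>R ?p \<in> (\<lambda>v. r *\<^sub>R v) ` C" using nearest_in[OF C] by blast
  fix z assume "z \<in> (\<lambda>v. r *\<^sub>R v) ` C"
  then obtain w where w: "w \<in> C" "z = r *\<^sub>R w" by auto
  have "x - r *\<^sub>R ?p = r *\<^sub>R ((1/r) *\<^sub>R x - ?p)" "z - r *\<^sub>R ?p = r *\<^sub>R (w - ?p)"
    using r w by (simp_all add: algebra_simps)
  then have "inner (x - r *\<^sub>R ?p) (z - r *\<^sub>R ?p) = r * r * inner ((1/r) *\<^sub>R x - ?p) (w - ?p)"
    by simp
  also have "\<dots> \<le> 0" using nearest_dot[OF C w(1), of "(1/r) *\<^sub>R x"]
    by (intro mult_nonneg_nonpos) auto
  finally show "inner (x - r *\<^sub>R ?p) (z - r *\<^sub>R ?p) \<le> 0" .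
qed

lemma bounded_linear_extension:
  fixes \<Lambda> g :: "'a::real_vector \<Rightarrow> 'h::{real_normed_vector,complete_space}"
  assumes S: "subspace S"
    and \<Lambda>: "\<And>a b. a \<in> S \<Longrightarrow> b \<in> S \<Longrightarrow> \<Lambda> (a + b) = \<Lambda> a + \<Lambda> b"
      "\<And>r a. a \<in> S \<Longrightarrow> \<Lambda> (r *\<^sub>R a) = r *\<^sub>R \<Lambda> a"
    and dense: "closure (\<Lambda> ` S) = UNIV"
    and g: "\<And>a b. a \<in> S \<Longrightarrow> b \<in> S \<Longrightarrow> g (a + b) = g a + g b"
      "\<And>r a. a \<in> S \<Longrightarrow> g (r *\<^sub>R a) = r *\<^sub>R g a"
    and bd: "\<And>a. a \<in> S \<Longrightarrow> norm (g a) \<le> c * norm (\<Lambda> a)"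
  obtains T where "bounded_linear T" "\<And>a. a \<in> S \<Longrightarrow> T (\<Lambda> a) = g a"
proof -
  have diff: "g (a - b) = g a - g b" "\<Lambda> (a - b) = \<Lambda> a - \<Lambda> b" if "a \<in> S" "b \<in> S" for a b
  proof -
    have "- b \<in> S" using that subspace_neg[OF S] by blast
    then have "g (a + (- b)) = g a + g (- b)" "\<Lambda> (a + (- b)) = \<Lambda> a + \<Lambda> (- b)"
      using g(1) \<Lambda>(1) that by blast+
    moreover have "g (- b) = - g b" "\<Lambda> (- b) = - \<Lambda> b" using g(2)[of b "-1"] \<Lambda>(2)[of b "-1"] that by simp_all
    ultimately show "g (a - b) = g a - g b" "\<Lambda> (a - b) = \<Lambda> a - \<Lambda> b" by simp_all
  qed
  define f where "f = (\<lambda>v. g (SOME a. a \<in> S \<and> \<Lambda> a = v))"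
  have f: "f (\<Lambda> a) = g a" if a: "a \<in> S" for a
  proof -
    define b where "b = (SOME b. b \<in> S \<and> \<Lambda> b = \<Lambda> a)"
    have b: "b \<in> S" "\<Lambda> b = \<Lambda> a" using someI[of "\<lambda>b. b \<in> S \<and> \<Lambda> b = \<Lambda> a" a] a by (auto simp: b_def)
    have "norm (g (b - a)) \<le> c * norm (\<Lambda> (b - a))" using a b S by (intro bd subspace_diff)
    then have "g b = g a" using diff a b by simp
    then show ?thesis by (simp add: f_def b_def)
  qed
  have "\<bar>c\<bar>-lipschitz_on (\<Lambda> ` S) f"
  proof (rule lipschitz_onI)
    fix u v assume "u \<in> \<Lambda> ` S" "v \<in> \<Lambda> ` S"
    then obtain a b where ab: "a \<in> S" "b \<in> S" "u = \<Lambda> a" "v = \<Lambda> b" by blast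
    have "norm (g (a - b)) \<le> \<bar>c\<bar> * norm (\<Lambda> (a - b))"
      using bd[OF subspace_diff[OF S ab(1,2)]] mult_right_mono[OF abs_ge_self[of c], of "norm (\<Lambda> (a - b))"] by simp
    then show "dist (f u) (f v) \<le> \<bar>c\<bar> * dist u v" using ab diff by (simp add: f dist_norm)
  qed simp
  then obtain T where T: "uniformly_continuous_on (closure (\<Lambda> ` S)) T" "\<And>v. v \<in> \<Lambda> ` S \<Longrightarrow> f v = T v"
    using uniformly_continuous_on_extension_on_closure[OF lipschitz_on_uniformly_continuous] by metis
  have cont: "continuous_on UNIV T" using T(1) dense uniformly_continuous_imp_continuous by metis
  have contc: "continuous_on UNIV (\<lambda>x. T (h x))" if "continuous_on UNIV h" for h
    using continuous_on_compose2[OF cont that] by simp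
  have T\<Lambda>: "T (\<Lambda> a) = g a" if "a \<in> S" for a using T(2) f that by force
  have dns: "P v" if "closed {v. P v}" "\<And>a. a \<in> S \<Longrightarrow> P (\<Lambda> a)" for P v
  proof -
    have "closure (\<Lambda> ` S) \<subseteq> {v. P v}" using that by (intro closure_minimal) auto
    then show ?thesis using dense by auto
  qed
  have add1: "T (\<Lambda> a + v) = T (\<Lambda> a) + T v" if a: "a \<in> S" for a v
  proof (rule dns[of "\<lambda>v. T (\<Lambda> a + v) = T (\<Lambda> a) + T v"])
    show "closed {v. T (\<Lambda> a + v) = T (\<Lambda> a) + T v}"
      by (intro closed_Collect_eq continuous_intros contc)
    show "T (\<Lambda> a + \<Lambda> b) = T (\<Lambda> a) + T (\<Lambda> b)" if "b \<in> S" for b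
      using a that by (simp add: \<Lambda>(1)[symmetric] T\<Lambda> g(1) subspace_add[OF S])
  qed
  have add: "T (u + v) = T u + T v" for u v
  proof (rule dns[of "\<lambda>u. T (u + v) = T u + T v"])
    show "closed {u. T (u + v) = T u + T v}"
      by (intro closed_Collect_eq continuous_intros contc)
  qed (rule add1)
  have scale: "T (r *\<^sub>R v) = r *\<^sub>R T v" for r v
  proof (rule dns[of "\<lambda>v. T (r *\<^sub>R v) = r *\<^sub>R T v"])
    show "closed {v. T (r *\<^sub>R v) = r *\<^sub>R T v}"
      by (intro closed_Collect_eq continuous_intros contc)
    show "T (r *\<^sub>R \<Lambda> a) = r *\<^sub>R T (\<Lambda> a)" if "a \<in> S" for a
      using that by (simp add: \<Lambda>(2)[symmetric] T\<Lambda> g(2) subspace_scale[OF S])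
  qed
  have bound: "norm (T v) \<le> norm v * c" for v
  proof (rule dns[of "\<lambda>v. norm (T v) \<le> norm v * c"])
    show "closed {v. norm (T v) \<le> norm v * c}"
      by (intro closed_Collect_le continuous_intros contc)
  qed (use bd in \<open>simp add: T\<Lambda> mult.commute\<close>)
  have "bounded_linear T" by (rule bounded_linear_intro[OF add scale bound])
  then show ?thesis using T\<Lambda> that by blast
qed

section \<open>Closed nonnegative forms\<close>

locale closed_nonneg_form =
  fixes F :: "'h::chilbert_space set" and E :: "'h \<Rightarrow> 'h \<Rightarrow> complex"
  assumes nonneg: "nonneg_form F E" and closed: "closed_form F E"
begin

text \<open>The real part of the inner product of \<open>F\<close>, which makes \<open>F\<close> a real Hilbert space.\<close>

definition finner :: "'h \<Rightarrow> 'h \<Rightarrow> real" where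
  "finner x y = Re (form_inner E x y)"

lemma F_zero: "0 \<in> F" and F_add: "x \<in> F \<Longrightarrow> y \<in> F \<Longrightarrow> x + y \<in> F" and F_scaleC: "x \<in> F \<Longrightarrow> c *\<^sub>C x \<in> F"
  using nonneg by (simp_all add: nonneg_form_def)

lemma F_scaleR: "x \<in> F \<Longrightarrow> r *\<^sub>R x \<in> F"
  by (simp add: scaleR_scaleC F_scaleC)

lemma F_diff: "x \<in> F \<Longrightarrow> y \<in> F \<Longrightarrow> x - y \<in> F"
  using F_add[of x "(-1) *\<^sub>R y"] F_scaleR[of y "-1"] by simp

lemma subspace_F: "subspace F"
  by (simp add: subspace_def F_zero F_add F_scaleR)

lemma E_add_right: "x \<in> F \<Longrightarrow> y \<in> F \<Longrightarrow> z \<in> F \<Longrightarrow> E x (y + z) = E x y + E x z"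
  and E_add_left: "x \<in> F \<Longrightarrow> y \<in> F \<Longrightarrow> z \<in> F \<Longrightarrow> E (x + y) z = E x z + E y z"
  and E_scaleC_right: "x \<in> F \<Longrightarrow> y \<in> F \<Longrightarrow> E x (c *\<^sub>C y) = c * E x y"
  and E_scaleC_left: "x \<in> F \<Longrightarrow> y \<in> F \<Longrightarrow> E (c *\<^sub>C x) y = cnj c * E x y"
  using nonneg by (simp_all add: nonneg_form_def)

lemma E_self: "x \<in> F \<Longrightarrow> Im (E x x) = 0 \<and> 0 \<le> Re (E x x)"
  using nonneg by (auto simp: nonneg_form_def complex_nonneg_Reals_iff)

lemma E_hermitian:
  assumes "x \<in> F" "y \<in> F"
  shows "E y x = cnj (E x y)"
proof (rule complex_eqI)
  have "Im (E (x + y) (x + y)) = 0" using E_self F_add assms by blast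
  then show "Im (E y x) = Im (cnj (E x y))"
    using assms E_self[of x] E_self[of y] by (simp add: E_add_left E_add_right F_add)
  have "Im (E (x + \<i> *\<^sub>C y) (x + \<i> *\<^sub>C y)) = 0" using E_self F_add F_scaleC assms by blast
  then show "Re (E y x) = Re (cnj (E x y))"
    using assms E_self[of x] E_self[of y]
    by (simp add: E_add_left E_add_right F_add F_scaleC E_scaleC_left E_scaleC_right)
qed

lemma form_inner_add_right: "x \<in> F \<Longrightarrow> y \<in> F \<Longrightarrow> z \<in> F \<Longrightarrow> form_inner E x (y + z) = form_inner E x y + form_inner E x z"
  and form_inner_scaleC_right: "x \<in> F \<Longrightarrow> y \<in> F \<Longrightarrow> form_inner E x (c *\<^sub>C y) = c * form_inner E x y"
  by (simp_all add: form_inner_def E_add_right E_scaleC_right cinner_add_right cinner_scaleC_right algebra_simps)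

lemma form_inner_hermitian: "x \<in> F \<Longrightarrow> y \<in> F \<Longrightarrow> form_inner E y x = cnj (form_inner E x y)"
  by (simp add: form_inner_def E_hermitian[of x y]) (rule cinner_commute)

lemma finner_commute: "x \<in> F \<Longrightarrow> y \<in> F \<Longrightarrow> finner x y = finner y x"
  using form_inner_hermitian[of x y] by (simp add: finner_def)

lemma finner_add_right: "x \<in> F \<Longrightarrow> y \<in> F \<Longrightarrow> z \<in> F \<Longrightarrow> finner x (y + z) = finner x y + finner x z"
  by (simp add: finner_def form_inner_add_right)

lemma finner_scaleR_right: "x \<in> F \<Longrightarrow> y \<in> F \<Longrightarrow> finner x (r *\<^sub>R y) = r * finner x y"
  by (simp add: finner_def form_inner_scaleC_right scaleR_scaleC)

lemma finner_diff_right: "x \<in> F \<Longrightarrow> y \<in> F \<Longrightarrow> z \<in> F \<Longrightarrow> finner x (y - z) = finner x y - finner x z"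
  using finner_add_right[of x y "(-1) *\<^sub>R z"] finner_scaleR_right[of x z "-1"] F_scaleR[of z "-1"] by simp

lemma finner_left:
  assumes "x \<in> F" "y \<in> F" "z \<in> F"
  shows "finner (x + y) z = finner x z + finner y z" "finner (x - y) z = finner x z - finner y z"
    "finner (r *\<^sub>R x) z = r * finner x z"
proof -
  note c = finner_commute[OF _ assms(3)]
  show "finner (x + y) z = finner x z + finner y z"
    using assms by (simp only: c F_add finner_add_right)
  show "finner (x - y) z = finner x z - finner y z"
    using assms by (simp only: c F_diff finner_diff_right)
  show "finner (r *\<^sub>R x) z = r * finner x z"
    using assms by (simp only: c F_scaleR finner_scaleR_right)
qed

lemmas finner_simps = finner_add_right finner_diff_right finner_scaleR_right finner_left
  F_add F_diff F_scaleR

lemma finner_self: "finner x x = energy E x + (norm x)\<^sup>2"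
  by (simp add: finner_def form_inner_def energy_def cinner_self)

lemma energy_nonneg: "x \<in> F \<Longrightarrow> 0 \<le> energy E x"
  using E_self by (simp add: energy_def)

lemma norm_le_finner: "x \<in> F \<Longrightarrow> (norm x)\<^sup>2 \<le> finner x x"
  using energy_nonneg[of x] by (simp add: finner_self)

lemma finner_nonneg: "x \<in> F \<Longrightarrow> 0 \<le> finner x x"
  using norm_le_finner[of x] zero_le_power2[of "norm x"] by linarith

lemma form_norm_sq: "x \<in> F \<Longrightarrow> (form_norm E x)\<^sup>2 = finner x x"
  using finner_nonneg[of x] by (simp add: form_norm_def finner_def)

lemma form_norm_nonneg: "x \<in> F \<Longrightarrow> 0 \<le> form_norm E x"
  using finner_nonneg[of x] by (simp add: form_norm_def finner_def)

lemma norm_le_form_norm: "x \<in> F \<Longrightarrow> norm x \<le> form_norm E x"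
  by (rule power2_le_imp_le) (simp_all add: form_norm_sq norm_le_finner form_norm_nonneg)

lemma finner_Cauchy_Schwarz:
  assumes x: "x \<in> F" and y: "y \<in> F"
  shows "\<bar>finner x y\<bar> \<le> form_norm E x * form_norm E y"
proof -
  have "(finner x y)\<^sup>2 \<le> finner x x * finner y y"
  proof (cases "finner y y = 0")
    case True
    then have "y = 0" using norm_le_finner[OF y] by simp
    then have "finner x y = 0" using finner_scaleR_right[OF x y, of 0] by simp
    then show ?thesis using True by simp
  next
    case False
    then have pos: "finner y y > 0" using finner_nonneg[OF y] by simp
    have "0 \<le> finner (finner y y *\<^sub>R x - finner x y *\<^sub>R y) (finner y y *\<^sub>R x - finner x y *\<^sub>R y)"
      using x y by (intro finner_nonneg F_diff F_scaleR)
    also have "\<dots> = finner y y * (finner x x * finner y y - (finner x y)\<^sup>2)"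
      using x y finner_commute[OF y x] by (simp add: finner_simps algebra_simps power2_eq_square)
    finally show ?thesis using pos by (simp add: zero_le_mult_iff)
  qed
  then have "(finner x y)\<^sup>2 \<le> (form_norm E x * form_norm E y)\<^sup>2"
    using x y by (simp add: power_mult_distrib form_norm_sq)
  then show ?thesis
    using form_norm_nonneg x y by (metis abs_le_square_iff abs_of_nonneg mult_nonneg_nonneg)
qed

lemma form_norm_triangle:
  assumes x: "x \<in> F" and y: "y \<in> F"
  shows "form_norm E (x + y) \<le> form_norm E x + form_norm E y"
proof (rule power2_le_imp_le)
  have "finner (x + y) (x + y) = finner x x + 2 * finner x y + finner y y"
    using x y finner_commute[OF y x] by (simp add: finner_simps)
  also have "\<dots> \<le> (form_norm E x)\<^sup>2 + 2 * (form_norm E x * form_norm E y) + (form_norm E y)\<^sup>2"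
    using finner_Cauchy_Schwarz[OF x y] x y by (simp add: form_norm_sq)
  finally show "(form_norm E (x + y))\<^sup>2 \<le> (form_norm E x + form_norm E y)\<^sup>2"
    using x y by (simp add: form_norm_sq F_add power2_sum)
  show "0 \<le> form_norm E x + form_norm E y" using x y form_norm_nonneg by simp
qed

lemma finner_tendsto:
  assumes z: "z \<in> F" and x: "x \<in> F" "\<And>n. y n \<in> F" and lim: "(\<lambda>n. form_norm E (y n - x)) \<longlonglongrightarrow> 0"
  shows "(\<lambda>n. finner z (y n)) \<longlonglongrightarrow> finner z x"
proof -
  have "(\<lambda>n. finner z (y n) - finner z x) \<longlonglongrightarrow> 0"
  proof (rule Lim_null_comparison)
    show "\<forall>\<^sub>F n in sequentially. norm (finner z (y n) - finner z x) \<le> form_norm E z * form_norm E (y n - x)"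
      using finner_Cauchy_Schwarz[OF z F_diff[OF x(2) x(1)]] z x by (simp add: finner_diff_right)
    show "(\<lambda>n. form_norm E z * form_norm E (y n - x)) \<longlonglongrightarrow> 0"
      using tendsto_mult_left[OF lim, of "form_norm E z"] by simp
  qed
  then show ?thesis by (rule LIM_zero_cancel)
qed

lemma finner_self_tendsto:
  assumes x: "x \<in> F" "\<And>n. y n \<in> F" and lim: "(\<lambda>n. form_norm E (y n - x)) \<longlonglongrightarrow> 0"
  shows "(\<lambda>n. finner (y n) (y n)) \<longlonglongrightarrow> finner x x"
proof -
  have "(\<lambda>n. (form_norm E (y n - x))\<^sup>2 + 2 * finner x (y n) - finner x x) \<longlonglongrightarrow> 0\<^sup>2 + 2 * finner x x - finner x x"
    by (intro tendsto_add tendsto_diff tendsto_power tendsto_mult tendsto_const lim finner_tendsto[OF x(1) x lim])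
  moreover have "(form_norm E (y n - x))\<^sup>2 + 2 * finner x (y n) - finner x x = finner (y n) (y n)" for n
    using x finner_commute[of "y n" x] by (simp add: form_norm_sq finner_simps)
  ultimately show ?thesis by simp
qed

text \<open>The elementary substitute for weak compactness of balls in \<open>F\<close>. Almost minimal elements of the
  convex hulls of the tails form a Cauchy sequence in form norm, and its limit can only be \<open>l\<close>, because
  tails of a sequence converging to \<open>l\<close> have convex hulls close to \<open>l\<close>.\<close>

lemma weak_closure:
  assumes x: "\<And>n. x n \<in> F" and bd: "\<And>n. finner (x n) (x n) \<le> M" and lim: "x \<longlonglongrightarrow> l"
  shows "l \<in> F" and "\<exists>y. (\<forall>n. y n \<in> convex hull (range x)) \<and> (\<lambda>n. form_norm E (y n - l)) \<longlonglongrightarrow> 0"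
proof -
  define D where "D = (\<lambda>n. convex hull (x ` {n..}))"
  have DF: "D n \<subseteq> F" for n
    unfolding D_def using x by (intro hull_minimal subspace_imp_convex subspace_F) auto
  have nn: "0 \<le> finner v v" if "v \<in> D 0" for v using that DF finner_nonneg by blast
  have par: "finner (u - v) (u - v) = 2 * finner u u + 2 * finner v v
      - 4 * finner ((1 / 2) *\<^sub>R (u + v)) ((1 / 2) *\<^sub>R (u + v))" if "u \<in> D 0" "v \<in> D 0" for u v
  proof -
    have "u \<in> F" "v \<in> F" using that DF by blast+
    then show ?thesis using finner_commute[of u v] by (simp add: finner_simps algebra_simps)
  qed
  have mid: "(1/2) *\<^sub>R (u + v) \<in> D n" if "u \<in> D n" "v \<in> D n" for n u v
    using convexD[OF convex_convex_hull that[unfolded D_def], of "1/2" "1/2"]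
    by (simp add: D_def scaleR_add_right)
  have dec: "D n \<subseteq> D m" if "m \<le> n" for m n unfolding D_def using that by (intro hull_mono) auto
  have bdd: "\<exists>v\<in>D n. finner v v \<le> M" for n
    unfolding D_def by (rule bexI[of _ "x n"]) (simp_all add: bd hull_inc)
  obtain y where yD: "\<And>n. y n \<in> D n"
    and cau: "\<And>e. e > 0 \<Longrightarrow> \<exists>K. \<forall>m\<ge>K. \<forall>n\<ge>K. finner (y m - y n) (y m - y n) < e"
  proof (rule minimizing_sequence_Cauchy[of D "\<lambda>v. finner v v", OF nn par mid dec bdd])
    fix y :: "nat \<Rightarrow> 'h"
    assume "\<And>n. y n \<in> D n"
      and "\<And>e. e > 0 \<Longrightarrow> \<exists>K. \<forall>m\<ge>K. \<forall>n\<ge>K. finner (y m - y n) (y m - y n) < e"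
    then show thesis by (rule that)
  qed
  have yF: "y n \<in> F" for n using yD DF by blast
  have "\<exists>N. \<forall>m\<ge>N. \<forall>n\<ge>N. form_norm E (y m - y n) < e" if e: "e > 0" for e
  proof -
    have "e\<^sup>2 > 0" using e by simp
    from cau[OF this] obtain K where K: "\<And>m n. m \<ge> K \<Longrightarrow> n \<ge> K \<Longrightarrow> finner (y m - y n) (y m - y n) < e\<^sup>2" by blast
    have "form_norm E (y m - y n) < e" if "m \<ge> K" "n \<ge> K" for m n
      by (rule power2_less_imp_less) (use K[OF that] e yF in \<open>simp_all add: form_norm_sq F_diff\<close>)
    then show ?thesis by blast
  qed
  then obtain \<xi> where \<xi>: "\<xi> \<in> F" "(\<lambda>n. form_norm E (y n - \<xi>)) \<longlonglongrightarrow> 0"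
    using closed yF unfolding closed_form_def by blast
  have "(\<lambda>n. y n - \<xi>) \<longlonglongrightarrow> 0"
    by (rule Lim_null_comparison[OF _ \<xi>(2)]) (simp add: norm_le_form_norm F_diff yF \<xi>(1))
  then have y\<xi>: "y \<longlonglongrightarrow> \<xi>" by (rule LIM_zero_cancel)
  have yl: "y \<longlonglongrightarrow> l"
  proof (rule LIMSEQ_I)
    fix r :: real assume "r > 0"
    then obtain N where N: "\<And>n. n \<ge> N \<Longrightarrow> norm (x n - l) < r" using LIMSEQ_D[OF lim] by blast
    have "norm (y n - l) < r" if n: "n \<ge> N" for n
    proof -
      have "D n \<subseteq> ball l r"
        unfolding D_def using N n by (intro hull_minimal convex_ball) (auto simp: dist_norm norm_minus_commute)
      then show ?thesis using yD[of n] by (auto simp: dist_norm norm_minus_commute)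
    qed
    then show "\<exists>no. \<forall>n\<ge>no. norm (y n - l) < r" by blast
  qed
  have "\<xi> = l" using y\<xi> yl LIMSEQ_unique by blast
  moreover have "y n \<in> convex hull (range x)" for n
    using yD[of n] hull_mono[of "x ` {n..}" "range x"] by (auto simp: D_def)
  ultimately show "l \<in> F" "\<exists>y. (\<forall>n. y n \<in> convex hull (range x)) \<and> (\<lambda>n. form_norm E (y n - l)) \<longlonglongrightarrow> 0"
    using \<xi> by blast+
qed

lemma finner_bounded:
  assumes x: "\<And>n. x n \<in> F" and en: "\<And>n. energy E (x n) \<le> M" and lim: "x \<longlonglongrightarrow> l"
  obtains B where "\<And>n. finner (x n) (x n) \<le> B"
proof -
  have "Bseq x" using lim convergent_imp_Bseq convergent_def by blast
  then obtain K where K: "\<And>n. norm (x n) \<le> K" by (auto simp: Bseq_def)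
  have "finner (x n) (x n) \<le> M + K\<^sup>2" for n
    using power_mono[OF K[of n], of 2] en[of n] by (simp add: finner_self)
  then show ?thesis by (rule that)
qed

lemma energy_convex: "convex {x\<in>F. energy E x \<le> M}"
proof (rule convexI)
  fix x y and s t :: real
  assume xy: "x \<in> {x\<in>F. energy E x \<le> M}" "y \<in> {x\<in>F. energy E x \<le> M}" and st: "0 \<le> s" "0 \<le> t" "s + t = 1"
  then have F: "x \<in> F" "y \<in> F" by auto
  have t: "t = 1 - s" using st by simp
  have e1: "Re (E (s *\<^sub>R x + t *\<^sub>R y) (s *\<^sub>R x + t *\<^sub>R y)) =
      s * s * Re (E x x) + s * t * (2 * Re (E x y)) + t * t * Re (E y y)"
    using F E_hermitian[OF F]
    by (simp add: scaleR_scaleC E_add_left E_add_right F_add F_scaleC E_scaleC_left E_scaleC_right algebra_simps)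
  have e2: "Re (E (x - y) (x - y)) = Re (E x x) - 2 * Re (E x y) + Re (E y y)"
  proof -
    have eq: "x - y = x + (-1) *\<^sub>C y" by (simp add: scaleC_minus_left)
    show ?thesis unfolding eq using F E_hermitian[OF F]
      by (simp add: E_add_left E_add_right F_add F_scaleC E_scaleC_left E_scaleC_right)
  qed
  have "energy E (s *\<^sub>R x + t *\<^sub>R y) = s * energy E x + t * energy E y - s * t * energy E (x - y)"
    unfolding energy_def e1 e2 unfolding t by (simp add: algebra_simps)
  also have "\<dots> \<le> s * M + t * M - 0"
  proof (intro diff_mono add_mono mult_left_mono)
    show "0 \<le> s * t * energy E (x - y)" using st energy_nonneg[OF F_diff[OF F]] by simp
  qed (use xy st in simp_all)
  also have "\<dots> = M" using st(3) by (simp add: distrib_right[symmetric])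
  finally show "s *\<^sub>R x + t *\<^sub>R y \<in> {x\<in>F. energy E x \<le> M}" using F by (simp add: F_add F_scaleR)
qed

lemma energy_lsc:
  assumes x: "\<And>n. x n \<in> F" and en: "\<And>n. energy E (x n) \<le> M" and lim: "x \<longlonglongrightarrow> l"
  shows "l \<in> F" and "energy E l \<le> M"
proof -
  obtain B where B: "\<And>n. finner (x n) (x n) \<le> B" using finner_bounded[OF assms] by blast
  show lF: "l \<in> F" by (rule weak_closure(1)[OF x B lim])
  obtain y where y: "\<And>n. y n \<in> convex hull (range x)" and lim_y: "(\<lambda>n. form_norm E (y n - l)) \<longlonglongrightarrow> 0"
    using weak_closure(2)[OF x B lim] by blast
  have "convex hull (range x) \<subseteq> {x\<in>F. energy E x \<le> M}"
    using x en by (intro hull_minimal energy_convex) auto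
  then have yF: "y n \<in> F" and ey: "energy E (y n) \<le> M" for n using y[of n] by blast+
  have "(\<lambda>n. y n - l) \<longlonglongrightarrow> 0"
    by (rule Lim_null_comparison[OF _ lim_y]) (simp add: norm_le_form_norm F_diff yF lF)
  then have "y \<longlonglongrightarrow> l" by (rule LIM_zero_cancel)
  from tendsto_diff[OF finner_self_tendsto[OF lF yF lim_y] tendsto_power[OF tendsto_norm[OF this], of 2]]
  have "(\<lambda>n. energy E (y n)) \<longlonglongrightarrow> energy E l" by (simp add: finner_self)
  then show "energy E l \<le> M" by (rule Lim_bounded) (use ey in blast)
qed

lemma finner_weak_limit_nonneg:
  assumes z: "z \<in> F" and x: "\<And>n. x n \<in> F" and en: "\<And>n. energy E (x n) \<le> M" and lim: "x \<longlonglongrightarrow> l"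
    and pos: "\<And>n. 0 \<le> finner z (x n)"
  shows "0 \<le> finner z l"
proof -
  obtain B where B: "\<And>n. finner (x n) (x n) \<le> B" using finner_bounded[OF x en lim] by blast
  have lF: "l \<in> F" by (rule weak_closure(1)[OF x B lim])
  obtain y where y: "\<And>n. y n \<in> convex hull (range x)" and lim_y: "(\<lambda>n. form_norm E (y n - l)) \<longlonglongrightarrow> 0"
    using weak_closure(2)[OF x B lim] by blast
  have "convex {v\<in>F. 0 \<le> finner z v}"
  proof (rule convexI)
    fix u v and s t :: real
    assume "u \<in> {v\<in>F. 0 \<le> finner z v}" "v \<in> {v\<in>F. 0 \<le> finner z v}" and st: "0 \<le> s" "0 \<le> t"
    then have uv: "u \<in> F" "v \<in> F" "0 \<le> finner z u" "0 \<le> finner z v" by blast+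
    then have "finner z (s *\<^sub>R u + t *\<^sub>R v) = s * finner z u + t * finner z v"
      using z by (simp add: finner_simps)
    then show "s *\<^sub>R u + t *\<^sub>R v \<in> {v\<in>F. 0 \<le> finner z v}"
      using uv st by (simp add: F_add F_scaleR)
  qed
  then have "convex hull (range x) \<subseteq> {v\<in>F. 0 \<le> finner z v}"
    using x pos by (intro hull_minimal) auto
  then have yF: "y n \<in> F" and ey: "0 \<le> finner z (y n)" for n using y[of n] by blast+
  have "(\<lambda>n. finner z (y n)) \<longlonglongrightarrow> finner z l" by (rule finner_tendsto[OF z lF yF lim_y])
  then show ?thesis by (rule LIMSEQ_le_const) (use ey in blast)
qed

end

section \<open>The GNS space of a trace\<close>

lemma cinner_eq_inner: "cinner x y = Complex (inner x y) (- inner x (\<i> *\<^sub>C (y::'h::chilbert_space)))"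
  by (simp add: complex_eq_iff inner_eq_Re_cinner cinner_scaleC_right)

lemma continuous_on_cinner:
  fixes f g :: "'x::topological_space \<Rightarrow> 'h::chilbert_space"
  assumes "continuous_on S f" "continuous_on S g"
  shows "continuous_on S (\<lambda>x. cinner (f x) (g x))"
  unfolding cinner_eq_inner
  by (intro continuous_on_Complex continuous_on_minus continuous_on_inner assms
      bounded_linear.continuous_on[OF bounded_linear_scaleC])

lemma cinner_diff_right: "cinner x (y - z) = cinner x y - cinner x (z::'h::chilbert_space)"
  using cinner_add_right[of x "y - z" z] by simp

locale tracial_gns =
  fixes \<tau> :: "'a::cstar_algebra \<Rightarrow> ennreal" and \<Lambda> :: "'a \<Rightarrow> 'h::chilbert_space"
  assumes trace: "positive_trace \<tau>" and faithful: "faithful_trace \<tau>" and lsc: "lsc_trace \<tau>"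
    and gns: "gns_map \<tau> \<Lambda>"
begin

lemma tau_add: "x \<in> cstar_pos \<Longrightarrow> y \<in> cstar_pos \<Longrightarrow> \<tau> (x + y) = \<tau> x + \<tau> y"
  and tau_scaleR: "x \<in> cstar_pos \<Longrightarrow> 0 \<le> r \<Longrightarrow> \<tau> (r *\<^sub>R x) = ennreal r * \<tau> x"
  and tau_star: "\<tau> (star x * x) = \<tau> (x * star x)"
  using trace by (simp_all add: positive_trace_def)

lemma star_mult_self_pos: "star b * b \<in> (cstar_pos :: 'a set)"
  by (auto simp: cstar_pos_def)

lemma tau_zero [simp]: "\<tau> 0 = 0"
  using tau_scaleR[OF star_mult_self_pos[of 0], of 0] by simp

lemma L2_star: "a \<in> trace_L2 \<tau> \<Longrightarrow> star a \<in> trace_L2 \<tau>"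
  by (simp add: trace_L2_def star_star tau_star)

lemma L2_zero: "0 \<in> trace_L2 \<tau>"
  by (simp add: trace_L2_def)

lemma L2_scaleC: "a \<in> trace_L2 \<tau> \<Longrightarrow> c *\<^sub>C a \<in> trace_L2 \<tau>"
proof -
  assume a: "a \<in> trace_L2 \<tau>"
  have "star (c *\<^sub>C a) * (c *\<^sub>C a) = (cmod c)\<^sup>2 *\<^sub>R (star a * a)"
    by (simp add: star_scaleC scaleC_mult_left scaleC_mult_right scaleC_scaleC scaleR_scaleC
        complex_norm_square mult.commute del: of_real_power)
  then show ?thesis
    using a by (simp add: trace_L2_def tau_scaleR star_mult_self_pos ennreal_mult_less_top)
qed

lemma L2_scaleR: "a \<in> trace_L2 \<tau> \<Longrightarrow> r *\<^sub>R a \<in> trace_L2 \<tau>"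
  by (simp add: scaleR_scaleC L2_scaleC)

lemma L2_add:
  assumes "a \<in> trace_L2 \<tau>" "b \<in> trace_L2 \<tau>"
  shows "a + b \<in> trace_L2 \<tau>"
proof -
  have "star (a + b) * (a + b) + star (a - b) * (a - b) = 2 *\<^sub>R (star a * a) + 2 *\<^sub>R (star b * b)"
    by (simp add: star_simps algebra_simps scaleR_2)
  then have "\<tau> (star (a + b) * (a + b)) + \<tau> (star (a - b) * (a - b))
      = \<tau> (2 *\<^sub>R (star a * a) + 2 *\<^sub>R (star b * b))"
    by (metis tau_add star_mult_self_pos)
  also have "\<dots> = ennreal 2 * \<tau> (star a * a) + ennreal 2 * \<tau> (star b * b)"
    by (simp only: tau_add cstar_pos_scaleR star_mult_self_pos tau_scaleR zero_le_numeral)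
  also have "\<dots> < \<infinity>" using assms by (auto simp: trace_L2_def ennreal_mult_less_top)
  finally show ?thesis by (auto simp: trace_L2_def)
qed

lemma L2_diff: "a \<in> trace_L2 \<tau> \<Longrightarrow> b \<in> trace_L2 \<tau> \<Longrightarrow> a - b \<in> trace_L2 \<tau>"
  using L2_add[of a "(-1) *\<^sub>R b"] L2_scaleR[of b "-1"] by simp

lemma subspace_L2: "subspace (trace_L2 \<tau>)"
  by (simp add: subspace_def L2_zero L2_add L2_scaleR)

text \<open>For \<open>\<parallel>a\<parallel> \<le> 1\<close> the operator \<open>1 - a\<^sup>*a\<close> is a square \<open>(1 - r)\<^sup>2\<close>, so \<open>b\<^sup>*b\<close> is the sum of \<open>(ab)\<^sup>*(ab)\<close> and of
  \<open>d\<^sup>*d\<close> with \<open>d = b - rb\<close>.\<close>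

lemma tau_mult_le:
  "\<tau> (star (a * b) * (a * b)) \<le> ennreal ((norm a)\<^sup>2) * \<tau> (star b * b)"
proof -
  have unit: "\<tau> (star (a * b) * (a * b)) \<le> \<tau> (star b * b)" if a: "norm a \<le> 1" for a
  proof -
    have "norm (0 *\<^sub>R x + star a * a * x) \<le> norm x" for x
    proof -
      have "norm (star a * a * x) \<le> norm (star a * a) * norm x" by (rule norm_mult_ineq)
      also have "\<dots> \<le> 1 * norm x"
        using a by (intro mult_right_mono) (simp_all add: cstar_identity power_le_one)
      finally show ?thesis by simp
    qed
    then obtain k r where k: "\<bar>k\<bar> \<le> 1" "2 * k = 0 + k\<^sup>2"
      and r: "2 *\<^sub>R r = star a * a + (2 * k) *\<^sub>R r + r * r" "star (star a * a) = star a * a \<Longrightarrow> star r = r"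
      using affine_sqrt[of 0 "star a * a"] by (metis abs_zero zero_le_one)
    have "k * (2 - k) = 0" using k(2) by (simp add: algebra_simps power2_eq_square)
    then have k0: "k = 0" using k(1) by auto
    have sr: "star r = r" using r(2) by (simp add: star_simps)
    have aa: "star a * a = 2 *\<^sub>R r - r * r" using r(1) by (simp add: k0)
    have "star (a * b) * (a * b) = star b * (star a * a) * b" by (simp add: star_mult mult.assoc)
    also have "\<dots> = 2 *\<^sub>R (star b * r * b) - star b * r * r * b"
      unfolding aa by (simp add: algebra_simps)
    finally have "star (a * b) * (a * b) + star (b - r * b) * (b - r * b) = star b * b"
      by (simp add: star_simps sr algebra_simps scaleR_2)
    then have "\<tau> (star b * b) = \<tau> (star (a * b) * (a * b)) + \<tau> (star (b - r * b) * (b - r * b))"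
      by (metis tau_add star_mult_self_pos)
    then show ?thesis by simp
  qed
  show ?thesis
  proof (cases "a = 0")
    case False
    define a' where "a' = (1 / norm a) *\<^sub>R a"
    have a': "norm a' \<le> 1" "a = norm a *\<^sub>R a'" using False by (simp_all add: a'_def)
    have "star (a * b) * (a * b) = (norm a)\<^sup>2 *\<^sub>R (star (a' * b) * (a' * b))"
      by (subst (1 2) a'(2)) (simp add: star_simps power2_eq_square)
    then have "\<tau> (star (a * b) * (a * b)) = ennreal ((norm a)\<^sup>2) * \<tau> (star (a' * b) * (a' * b))"
      by (simp add: tau_scaleR star_mult_self_pos)
    also have "\<dots> \<le> ennreal ((norm a)\<^sup>2) * \<tau> (star b * b)"
      by (intro mult_left_mono unit a') simp
    finally show ?thesis .
  qed simp
qed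

lemma L2_mult_left: "b \<in> trace_L2 \<tau> \<Longrightarrow> a * b \<in> trace_L2 \<tau>"
  unfolding trace_L2_def
  by (auto simp: ennreal_mult_less_top intro: order_le_less_trans[OF tau_mult_le[of a b]])

lemma L2_mult_right: "b \<in> trace_L2 \<tau> \<Longrightarrow> b * a \<in> trace_L2 \<tau>"
  using L2_mult_left[OF L2_star, of b "star a"] by (metis L2_star star_mult star_star)

text \<open>In any representation \<open>p = (p' - q) + \<i>(r - s)\<close>, comparing \<open>p\<close> with its adjoint gives \<open>r = s\<close> and
  \<open>p + q = p'\<close>, and additivity on positive elements determines the value.\<close>

lemma trace_ext_pos:
  assumes p: "p \<in> trace_finite_pos \<tau>"
  shows "trace_ext \<tau> p = complex_of_real (enn2real (\<tau> p))"
proof -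
  have z: "0 \<in> trace_finite_pos \<tau>"
    using star_mult_self_pos[of 0] by (simp add: trace_finite_pos_def)
  show ?thesis
    unfolding trace_ext_def
  proof (rule the_equality)
    show "\<exists>p'\<in>trace_finite_pos \<tau>. \<exists>q\<in>trace_finite_pos \<tau>. \<exists>r\<in>trace_finite_pos \<tau>. \<exists>s\<in>trace_finite_pos \<tau>.
        p = (p' - q) + \<i> *\<^sub>C (r - s) \<and> complex_of_real (enn2real (\<tau> p)) =
        Complex (enn2real (\<tau> p') - enn2real (\<tau> q)) (enn2real (\<tau> r) - enn2real (\<tau> s))"
      by (rule bexI[OF _ p], (rule bexI[OF _ z])+) (simp add: complex_of_real_def)
  next
    fix z
    assume "\<exists>p'\<in>trace_finite_pos \<tau>. \<exists>q\<in>trace_finite_pos \<tau>. \<exists>r\<in>trace_finite_pos \<tau>. \<exists>s\<in>trace_finite_pos \<tau>.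
        p = (p' - q) + \<i> *\<^sub>C (r - s) \<and> z =
        Complex (enn2real (\<tau> p') - enn2real (\<tau> q)) (enn2real (\<tau> r) - enn2real (\<tau> s))"
    then obtain p' q r s where pq: "p' \<in> trace_finite_pos \<tau>" "q \<in> trace_finite_pos \<tau>"
        "r \<in> trace_finite_pos \<tau>" "s \<in> trace_finite_pos \<tau>" "p = (p' - q) + \<i> *\<^sub>C (r - s)"
      and z: "z = Complex (enn2real (\<tau> p') - enn2real (\<tau> q)) (enn2real (\<tau> r) - enn2real (\<tau> s))"
      by blast
    have sa: "star x = x" if "x \<in> trace_finite_pos \<tau>" for x
      using that cstar_pos_star by (auto simp: trace_finite_pos_def)
    have "star p = (p' - q) - \<i> *\<^sub>C (r - s)"
      unfolding pq(5) using pq by (simp add: star_simps star_scaleC sa scaleC_minus_left)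
    then have "\<i> *\<^sub>C (r - s) = - (\<i> *\<^sub>C (r - s))" using pq(5) sa[OF p] by simp
    then have "\<i> *\<^sub>C (r - s) = 0" by (metis add.right_inverse double_zero_sym scaleR_2 real_vector.scale_eq_0_iff zero_neq_numeral)
    then have "norm (r - s) = 0" using norm_scaleC[of \<i> "r - s"] by simp
    then have rs: "r = s" by simp
    then have "p + q = p'" using pq(5) by simp
    then have "\<tau> p' = \<tau> p + \<tau> q"
      using tau_add[of p q] p pq by (auto simp: trace_finite_pos_def)
    then have "enn2real (\<tau> p') = enn2real (\<tau> p) + enn2real (\<tau> q)"
      using p pq by (simp add: trace_finite_pos_def enn2real_plus)
    then show "z = complex_of_real (enn2real (\<tau> p))" by (simp add: z rs complex_of_real_def)
  qed
qed

lemma L2_iff_finite_pos: "a \<in> trace_L2 \<tau> \<longleftrightarrow> star a * a \<in> trace_finite_pos \<tau>"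
  by (simp add: trace_L2_def trace_finite_pos_def star_mult_self_pos)

lemma \<Lambda>_add: "a \<in> trace_L2 \<tau> \<Longrightarrow> b \<in> trace_L2 \<tau> \<Longrightarrow> \<Lambda> (a + b) = \<Lambda> a + \<Lambda> b"
  and \<Lambda>_scaleC: "a \<in> trace_L2 \<tau> \<Longrightarrow> \<Lambda> (c *\<^sub>C a) = c *\<^sub>C \<Lambda> a"
  and cinner_\<Lambda>: "a \<in> trace_L2 \<tau> \<Longrightarrow> b \<in> trace_L2 \<tau> \<Longrightarrow> cinner (\<Lambda> a) (\<Lambda> b) = trace_ext \<tau> (star a * b)"
  and \<Lambda>_dense: "closure (\<Lambda> ` trace_L2 \<tau>) = UNIV"
  using gns by (simp_all add: gns_map_def)

lemma \<Lambda>_scaleR: "a \<in> trace_L2 \<tau> \<Longrightarrow> \<Lambda> (r *\<^sub>R a) = r *\<^sub>R \<Lambda> a"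
  by (simp add: scaleR_scaleC \<Lambda>_scaleC)

lemma \<Lambda>_diff: "a \<in> trace_L2 \<tau> \<Longrightarrow> b \<in> trace_L2 \<tau> \<Longrightarrow> \<Lambda> (a - b) = \<Lambda> a - \<Lambda> b"
  using \<Lambda>_add[of a "(-1) *\<^sub>R b"] L2_scaleR[of b "-1"] \<Lambda>_scaleR[of b "-1"] by simp

lemma \<Lambda>_zero: "\<Lambda> 0 = 0"
  using \<Lambda>_scaleR[OF L2_zero, of 0] by simp

lemma dense_induct:
  assumes "closed {v. P v}" "\<And>a. a \<in> trace_L2 \<tau> \<Longrightarrow> P (\<Lambda> a)"
  shows "P v"
proof -
  have "closure (\<Lambda> ` trace_L2 \<tau>) \<subseteq> {v. P v}" using assms by (intro closure_minimal) auto
  then show ?thesis using \<Lambda>_dense by auto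
qed

lemma norm_\<Lambda>_square:
  assumes "a \<in> trace_L2 \<tau>"
  shows "(norm (\<Lambda> a))\<^sup>2 = enn2real (\<tau> (star a * a))"
proof -
  have "complex_of_real ((norm (\<Lambda> a))\<^sup>2) = complex_of_real (enn2real (\<tau> (star a * a)))"
    using assms by (simp only: cinner_self[symmetric] cinner_\<Lambda>) (simp add: trace_ext_pos L2_iff_finite_pos)
  then show ?thesis by (simp only: of_real_eq_iff)
qed

lemma tau_eq_norm_\<Lambda>:
  assumes "a \<in> trace_L2 \<tau>"
  shows "\<tau> (star a * a) = ennreal ((norm (\<Lambda> a))\<^sup>2)"
  using assms by (simp add: norm_\<Lambda>_square trace_L2_def)

lemma norm_\<Lambda>_star: "a \<in> trace_L2 \<tau> \<Longrightarrow> norm (\<Lambda> (star a)) = norm (\<Lambda> a)"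
  by (rule power2_eq_imp_eq) (simp_all add: norm_\<Lambda>_square L2_star star_star tau_star)

lemma norm_\<Lambda>_mult:
  assumes "b \<in> trace_L2 \<tau>"
  shows "norm (\<Lambda> (a * b)) \<le> norm a * norm (\<Lambda> b)"
proof (rule power2_le_imp_le)
  have "ennreal ((norm (\<Lambda> (a * b)))\<^sup>2) \<le> ennreal ((norm a)\<^sup>2 * (norm (\<Lambda> b))\<^sup>2)"
    using tau_mult_le[of a b] assms by (simp add: tau_eq_norm_\<Lambda> L2_mult_left ennreal_mult)
  then show "(norm (\<Lambda> (a * b)))\<^sup>2 \<le> (norm a * norm (\<Lambda> b))\<^sup>2"
    by (simp add: power_mult_distrib)
qed simp

lemma cinner_\<Lambda>_mult:
  assumes "x \<in> trace_L2 \<tau>" "y \<in> trace_L2 \<tau>"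
  shows "cinner (\<Lambda> x) (\<Lambda> (a * y)) = cinner (\<Lambda> (star a * x)) (\<Lambda> y)"
  using assms by (simp add: cinner_\<Lambda> L2_mult_left star_simps mult.assoc)

lemma gns_conj_ex:
  obtains J where "bounded_linear J" "antiunitary_involution J" "\<And>a. a \<in> trace_L2 \<tau> \<Longrightarrow> J (\<Lambda> a) = \<Lambda> (star a)"
proof -
  obtain J where bl: "bounded_linear J" and J: "\<And>a. a \<in> trace_L2 \<tau> \<Longrightarrow> J (\<Lambda> a) = \<Lambda> (star a)"
  proof (rule bounded_linear_extension[of "trace_L2 \<tau>" \<Lambda> "\<lambda>a. \<Lambda> (star a)" 1])
  qed (simp_all add: subspace_L2 \<Lambda>_add \<Lambda>_scaleR \<Lambda>_dense star_simps L2_star norm_\<Lambda>_star)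
  have contJ: "continuous_on UNIV (\<lambda>x. J (f x))" if "continuous_on UNIV f" for f :: "'h \<Rightarrow> 'h"
    using bounded_linear.continuous_on[OF bl that] .
  have contC: "continuous_on UNIV (\<lambda>x. c *\<^sub>C f x)" if "continuous_on UNIV f" for f :: "'h \<Rightarrow> 'h" and c
    using bounded_linear.continuous_on[OF bounded_linear_scaleC that] .
  have add: "J (x + y) = J x + J y" for x y by (rule linear_add[OF bounded_linear.linear[OF bl]])
  have scale: "J (c *\<^sub>C x) = cnj c *\<^sub>C J x" for c x
  proof (rule dense_induct[of "\<lambda>x. J (c *\<^sub>C x) = cnj c *\<^sub>C J x"])
    show "closed {x. J (c *\<^sub>C x) = cnj c *\<^sub>C J x}"
      by (intro closed_Collect_eq contJ contC continuous_on_id)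
    show "J (c *\<^sub>C \<Lambda> a) = cnj c *\<^sub>C J (\<Lambda> a)" if "a \<in> trace_L2 \<tau>" for a
    proof -
      have "J (c *\<^sub>C \<Lambda> a) = J (\<Lambda> (c *\<^sub>C a))" using that by (simp add: \<Lambda>_scaleC)
      also have "\<dots> = \<Lambda> (cnj c *\<^sub>C star a)" using that by (simp add: J L2_scaleC star_scaleC)
      finally show ?thesis using that by (simp add: J \<Lambda>_scaleC L2_star)
    qed
  qed
  have invol: "J (J x) = x" for x
  proof (rule dense_induct[of "\<lambda>x. J (J x) = x"])
    show "closed {x. J (J x) = x}" by (intro closed_Collect_eq contJ continuous_on_id)
  qed (simp add: J L2_star star_star)
  have nrm: "norm (J x) = norm x" for x
  proof (rule dense_induct[of "\<lambda>x. norm (J x) = norm x"])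
    show "closed {x. norm (J x) = norm x}" by (intro closed_Collect_eq continuous_on_norm contJ continuous_on_id)
  qed (simp add: J norm_\<Lambda>_star)
  have inn: "inner (J x) (J y) = inner x y" for x y
    using nrm[of "x + y"] by (simp add: add norm_eq_sqrt_inner inner_simps inner_commute)
      (use nrm[of x] nrm[of y] in \<open>simp add: norm_eq_sqrt_inner\<close>)
  have cin: "cinner (J x) (J y) = cinner y x" for x y
  proof (rule complex_eqI)
    show "Re (cinner (J x) (J y)) = Re (cinner y x)"
      using inn[of x y] by (simp add: inner_eq_Re_cinner[symmetric] inner_commute)
    have "\<i> *\<^sub>C J y = J ((- \<i>) *\<^sub>C y)" by (simp add: scale)
    then have "inner (J x) (\<i> *\<^sub>C J y) = - inner x (\<i> *\<^sub>C y)" by (simp add: inn scaleC_minus_left)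
    then have "Im (cinner (J x) (J y)) = - Im (cinner x y)" by (simp add: cinner_eq_inner)
    also have "\<dots> = Im (cinner y x)" by (subst cinner_commute) simp
    finally show "Im (cinner (J x) (J y)) = Im (cinner y x)" .
  qed
  show ?thesis
    by (rule that[OF bl _ J]) (simp_all add: antiunitary_involution_def add scale cin invol)
qed

definition "J = gns_conj \<tau> \<Lambda>"

lemma J_props: "bounded_linear J" "antiunitary_involution J" "a \<in> trace_L2 \<tau> \<Longrightarrow> J (\<Lambda> a) = \<Lambda> (star a)"
proof -
  obtain J' where J': "bounded_linear J'" "antiunitary_involution J'" "\<And>a. a \<in> trace_L2 \<tau> \<Longrightarrow> J' (\<Lambda> a) = \<Lambda> (star a)"
    using gns_conj_ex by blast
  have "J = J'"
    unfolding J_def gns_conj_def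
  proof (rule the_equality)
    show "antiunitary_involution J' \<and> (\<forall>a\<in>trace_L2 \<tau>. J' (\<Lambda> a) = \<Lambda> (star a))" using J' by blast
    fix J'' assume J'': "antiunitary_involution J'' \<and> (\<forall>a\<in>trace_L2 \<tau>. J'' (\<Lambda> a) = \<Lambda> (star a))"
    have add: "J'' (x + y) = J'' x + J'' y" and scale: "J'' (c *\<^sub>C x) = cnj c *\<^sub>C J'' x"
      and cin: "cinner (J'' x) (J'' y) = cinner y x" for x y c
      using J'' by (simp_all add: antiunitary_involution_def)
    have "(norm (J'' x))\<^sup>2 = (norm x)\<^sup>2" for x
      using cin[of x x] unfolding cinner_self of_real_eq_iff .
    then have nrm: "norm (J'' x) = norm x" for x by (simp add: power2_eq_iff_nonneg)
    have bl: "bounded_linear J''"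
      by (rule bounded_linear_intro[where K=1]) (simp_all add: add scale scaleR_scaleC nrm)
    show "J'' = J'"
    proof
      fix x show "J'' x = J' x"
      proof (rule dense_induct[of "\<lambda>x. J'' x = J' x"])
        show "closed {x. J'' x = J' x}"
          by (intro closed_Collect_eq bounded_linear.continuous_on[OF bl]
              bounded_linear.continuous_on[OF J'(1)] continuous_on_id)
      qed (use J' J'' in simp)
    qed
  qed
  then show "bounded_linear J" "antiunitary_involution J" "a \<in> trace_L2 \<tau> \<Longrightarrow> J (\<Lambda> a) = \<Lambda> (star a)"
    using J' by simp_all
qed

lemmas J_\<Lambda> = J_props(3)

lemma J_add: "J (x + y) = J x + J y" and J_scaleC: "J (c *\<^sub>C x) = cnj c *\<^sub>C J x"
  and J_cinner: "cinner (J x) (J y) = cinner y x" and J_invol: "J (J x) = x"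
  using J_props(2) by (simp_all add: antiunitary_involution_def)

lemma J_scaleR: "J (r *\<^sub>R x) = r *\<^sub>R J x"
  by (simp add: scaleR_scaleC J_scaleC)

lemma J_diff: "J (x - y) = J x - J y"
  using J_add[of "x - y" y] by simp

lemma continuous_on_J: "continuous_on S f \<Longrightarrow> continuous_on S (\<lambda>x. J (f x))"
  by (rule bounded_linear.continuous_on[OF J_props(1)])

text \<open>The trace property \<open>\<tau>(xy\<^sup>*) = \<tau>(y\<^sup>*x)\<close>, in the form of antiunitarity of \<open>J\<close>.\<close>

lemma cinner_\<Lambda>_star:
  "x \<in> trace_L2 \<tau> \<Longrightarrow> y \<in> trace_L2 \<tau> \<Longrightarrow> cinner (\<Lambda> (star x)) (\<Lambda> (star y)) = cinner (\<Lambda> y) (\<Lambda> x)"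
  using J_cinner[of "\<Lambda> x" "\<Lambda> y"] by (simp add: J_\<Lambda>)

lemma lmult_props:
  "bounded_linear (lmult \<tau> \<Lambda> a)" "b \<in> trace_L2 \<tau> \<Longrightarrow> lmult \<tau> \<Lambda> a (\<Lambda> b) = \<Lambda> (a * b)"
proof -
  obtain T where bl: "bounded_linear T" and T: "\<And>b. b \<in> trace_L2 \<tau> \<Longrightarrow> T (\<Lambda> b) = \<Lambda> (a * b)"
  proof (rule bounded_linear_extension[of "trace_L2 \<tau>" \<Lambda> "\<lambda>b. \<Lambda> (a * b)" "norm a"])
  qed (simp_all add: subspace_L2 \<Lambda>_add \<Lambda>_scaleR \<Lambda>_dense distrib_left L2_mult_left norm_\<Lambda>_mult)
  have scale: "T (c *\<^sub>C x) = c *\<^sub>C T x" for c x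
  proof (rule dense_induct[of "\<lambda>x. T (c *\<^sub>C x) = c *\<^sub>C T x"])
    show "closed {x. T (c *\<^sub>C x) = c *\<^sub>C T x}"
      by (intro closed_Collect_eq bounded_linear.continuous_on[OF bl]
          bounded_linear.continuous_on[OF bounded_linear_scaleC] continuous_on_id)
    show "T (c *\<^sub>C \<Lambda> b) = c *\<^sub>C T (\<Lambda> b)" if "b \<in> trace_L2 \<tau>" for b
    proof -
      have "T (c *\<^sub>C \<Lambda> b) = T (\<Lambda> (c *\<^sub>C b))" using that by (simp add: \<Lambda>_scaleC)
      also have "\<dots> = \<Lambda> (c *\<^sub>C (a * b))" using that by (simp add: T L2_scaleC scaleC_mult_right)
      finally show ?thesis using that by (simp add: T \<Lambda>_scaleC L2_mult_left)
    qed
  qed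
  have "lmult \<tau> \<Lambda> a = T"
    unfolding lmult_def
  proof (rule the_equality)
    fix T' assume T': "bounded_linear T' \<and> (\<forall>c \<xi>. T' (c *\<^sub>C \<xi>) = c *\<^sub>C T' \<xi>) \<and> (\<forall>b\<in>trace_L2 \<tau>. T' (\<Lambda> b) = \<Lambda> (a * b))"
    show "T' = T"
    proof
      fix x show "T' x = T x"
      proof (rule dense_induct[of "\<lambda>x. T' x = T x"])
        show "closed {x. T' x = T x}"
          by (intro closed_Collect_eq bounded_linear.continuous_on[OF bl]
              bounded_linear.continuous_on[OF conjunct1[OF T']] continuous_on_id)
      qed (use T T' in simp)
    qed
  qed (use bl T scale in blast)
  then show "bounded_linear (lmult \<tau> \<Lambda> a)" "b \<in> trace_L2 \<tau> \<Longrightarrow> lmult \<tau> \<Lambda> a (\<Lambda> b) = \<Lambda> (a * b)"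
    using bl T by simp_all
qed

lemma continuous_on_lmult: "continuous_on S f \<Longrightarrow> continuous_on S (\<lambda>x. lmult \<tau> \<Lambda> a (f x))"
  by (rule bounded_linear.continuous_on[OF lmult_props(1)])

lemma lmult_linear:
  "lmult \<tau> \<Lambda> (s *\<^sub>R a + t *\<^sub>R b) x = s *\<^sub>R lmult \<tau> \<Lambda> a x + t *\<^sub>R lmult \<tau> \<Lambda> b x"
proof (rule dense_induct[of "\<lambda>x. lmult \<tau> \<Lambda> (s *\<^sub>R a + t *\<^sub>R b) x = s *\<^sub>R lmult \<tau> \<Lambda> a x + t *\<^sub>R lmult \<tau> \<Lambda> b x"])
  show "closed {x. lmult \<tau> \<Lambda> (s *\<^sub>R a + t *\<^sub>R b) x = s *\<^sub>R lmult \<tau> \<Lambda> a x + t *\<^sub>R lmult \<tau> \<Lambda> b x}"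
    by (intro closed_Collect_eq continuous_intros continuous_on_lmult)
qed (simp add: lmult_props(2) distrib_right \<Lambda>_add \<Lambda>_scaleR L2_mult_left L2_scaleR)

end

section \<open>The positive cone\<close>

lemma norm_le_two_if_pos_le_two:
  assumes "pos_le_two e"
  shows "norm e \<le> 2"
proof (rule norm_le_of_left_mult_le)
  fix x
  have "norm (e * x) \<le> norm x + norm (x - e * x)"
    using norm_triangle_ineq4[of x "x - e * x"] by simp
  also have "\<dots> \<le> 2 * norm x" using assms by (simp add: pos_le_two_def)
  finally show "norm (e * x) \<le> 2 * norm x" .
qed simp

text \<open>
  Put \<open>y = b\<^sup>2\<close>. The elements \<open>G\<^sub>k = 1 - (1 - y)\<^sup>k\<close> lie in the algebra, and \<open>e\<^sub>n\<close> is the mean of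
  \<open>G\<^sub>0, \<dots>, G\<^sub>n\<close>. So \<open>1 - e\<^sub>n\<close> is a Cesaro mean of the powers of the contraction \<open>1 - y\<close>, and multiplying
  it by \<open>y\<close> telescopes: \<open>y - e\<^sub>n y\<close> is \<open>G\<^bsub>n+1\<^esub>/(n+1)\<close>, which tends to \<open>0\<close>.
\<close>

lemma local_approximate_unit:
  fixes b :: "'a::cstar_algebra"
  assumes b: "star b = b" "norm b \<le> 1"
  obtains e g where "\<And>n. pos_le_two (e n)" "\<And>n. e n = b * g n" "\<And>n. e n * b = b * e n"
    "(\<lambda>n. e n * b) \<longlonglongrightarrow> b"
proof -
  define y where "y = b * b"
  define G :: "nat \<Rightarrow> 'a" where "G = rec_nat 0 (\<lambda>_ x. y + (x - y * x))"
  have G0: "G 0 = 0" and GS: "G (Suc k) = y + (G k - y * G k)" for k by (simp_all add: G_def)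
  have y: "pos_le_two y" unfolding y_def by (rule pos_le_two_square[OF b])
  have sy: "star y = y" using y by (simp add: pos_le_two_def)
  have yb: "y * b = b * y" by (simp add: y_def mult.assoc)
  have Gb: "G k * b = b * G k" for k
  proof (induction k)
    case (Suc k)
    have "y * G k * b = b * (y * G k)" by (metis Suc mult.assoc yb)
    then show ?case using Suc yb by (simp add: GS algebra_simps)
  qed (simp add: G0)
  have Gy: "G k * y = y * G k" for k unfolding y_def by (metis Gb mult.assoc)
  have sG: "star (G k) = G k" for k
    by (induction k) (simp_all add: G0 GS star_simps sy Gy)
  have G_contr: "norm (x - G k * x) \<le> norm x" for k x
  proof (induction k)
    case (Suc k)
    have "x - G (Suc k) * x = (x - G k * x) - y * (x - G k * x)" by (simp add: GS algebra_simps)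
    also have "norm \<dots> \<le> norm (x - G k * x)" using y by (simp add: pos_le_two_def)
    finally show ?case using Suc by simp
  qed (simp add: G0)
  have pG: "pos_le_two (G k)" for k using sG G_contr by (simp add: pos_le_two_def)
  have "\<exists>g. G k = b * g" for k
  proof (induction k)
    case (Suc k)
    then obtain g where "G k = b * g" by blast
    then have "G (Suc k) = b * (b + (g - b * (b * g)))" by (simp add: GS y_def algebra_simps)
    then show ?case by blast
  qed (auto simp: G0 intro: exI[of _ 0])
  then obtain g where g: "\<And>k. G k = b * g k" by metis
  define c :: "nat \<Rightarrow> real" where "c = (\<lambda>n. 1 / Suc n)"
  have c0: "0 \<le> c n" for n by (simp add: c_def)
  have cn: "c n * Suc n = 1" for n by (simp add: c_def)
  define e where "e = (\<lambda>n. c n *\<^sub>R (\<Sum>k<Suc n. G k))"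
  have csum: "x = c n *\<^sub>R (\<Sum>k<Suc n. x)" for x :: 'a and n
    using cn[of n] by (simp only: sum_constant_scaleR card_lessThan scaleR_scaleR) simp
  have defect: "x - e n * x = c n *\<^sub>R (\<Sum>k<Suc n. x - G k * x)" for n x
    by (subst csum[of x n]) (simp only: e_def sum_subtractf scaleR_diff_right mult_scaleR_left sum_distrib_right)
  have e_contr: "norm (x - e n * x) \<le> norm x" for n x
  proof -
    have "norm (x - e n * x) \<le> c n * (\<Sum>k<Suc n. norm (x - G k * x))"
      unfolding defect norm_scaleR abs_of_nonneg[OF c0] by (intro mult_left_mono norm_sum c0)
    also have "\<dots> \<le> c n * (\<Sum>k<Suc n. norm x)" by (intro mult_left_mono sum_mono G_contr c0)
    also have "\<dots> = norm x" using cn[of n] by (simp add: mult.assoc[symmetric])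
    finally show ?thesis .
  qed
  have starsum: "star (sum f S) = (\<Sum>k\<in>S. star (f k))" for f :: "nat \<Rightarrow> 'a" and S
    by (induction S rule: infinite_finite_induct) (simp_all add: star_add)
  have se: "star (e n) = e n" for n by (simp add: e_def star_scaleR starsum sG star_add)
  have eb: "e n * b = b * e n" for n
    by (simp only: e_def mult_scaleR_left mult_scaleR_right sum_distrib_left sum_distrib_right Gb)
  have tele: "(\<Sum>k<n. y - G k * y) = G n" for n
    by (induction n) (simp_all add: G0 GS Gy algebra_simps)
  have small: "norm (y - e n * y) \<le> 2 * c n" for n
    unfolding defect tele norm_scaleR abs_of_nonneg[OF c0]
    using mult_left_mono[OF norm_le_two_if_pos_le_two[OF pG] c0] by (simp add: mult.commute)
  have d: "norm (e n * b - b) \<le> sqrt (2 * c n)" for n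
  proof -
    define v where "v = b - e n * b"
    have sv: "star v = v" by (simp add: v_def star_simps se b eb)
    have "v * v = (y - e n * y) - e n * (y - e n * y)"
    proof -
      have "b * (e n * b) = e n * (b * b)" by (metis eb mult.assoc)
      then show ?thesis unfolding v_def y_def by (simp add: algebra_simps)
    qed
    then have "(norm v)\<^sup>2 \<le> norm (y - e n * y)"
      using norm_selfadjoint_square[OF sv] e_contr[of "y - e n * y" n] by simp
    then have "norm v \<le> sqrt (2 * c n)" using small[of n] by (intro real_le_rsqrt) simp
    then show ?thesis by (simp add: v_def norm_minus_commute)
  qed
  have "(\<lambda>n. e n * b - b) \<longlonglongrightarrow> 0"
  proof (rule Lim_null_comparison)
    show "\<forall>\<^sub>F n in sequentially. norm (e n * b - b) \<le> sqrt (2 * c n)" using d by simp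
    have "c \<longlonglongrightarrow> 0" unfolding c_def by (rule LIMSEQ_Suc[OF lim_1_over_n])
    then have "(\<lambda>n. sqrt (2 * c n)) \<longlonglongrightarrow> sqrt (2 * 0)" by (intro tendsto_real_sqrt tendsto_mult_left)
    then show "(\<lambda>n. sqrt (2 * c n)) \<longlonglongrightarrow> 0" by simp
  qed
  then have lim: "(\<lambda>n. e n * b) \<longlonglongrightarrow> b" by (rule LIM_zero_cancel)
  show ?thesis
  proof (rule that[OF _ _ eb lim])
    show "pos_le_two (e n)" for n using se e_contr by (simp add: pos_le_two_def)
    show "e n = b * (c n *\<^sub>R (\<Sum>k<Suc n. g k))" for n
      by (simp only: e_def g mult_scaleR_right sum_distrib_left)
  qed
qed

context tracial_gns
begin

text \<open>
  Decompose \<open>c\<^sup>*c = y - z\<close>. Then \<open>(cz)\<^sup>*(cz) = -z\<^sup>3\<close>, while \<open>z\<^sup>3 = (wz)\<^sup>*(wz)\<close> for the square root \<open>w\<close> of \<open>z\<close>. Two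
  positive elements with sum \<open>0\<close> have trace \<open>0\<close>, hence vanish, so \<open>z = 0\<close>. The trace thus replaces the
  comparison of the spectra of \<open>c\<^sup>*c\<close> and \<open>cc\<^sup>*\<close>.
\<close>

lemma pos_le_two_if_cstar_pos:
  assumes x: "x \<in> cstar_pos" "norm x \<le> 1"
  shows "pos_le_two (x :: 'a)"
proof -
  obtain c where c: "x = star c * c" using x(1) by (auto simp: cstar_pos_def)
  obtain y z where yz: "x = y - z" "y * z = 0" "z * y = 0" "pos_le_two y" "pos_le_two z"
    using orthogonal_decomposition_unit_ball[OF cstar_pos_star[OF x(1)] x(2)] .
  obtain w where w: "pos_le_two w" "w * w = z" using pos_le_two_sqrt[OF yz(5)] by metis
  have s: "star z = z" "star w = w" using yz(5) w(1) by (simp_all add: pos_le_two_def)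
  have 1: "star (c * z) * (c * z) = - (z * z * z)"
  proof -
    have "star (c * z) * (c * z) = z * x * z" by (simp add: c star_mult s mult.assoc)
    also have "\<dots> = (z * y) * z - z * z * z" by (simp add: yz(1) algebra_simps)
    finally show ?thesis by (simp add: yz(3))
  qed
  have 2: "star (w * z) * (w * z) = z * z * z"
    by (simp add: star_mult s w(2)[symmetric] mult.assoc)
  have "\<tau> 0 = \<tau> (star (c * z) * (c * z) + star (w * z) * (w * z))" by (simp add: 1 2)
  also have "\<dots> = \<tau> (star (c * z) * (c * z)) + \<tau> (star (w * z) * (w * z))"
    by (intro tau_add star_mult_self_pos)
  finally have "\<tau> (z * z * z) = 0" by (simp add: 2)
  then have zzz: "z * z * z = 0"
    using faithful star_mult_self_pos[of "w * z"] unfolding faithful_trace_def 2 by blast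
  have "(norm z ^ 2) ^ 2 = norm ((z * z) * (z * z))"
    by (subst norm_selfadjoint_square) (simp_all add: star_mult s norm_selfadjoint_square)
  also have "(z * z) * (z * z) = 0" using zzz by (simp add: mult.assoc[symmetric])
  finally have "z = 0" by simp
  then show ?thesis using yz by simp
qed

lemma cstar_pos_add:
  assumes x: "x \<in> cstar_pos" and y: "y \<in> cstar_pos"
  shows "x + y \<in> (cstar_pos :: 'a set)"
proof -
  define r where "r = norm x + norm y + 1"
  have r: "r > 0" by (simp add: r_def add_nonneg_pos)
  have p: "pos_le_two ((1/r) *\<^sub>R v)" if "v \<in> cstar_pos" "norm v \<le> r" for v :: 'a
    by (rule pos_le_two_if_cstar_pos) (use that r in \<open>simp_all add: cstar_pos_scaleR\<close>)
  have "pos_le_two ((1/2) *\<^sub>R ((1/r) *\<^sub>R x) + (1/2) *\<^sub>R ((1/r) *\<^sub>R y))"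
    by (intro pos_le_two_convex p x y) (simp_all add: r_def)
  then have "(2 * r) *\<^sub>R ((1/2) *\<^sub>R ((1/r) *\<^sub>R x) + (1/2) *\<^sub>R ((1/r) *\<^sub>R y)) \<in> cstar_pos"
    using r by (intro cstar_pos_scaleR pos_le_two_cstar_pos) simp_all
  also have "(2 * r) *\<^sub>R ((1/2) *\<^sub>R ((1/r) *\<^sub>R x) + (1/2) *\<^sub>R ((1/r) *\<^sub>R y)) = x + y"
    using r by (simp add: scaleR_add_right)
  finally show ?thesis .
qed

text \<open>Norm convergence of \<open>e\<^sub>nb\<close> to \<open>b\<close> is upgraded to \<open>L\<^sup>2\<close> convergence by lower semicontinuity. With
  \<open>d\<^sub>n = b - e\<^sub>nb\<close>, the element \<open>b\<^sup>2 - d\<^sub>n\<^sup>2\<close> is positive and converges to \<open>b\<^sup>2\<close> in norm, so its trace has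
  lower limit at least \<open>\<tau>(b\<^sup>2)\<close>, and nothing is left for \<open>\<tau>(d\<^sub>n\<^sup>2)\<close>.\<close>

lemma approx_unit_L2:
  assumes b: "b \<in> cstar_pos" "b \<in> trace_L2 \<tau>" "norm b \<le> 1"
    and e: "\<And>n. pos_le_two (e n)" "\<And>n. e n * b = b * e n" "(\<lambda>n. e n * b) \<longlonglongrightarrow> b"
  shows "(\<lambda>n. \<Lambda> (b - e n * b)) \<longlonglongrightarrow> 0"
proof -
  define d where "d = (\<lambda>n. b - e n * b)"
  define X where "X = (\<lambda>n. b * b - d n * d n)"
  have sb: "star b = b" by (rule cstar_pos_star[OF b(1)])
  have se: "star (e n) = e n" for n using e(1) by (simp add: pos_le_two_def)
  have sd: "star (d n) = d n" for n by (simp add: d_def star_simps sb se e(2))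
  have dL: "d n \<in> trace_L2 \<tau>" for n unfolding d_def by (intro L2_diff b L2_mult_left)
  have Xpos: "X n \<in> cstar_pos" for n
  proof -
    \<comment> \<open>\<open>1 - t = (1 - e\<^sub>n)\<^sup>2\<close>, so \<open>t\<close> has a square root commuting with \<open>b\<close> and \<open>X\<^sub>n = tb\<^sup>2\<close> is a square.\<close>
    define t where "t = e n + e n - e n * e n"
    have "norm (x - t * x) \<le> norm x" for x
    proof -
      have "x - t * x = (x - e n * x) - e n * (x - e n * x)" by (simp add: t_def algebra_simps)
      moreover have "norm ((x - e n * x) - e n * (x - e n * x)) \<le> norm (x - e n * x)"
        using e(1)[of n] unfolding pos_le_two_def by blast
      ultimately have "norm (x - t * x) \<le> norm (x - e n * x)" by (simp only:)
      also have "\<dots> \<le> norm x" using e(1)[of n] by (simp add: pos_le_two_def)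
      finally show ?thesis .
    qed
    then have "pos_le_two t" by (simp add: pos_le_two_def t_def star_simps se)
    then obtain h where h: "pos_le_two h" "h * h = t" "\<And>c. c * t = t * c \<Longrightarrow> c * h = h * c"
      using pos_le_two_sqrt by metis
    have sh: "star h = h" using h(1) by (simp add: pos_le_two_def)
    have "b * (e n * e n) = e n * e n * b" by (metis e(2) mult.assoc)
    then have "b * t = t * b" by (simp add: t_def algebra_simps e(2))
    then have bh: "b * h = h * b" by (rule h(3))
    have "b * e n * b = e n * b * b" by (simp add: e(2))
    moreover have "e n * b * (e n * b) = e n * e n * b * b" by (metis e(2) mult.assoc)
    ultimately have "X n = t * b * b"
      by (simp add: X_def d_def t_def algebra_simps)
    also have "\<dots> = star (h * b) * (h * b)"
      unfolding h(2)[symmetric] star_mult sb sh by (metis bh mult.assoc)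
    finally show ?thesis by (simp add: star_mult_self_pos)
  qed
  have Xlim: "X \<longlonglongrightarrow> b * b"
  proof -
    have "(\<lambda>n. b * b - (b - e n * b) * (b - e n * b)) \<longlonglongrightarrow> b * b - (b - b) * (b - b)"
      by (intro tendsto_diff tendsto_mult tendsto_const e(3))
    then show ?thesis by (simp add: X_def d_def)
  qed
  have split: "\<tau> (b * b) = \<tau> (X n) + \<tau> (d n * d n)" for n
  proof -
    have "b * b = X n + d n * d n" by (simp add: X_def)
    then show ?thesis using tau_add[OF Xpos square_cstar_pos[OF sd], of n n] by simp
  qed
  define B where "B = (norm (\<Lambda> b))\<^sup>2"
  have tb: "\<tau> (b * b) = ennreal B" using tau_eq_norm_\<Lambda>[OF b(2)] by (simp add: sb B_def)
  have td: "\<tau> (d n * d n) = ennreal ((norm (\<Lambda> (d n)))\<^sup>2)" for n using tau_eq_norm_\<Lambda>[OF dL] by (simp add: sd)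
  have "ennreal B \<le> liminf (\<lambda>n. \<tau> (X n))"
    using lsc Xlim Xpos square_cstar_pos[OF sb] unfolding lsc_trace_def tb[symmetric] by blast
  have "(\<lambda>n. (norm (\<Lambda> (d n)))\<^sup>2) \<longlonglongrightarrow> 0"
  proof (rule LIMSEQ_I)
    fix r :: real assume r: "r > 0"
    have "\<forall>\<^sub>F n in sequentially. (norm (\<Lambda> (d n)))\<^sup>2 < r"
    proof (cases "B < r")
      case True
      have "ennreal ((norm (\<Lambda> (d n)))\<^sup>2) \<le> ennreal B" for n using split[of n] tb td[of n] by simp
      then have "(norm (\<Lambda> (d n)))\<^sup>2 \<le> B" for n by (simp add: B_def)
      then show ?thesis using True by (intro always_eventually allI) (rule le_less_trans)
    next
      case False
      then have "ennreal (B - r) < ennreal B" using r by (simp add: ennreal_less_iff)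
      then have "\<forall>\<^sub>F n in sequentially. ennreal (B - r) < \<tau> (X n)"
        using \<open>ennreal B \<le> _\<close> less_LiminfD by (metis order_less_le_trans)
      then show ?thesis
      proof (rule eventually_mono)
        fix n assume n: "ennreal (B - r) < \<tau> (X n)"
        have fin: "ennreal B = \<tau> (X n) + ennreal ((norm (\<Lambda> (d n)))\<^sup>2)"
          using split[of n] tb td[of n] by simp
        then have "\<tau> (X n) < top"
          by (metis ennreal_less_top ennreal_add_eq_top less_top)
        then obtain x where x: "\<tau> (X n) = ennreal x" "0 \<le> x" by (cases "\<tau> (X n)") auto
        then have "B = x + (norm (\<Lambda> (d n)))\<^sup>2"
          using fin by (simp add: B_def flip: ennreal_plus)
        moreover have "B - r < x"
          using n x(1) False ennreal_less_iff[of "B - r" x] by simp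
        ultimately show "(norm (\<Lambda> (d n)))\<^sup>2 < r" by simp
      qed
    qed
    then show "\<exists>no. \<forall>n\<ge>no. norm ((norm (\<Lambda> (d n)))\<^sup>2 - 0) < r"
      by (simp add: eventually_sequentially)
  qed
  then have "(\<lambda>n. sqrt ((norm (\<Lambda> (d n)))\<^sup>2)) \<longlonglongrightarrow> sqrt 0" by (rule tendsto_real_sqrt)
  then show ?thesis by (simp add: tendsto_norm_zero_iff d_def)
qed

text \<open>A positive \<open>b = c\<^sup>*c\<close> in \<open>L\<^sup>2\<close> need not come from a \<open>c\<close> in \<open>L\<^sup>2\<close>, but \<open>ce\<^sub>n\<close> is in \<open>L\<^sup>2\<close>, because \<open>e\<^sub>n\<close> has the
  factor \<open>b\<close>, and \<open>(ce\<^sub>n)\<^sup>*(ce\<^sub>n) = e\<^sub>n\<^sup>2b\<close> tends to \<open>b\<close>. For such squares the trace property can be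
  applied to products.\<close>

lemma squares_dense_in_pos:
  assumes b: "b \<in> cstar_pos" "b \<in> trace_L2 \<tau>"
  shows "\<Lambda> b \<in> closure {\<Lambda> (star u * u) | u. u \<in> trace_L2 \<tau>}"
proof -
  define r where "r = norm b + 1"
  have r: "r > 0" by (simp add: r_def add_nonneg_pos)
  define b' where "b' = (1/r) *\<^sub>R b"
  have b': "b' \<in> cstar_pos" "b' \<in> trace_L2 \<tau>" "norm b' \<le> 1" "b = r *\<^sub>R b'"
    using b r by (simp_all add: b'_def cstar_pos_scaleR L2_scaleR) (simp add: r_def)
  obtain c where c: "b' = star c * c" using b'(1) by (auto simp: cstar_pos_def)
  obtain e g where e: "\<And>n. pos_le_two (e n)" "\<And>n. e n = b' * g n" "\<And>n. e n * b' = b' * e n"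
    "(\<lambda>n. e n * b') \<longlonglongrightarrow> b'"
    using local_approximate_unit[OF cstar_pos_star[OF b'(1)] b'(3)] by metis
  have se: "star (e n) = e n" for n using e(1) by (simp add: pos_le_two_def)
  define d where "d = (\<lambda>n. b' - e n * b')"
  have dL: "d n \<in> trace_L2 \<tau>" for n unfolding d_def by (intro L2_diff b' L2_mult_left)
  have d0: "(\<lambda>n. \<Lambda> (d n)) \<longlonglongrightarrow> 0" unfolding d_def by (rule approx_unit_L2[OF b'(1-3) e(1,3,4)])
  define u where "u = (\<lambda>n. sqrt r *\<^sub>R (c * e n))"
  have uL: "u n \<in> trace_L2 \<tau>" for n
    unfolding u_def e(2) by (intro L2_scaleR L2_mult_left L2_mult_right b'(2))
  have uu: "star (u n) * u n = r *\<^sub>R (e n * e n * b')" for n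
  proof -
    have "star (u n) * u n = r *\<^sub>R (e n * b' * e n)"
      using r by (simp add: u_def star_simps se c mult.assoc)
    also have "e n * b' * e n = e n * e n * b'" by (metis e(3) mult.assoc)
    finally show ?thesis .
  qed
  have "b - star (u n) * u n = r *\<^sub>R (d n + e n * d n)" for n
    unfolding uu b'(4) d_def by (simp add: algebra_simps)
  then have diff: "\<Lambda> b - \<Lambda> (star (u n) * u n) = r *\<^sub>R (\<Lambda> (d n) + \<Lambda> (e n * d n))" for n
    using b(2) uL[of n] dL[of n]
    by (metis L2_add L2_mult_left \<Lambda>_add \<Lambda>_diff \<Lambda>_scaleR)
  have "(\<lambda>n. \<Lambda> b - \<Lambda> (star (u n) * u n)) \<longlonglongrightarrow> 0"
  proof (rule Lim_null_comparison)
    have "norm (\<Lambda> b - \<Lambda> (star (u n) * u n)) \<le> (r * 3) * norm (\<Lambda> (d n))" for n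
    proof -
      have "norm (\<Lambda> (e n * d n)) \<le> 2 * norm (\<Lambda> (d n))"
        using norm_\<Lambda>_mult[OF dL, of "e n"] mult_right_mono[OF norm_le_two_if_pos_le_two[OF e(1)], of "norm (\<Lambda> (d n))"]
        by (meson norm_ge_zero order_trans)
      then have "norm (\<Lambda> (d n) + \<Lambda> (e n * d n)) \<le> 3 * norm (\<Lambda> (d n))"
        using norm_triangle_ineq[of "\<Lambda> (d n)" "\<Lambda> (e n * d n)"] by linarith
      then show ?thesis using r by (simp add: diff)
    qed
    then show "\<forall>\<^sub>F n in sequentially. norm (\<Lambda> b - \<Lambda> (star (u n) * u n)) \<le> (r * 3) * norm (\<Lambda> (d n))" by simp
    show "(\<lambda>n. (r * 3) * norm (\<Lambda> (d n))) \<longlonglongrightarrow> 0"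
      using tendsto_mult_left[OF tendsto_norm[OF d0], of "r * 3"] by simp
  qed
  from tendsto_diff[OF tendsto_const[of "\<Lambda> b"] this]
  have "(\<lambda>n. \<Lambda> (star (u n) * u n)) \<longlonglongrightarrow> \<Lambda> b" by simp
  then show ?thesis
    unfolding closure_sequential
    by (intro exI[of _ "\<lambda>n. \<Lambda> (star (u n) * u n)"]) (use uL in blast)
qed

abbreviation K where "K \<equiv> L2_pos \<tau> \<Lambda>"

lemma K_closed: "closed K" by (simp add: L2_pos_def)

lemma \<Lambda>_in_K: "x \<in> cstar_pos \<Longrightarrow> x \<in> trace_L2 \<tau> \<Longrightarrow> \<Lambda> x \<in> K"
  unfolding L2_pos_def by (intro subsetD[OF closure_subset] imageI IntI)

lemma zero_in_K: "0 \<in> K"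
  using \<Lambda>_in_K[OF _ L2_zero] star_mult_self_pos[of 0] by (simp add: \<Lambda>_zero)

lemma K_convex: "convex K"
  unfolding L2_pos_def
proof (rule convex_closure, rule convexI)
  fix v w and s t :: real
  assume "v \<in> \<Lambda> ` (cstar_pos \<inter> trace_L2 \<tau>)" "w \<in> \<Lambda> ` (cstar_pos \<inter> trace_L2 \<tau>)" and st: "0 \<le> s" "0 \<le> t"
  then obtain a b where ab: "v = \<Lambda> a" "w = \<Lambda> b" "a \<in> cstar_pos" "b \<in> cstar_pos" "a \<in> trace_L2 \<tau>" "b \<in> trace_L2 \<tau>"
    by blast
  have "s *\<^sub>R v + t *\<^sub>R w = \<Lambda> (s *\<^sub>R a + t *\<^sub>R b)" using ab by (simp add: \<Lambda>_add \<Lambda>_scaleR L2_scaleR)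
  moreover have "s *\<^sub>R a + t *\<^sub>R b \<in> cstar_pos \<inter> trace_L2 \<tau>"
    using ab st by (simp add: cstar_pos_add cstar_pos_scaleR L2_add L2_scaleR)
  ultimately show "s *\<^sub>R v + t *\<^sub>R w \<in> \<Lambda> ` (cstar_pos \<inter> trace_L2 \<tau>)" by blast
qed

lemma closed_induct_K:
  assumes "closed {v. P v}" "\<And>a. a \<in> cstar_pos \<Longrightarrow> a \<in> trace_L2 \<tau> \<Longrightarrow> P (\<Lambda> a)" "v \<in> K"
  shows "P v"
proof -
  have "K \<subseteq> {v. P v}" unfolding L2_pos_def using assms by (intro closure_minimal) auto
  then show ?thesis using assms(3) by auto
qed

lemma K_scaleR:
  assumes "v \<in> K" "0 \<le> r"
  shows "r *\<^sub>R v \<in> K"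
proof (rule closed_induct_K[of "\<lambda>v. r *\<^sub>R v \<in> K", OF _ _ assms(1)])
  have "closed ((\<lambda>v. r *\<^sub>R v) -` K)" by (intro closed_vimage K_closed continuous_intros)
  then show "closed {v. r *\<^sub>R v \<in> K}" by (simp add: vimage_def)
  show "r *\<^sub>R \<Lambda> a \<in> K" if "a \<in> cstar_pos" "a \<in> trace_L2 \<tau>" for a
    using \<Lambda>_in_K[of "r *\<^sub>R a"] that assms(2) by (simp add: \<Lambda>_scaleR cstar_pos_scaleR L2_scaleR)
qed

lemma K_J: "v \<in> K \<Longrightarrow> J v = v"
proof (rule closed_induct_K[of "\<lambda>v. J v = v"])
  show "closed {v. J v = v}" by (intro closed_Collect_eq continuous_on_J continuous_on_id)
qed (simp_all add: J_\<Lambda> cstar_pos_star)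

lemma closed_induct_K_square:
  assumes P: "closed {v. P v}" "\<And>u. u \<in> trace_L2 \<tau> \<Longrightarrow> P (\<Lambda> (star u * u))" and v: "v \<in> K"
  shows "P v"
proof (rule closed_induct_K[OF P(1) _ v])
  fix a assume a: "a \<in> cstar_pos" "a \<in> trace_L2 \<tau>"
  have "closure {\<Lambda> (star u * u) | u. u \<in> trace_L2 \<tau>} \<subseteq> {v. P v}"
    using P by (intro closure_minimal) auto
  then show "P (\<Lambda> a)" using squares_dense_in_pos[OF a] by auto
qed

text \<open>The trace property in the form \<open>\<tau>(a u\<^sup>*u) = \<tau>(u a u\<^sup>*)\<close>: pairing with a square tests \<open>a\<close> as an operator on
  the vector of \<open>u\<^sup>*\<close>. It links the order of operators with the order of the cone.\<close>

lemma cinner_square: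
  assumes a: "a \<in> trace_L2 \<tau>" "star a = a" and u: "u \<in> trace_L2 \<tau>"
  shows "cinner (\<Lambda> a) (\<Lambda> (star u * u)) = cinner (\<Lambda> (star u)) (\<Lambda> (a * star u))"
proof -
  have "cinner (\<Lambda> a) (\<Lambda> (star u * u)) = cinner (\<Lambda> (u * a)) (\<Lambda> u)"
    using cinner_\<Lambda>_mult[OF a(1) u, of "star u"] by (simp add: star_star)
  also have "\<dots> = cinner (\<Lambda> (star u)) (\<Lambda> (star (u * a)))"
    using cinner_\<Lambda>_star[OF u L2_mult_left[OF a(1), of u]] by simp
  finally show ?thesis by (simp add: star_mult a)
qed

lemma K_inner_nonneg:
  assumes "v \<in> K" "w \<in> K"
  shows "0 \<le> inner v w"
proof (rule closed_induct_K_square[of "\<lambda>w. 0 \<le> inner v w", OF _ _ assms(2)])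
  show "closed {w. 0 \<le> inner v w}" by (intro closed_Collect_le continuous_intros)
  fix u assume u: "u \<in> trace_L2 \<tau>"
  show "0 \<le> inner v (\<Lambda> (star u * u))"
  proof (rule closed_induct_K[of "\<lambda>v. 0 \<le> inner v (\<Lambda> (star u * u))", OF _ _ assms(1)])
    show "closed {v. 0 \<le> inner v (\<Lambda> (star u * u))}" by (intro closed_Collect_le continuous_intros)
    fix a assume a: "a \<in> cstar_pos" "a \<in> trace_L2 \<tau>"
    obtain c where c: "a = star c * c" using a(1) by (auto simp: cstar_pos_def)
    have "cinner (\<Lambda> a) (\<Lambda> (star u * u)) = cinner (\<Lambda> (star u)) (\<Lambda> (star c * (c * star u)))"
      using cinner_square[OF a(2) cstar_pos_star[OF a(1)] u] by (simp add: c mult.assoc)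
    also have "\<dots> = cinner (\<Lambda> (c * star u)) (\<Lambda> (c * star u))"
      using cinner_\<Lambda>_mult[of "star u" "c * star u" "star c"] u by (simp add: L2_star L2_mult_left star_star)
    finally show "0 \<le> inner (\<Lambda> a) (\<Lambda> (star u * u))"
      by (simp add: inner_eq_Re_cinner cinner_self)
  qed
qed

text \<open>The decomposition \<open>a = y - z\<close> is also the one of Moreau: \<open>z\<close> is orthogonal to \<open>y\<close> and pairs nonnegatively
  with the cone, so \<open>y\<close> satisfies the obtuse-angle criterion for the projection of \<open>a\<close>.\<close>

lemma positive_part:
  assumes a: "a \<in> trace_L2 \<tau>" "star a = a"
  obtains y z where "a = y - z" "y \<in> cstar_pos" "z \<in> cstar_pos" "y \<in> trace_L2 \<tau>" "z \<in> trace_L2 \<tau>"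
    "inner (\<Lambda> y) (\<Lambda> z) = 0" "nearest dist K (\<Lambda> a) = \<Lambda> y"
proof -
  obtain y z where yz: "a = y - z" "y * z = 0" "z * y = 0" "y \<in> cstar_pos" "z \<in> cstar_pos"
    using orthogonal_decomposition[OF a(2)] .
  have s: "star y = y" "star z = z" using yz cstar_pos_star by blast+
  have "star a * a = star y * y + star z * z"
    unfolding a(2) s unfolding yz(1) by (simp add: yz(2,3) algebra_simps)
  then have "\<tau> (star a * a) = \<tau> (star y * y) + \<tau> (star z * z)"
    using tau_add[OF star_mult_self_pos star_mult_self_pos, of y z] by simp
  then have L: "y \<in> trace_L2 \<tau>" "z \<in> trace_L2 \<tau>" using a by (auto simp: trace_L2_def)
  have "cinner (\<Lambda> y) (\<Lambda> z) = cinner (\<Lambda> 0) (\<Lambda> 0)"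
    using L by (simp only: cinner_\<Lambda> L2_zero) (simp add: s yz)
  then have o: "inner (\<Lambda> y) (\<Lambda> z) = 0" by (simp add: inner_eq_Re_cinner \<Lambda>_zero cinner_self)
  have "nearest dist K (\<Lambda> a) = \<Lambda> y"
  proof (rule nearest_eqI[OF K_closed K_convex \<Lambda>_in_K[OF yz(4) L(1)]])
    fix k assume k: "k \<in> K"
    have "inner (\<Lambda> z) k \<ge> 0" using K_inner_nonneg[OF \<Lambda>_in_K[OF yz(5) L(2)] k] .
    then show "inner (\<Lambda> a - \<Lambda> y) (k - \<Lambda> y) \<le> 0"
      using o L by (simp add: yz(1) \<Lambda>_diff inner_diff_right inner_commute)
  qed
  then show ?thesis using that yz L o by blast
qed

lemma selfadjoint_approx:
  assumes "J \<xi> = \<xi>"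
  obtains a :: "nat \<Rightarrow> 'a" where "\<And>n. a n \<in> trace_L2 \<tau>" "\<And>n. star (a n) = a n" "(\<lambda>n. \<Lambda> (a n)) \<longlonglongrightarrow> \<xi>"
proof -
  have "\<xi> \<in> closure (\<Lambda> ` trace_L2 \<tau>)" using \<Lambda>_dense by simp
  then obtain x where "\<And>n. x n \<in> \<Lambda> ` trace_L2 \<tau>" and lim: "x \<longlonglongrightarrow> \<xi>"
    unfolding closure_sequential by blast
  then have "\<forall>n. \<exists>b\<in>trace_L2 \<tau>. x n = \<Lambda> b" by blast
  then obtain b where b: "\<And>n. b n \<in> trace_L2 \<tau>" "\<And>n. x n = \<Lambda> (b n)" by metis
  define a where "a = (\<lambda>n. (1/2) *\<^sub>R (b n + star (b n)))"
  have \<Lambda>a: "\<Lambda> (a n) = (1/2) *\<^sub>R (x n + J (x n))" for n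
    by (simp add: a_def b \<Lambda>_scaleR \<Lambda>_add L2_add L2_star J_\<Lambda>)
  have "(\<lambda>n. (1/2) *\<^sub>R (x n + J (x n))) \<longlonglongrightarrow> (1/2) *\<^sub>R (\<xi> + J \<xi>)"
    by (intro tendsto_scaleR tendsto_const tendsto_add lim bounded_linear.tendsto[OF J_props(1)])
  then have "(\<lambda>n. \<Lambda> (a n)) \<longlonglongrightarrow> \<xi>" using assms by (simp add: \<Lambda>a scaleR_2[symmetric])
  moreover have "a n \<in> trace_L2 \<tau>" "star (a n) = a n" for n
    by (simp_all add: a_def L2_scaleR L2_add L2_star b star_simps add.commute)
  ultimately show ?thesis using that by blast
qed

text \<open>For elements of the algebra this is the decomposition into positive parts; the general case follows by
  continuity of the projection.\<close>

lemma negative_part_in_K: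
  assumes "J \<xi> = \<xi>"
  shows "nearest dist K \<xi> - \<xi> \<in> K"
proof -
  obtain a :: "nat \<Rightarrow> 'a" where a: "\<And>n. a n \<in> trace_L2 \<tau>" "\<And>n. star (a n) = a n" "(\<lambda>n. \<Lambda> (a n)) \<longlonglongrightarrow> \<xi>"
    using selfadjoint_approx[OF assms] by blast
  have neK: "K \<noteq> {}" using zero_in_K by auto
  have "nearest dist K (\<Lambda> (a n)) - \<Lambda> (a n) \<in> K" for n
  proof -
    obtain y z where yz: "a n = y - z" "y \<in> cstar_pos" "z \<in> cstar_pos" "y \<in> trace_L2 \<tau>" "z \<in> trace_L2 \<tau>"
      "inner (\<Lambda> y) (\<Lambda> z) = 0" "nearest dist K (\<Lambda> (a n)) = \<Lambda> y"
      using positive_part[OF a(1,2)] .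
    have "\<Lambda> (a n) = \<Lambda> y - \<Lambda> z" using yz by (simp add: \<Lambda>_diff)
    then show ?thesis using \<Lambda>_in_K[OF yz(3,5)] yz(7) by simp
  qed
  moreover have "(\<lambda>n. nearest dist K (\<Lambda> (a n)) - \<Lambda> (a n)) \<longlonglongrightarrow> nearest dist K \<xi> - \<xi>"
    by (intro tendsto_diff a(3) nearest_tendsto[OF K_closed K_convex neK])
  ultimately show ?thesis
    using closed_sequentially[OF K_closed, of "\<lambda>n. nearest dist K (\<Lambda> (a n)) - \<Lambda> (a n)"] by blast
qed

text \<open>For \<open>p\<close> the projection of \<open>\<xi>\<close> onto the cone, \<open>p - \<xi>\<close> is orthogonal to \<open>p\<close> and in the cone, so
  \<open>\<parallel>p - \<xi>\<parallel>\<^sup>2 = -(p - \<xi>, \<xi>)\<close> is at most \<open>0\<close>.\<close>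

lemma K_selfdual:
  assumes J: "J \<xi> = \<xi>" and pos: "\<And>k. k \<in> K \<Longrightarrow> 0 \<le> inner \<xi> k"
  shows "\<xi> \<in> K"
proof -
  let ?p = "nearest dist K \<xi>"
  have neK: "K \<noteq> {}" using zero_in_K by auto
  have pK: "?p \<in> K" by (rule nearest_in[OF K_closed K_convex neK])
  have "inner (\<xi> - ?p) (0 - ?p) \<le> 0" "0 \<le> inner \<xi> (?p - \<xi>)"
    using nearest_dot[OF K_closed K_convex neK zero_in_K] pos[OF negative_part_in_K[OF J]] by blast+
  then have "inner (?p - \<xi>) (?p - \<xi>) \<le> 0"
    by (simp add: inner_simps inner_commute algebra_simps)
  then have "?p - \<xi> = 0" by (metis inner_eq_zero_iff inner_ge_zero order_antisym)
  then show ?thesis using pK by simp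
qed

end

section \<open>Elements below the unit\<close>

lemma cinner_scaleR_right: "cinner x (r *\<^sub>R y) = complex_of_real r * cinner x (y::'h::chilbert_space)"
  by (simp add: scaleR_scaleC cinner_scaleC_right)

context tracial_gns
begin

definition "below_unit = {a \<in> trace_L2 \<tau>. star a = a \<and> le_unit \<tau> \<Lambda> a}"
text \<open>The set onto which \<open>\<xi> \<mapsto> \<xi> \<and> 1\<close> projects.\<close>

definition "C = closure (\<Lambda> ` below_unit)"

lemma le_unit_uminus:
  assumes "k \<in> cstar_pos"
  shows "le_unit \<tau> \<Lambda> (- k)"
  unfolding le_unit_def
proof
  fix \<xi>
  obtain c where c: "k = star c * c" using assms by (auto simp: cstar_pos_def)
  show "cinner \<xi> (\<xi> - lmult \<tau> \<Lambda> (- k) \<xi>) \<in> \<real>\<^sub>\<ge>\<^sub>0"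
  proof (rule dense_induct[of "\<lambda>\<xi>. cinner \<xi> (\<xi> - lmult \<tau> \<Lambda> (- k) \<xi>) \<in> \<real>\<^sub>\<ge>\<^sub>0"])
    have "closed ((\<lambda>\<xi>. cinner \<xi> (\<xi> - lmult \<tau> \<Lambda> (- k) \<xi>)) -` \<real>\<^sub>\<ge>\<^sub>0)"
      by (intro closed_vimage closed_nonneg_Reals_complex continuous_on_cinner continuous_on_diff
          continuous_on_lmult continuous_on_id)
    then show "closed {\<xi>. cinner \<xi> (\<xi> - lmult \<tau> \<Lambda> (- k) \<xi>) \<in> \<real>\<^sub>\<ge>\<^sub>0}" by (simp add: vimage_def)
    fix b assume b: "b \<in> trace_L2 \<tau>"
    have "lmult \<tau> \<Lambda> (- k) (\<Lambda> b) = \<Lambda> ((-1) *\<^sub>R (k * b))" using b by (simp add: lmult_props(2))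
    also have "\<dots> = - \<Lambda> (k * b)" using \<Lambda>_scaleR[OF L2_mult_left[OF b], of "-1" k] by simp
    finally have "cinner (\<Lambda> b) (\<Lambda> b - lmult \<tau> \<Lambda> (- k) (\<Lambda> b)) = cinner (\<Lambda> b) (\<Lambda> b) + cinner (\<Lambda> b) (\<Lambda> (star c * (c * b)))"
      by (simp add: cinner_add_right c mult.assoc)
    also have "cinner (\<Lambda> b) (\<Lambda> (star c * (c * b))) = cinner (\<Lambda> (c * b)) (\<Lambda> (c * b))"
      using cinner_\<Lambda>_mult[OF b L2_mult_left[OF b], of "star c"] by (simp add: star_star)
    finally show "cinner (\<Lambda> b) (\<Lambda> b - lmult \<tau> \<Lambda> (- k) (\<Lambda> b)) \<in> \<real>\<^sub>\<ge>\<^sub>0"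
      by (simp add: cinner_self complex_nonneg_Reals_iff)
  qed
qed

lemma C_closed: "closed C" by (simp add: C_def)

lemma C_convex: "convex C"
  unfolding C_def
proof (rule convex_closure, rule convexI)
  fix v w and s t :: real
  assume "v \<in> \<Lambda> ` below_unit" "w \<in> \<Lambda> ` below_unit" and st: "0 \<le> s" "0 \<le> t" "s + t = 1"
  then obtain a b where ab: "v = \<Lambda> a" "w = \<Lambda> b" "a \<in> below_unit" "b \<in> below_unit" by blast
  then have ab': "a \<in> trace_L2 \<tau>" "b \<in> trace_L2 \<tau>" "star a = a" "star b = b" "le_unit \<tau> \<Lambda> a" "le_unit \<tau> \<Lambda> b"
    by (simp_all add: below_unit_def)
  have "le_unit \<tau> \<Lambda> (s *\<^sub>R a + t *\<^sub>R b)"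
    unfolding le_unit_def
  proof
    fix \<xi>
    have "(s + t) *\<^sub>R \<xi> - (s *\<^sub>R lmult \<tau> \<Lambda> a \<xi> + t *\<^sub>R lmult \<tau> \<Lambda> b \<xi>)
        = s *\<^sub>R (\<xi> - lmult \<tau> \<Lambda> a \<xi>) + t *\<^sub>R (\<xi> - lmult \<tau> \<Lambda> b \<xi>)"
      by (simp add: algebra_simps)
    then have "cinner \<xi> (\<xi> - lmult \<tau> \<Lambda> (s *\<^sub>R a + t *\<^sub>R b) \<xi>) =
        complex_of_real s * cinner \<xi> (\<xi> - lmult \<tau> \<Lambda> a \<xi>) + complex_of_real t * cinner \<xi> (\<xi> - lmult \<tau> \<Lambda> b \<xi>)"
      using st(3) by (simp add: lmult_linear cinner_add_right cinner_scaleR_right)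
    also have "\<dots> \<in> \<real>\<^sub>\<ge>\<^sub>0"
      using ab'(5,6) st by (intro nonneg_Reals_add_I nonneg_Reals_mult_I) (auto simp: le_unit_def)
    finally show "cinner \<xi> (\<xi> - lmult \<tau> \<Lambda> (s *\<^sub>R a + t *\<^sub>R b) \<xi>) \<in> \<real>\<^sub>\<ge>\<^sub>0" .
  qed
  then have "s *\<^sub>R a + t *\<^sub>R b \<in> below_unit" using ab' by (simp add: below_unit_def L2_add L2_scaleR star_simps)
  moreover have "s *\<^sub>R v + t *\<^sub>R w = \<Lambda> (s *\<^sub>R a + t *\<^sub>R b)"
    using ab ab' by (simp add: \<Lambda>_add \<Lambda>_scaleR L2_scaleR)
  ultimately show "s *\<^sub>R v + t *\<^sub>R w \<in> \<Lambda> ` below_unit" by blast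
qed

lemma uminus_K_subset_C:
  assumes "v \<in> K"
  shows "- v \<in> C"
proof (rule closed_induct_K[of "\<lambda>v. - v \<in> C", OF _ _ assms])
  have "closed (uminus -` C)" by (intro closed_vimage C_closed continuous_intros)
  then show "closed {v. - v \<in> C}" by (simp add: vimage_def)
  fix a assume a: "a \<in> cstar_pos" "a \<in> trace_L2 \<tau>"
  have "- a \<in> below_unit"
    using L2_scaleR[OF a(2), of "-1"] le_unit_uminus[OF a(1)] cstar_pos_star[OF a(1)]
    by (simp add: below_unit_def star_minus)
  moreover have "\<Lambda> (- a) = - \<Lambda> a" using \<Lambda>_scaleR[OF a(2), of "-1"] by simp
  ultimately have "- \<Lambda> a \<in> \<Lambda> ` below_unit" by (metis imageI)
  then show "- \<Lambda> a \<in> C" unfolding C_def by (rule subsetD[OF closure_subset])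
qed

lemma zero_in_C: "0 \<in> C"
  using uminus_K_subset_C[OF zero_in_K] by simp

lemma closed_induct_C:
  assumes "closed {v. P v}" "\<And>a. a \<in> below_unit \<Longrightarrow> P (\<Lambda> a)" "v \<in> C"
  shows "P v"
proof -
  have "C \<subseteq> {v. P v}" unfolding C_def using assms by (intro closure_minimal) auto
  then show ?thesis using assms(3) by auto
qed

lemma C_J: "v \<in> C \<Longrightarrow> J v = v"
proof (rule closed_induct_C[of "\<lambda>v. J v = v"])
  show "closed {v. J v = v}" by (intro closed_Collect_eq continuous_on_J continuous_on_id)
qed (simp_all add: below_unit_def J_\<Lambda>)

text \<open>The bound \<open>\<tau>(a u\<^sup>*u) = \<tau>(u a u\<^sup>*) \<le> \<tau>(uu\<^sup>*)\<close> for \<open>a \<le> 1\<close>. It is how the condition \<open>a \<le> 1\<close> survives the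
  closure in \<open>L\<^sup>2\<close>.\<close>

lemma C_inner_le:
  assumes "v \<in> C" "u \<in> trace_L2 \<tau>"
  shows "inner v (\<Lambda> (star u * u)) \<le> (norm (\<Lambda> (star u)))\<^sup>2"
proof (rule closed_induct_C[of "\<lambda>v. inner v (\<Lambda> (star u * u)) \<le> (norm (\<Lambda> (star u)))\<^sup>2", OF _ _ assms(1)])
  show "closed {v. inner v (\<Lambda> (star u * u)) \<le> (norm (\<Lambda> (star u)))\<^sup>2}"
    by (intro closed_Collect_le continuous_intros)
  fix a assume "a \<in> below_unit"
  then have a: "a \<in> trace_L2 \<tau>" "star a = a" "le_unit \<tau> \<Lambda> a" by (simp_all add: below_unit_def)
  have "cinner (\<Lambda> (star u)) (\<Lambda> (star u) - lmult \<tau> \<Lambda> a (\<Lambda> (star u))) \<in> \<real>\<^sub>\<ge>\<^sub>0"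
    using a(3) by (simp add: le_unit_def)
  then have "0 \<le> Re (cinner (\<Lambda> (star u)) (\<Lambda> (star u)) - cinner (\<Lambda> (star u)) (\<Lambda> (a * star u)))"
    using assms(2) by (simp add: lmult_props(2) L2_star cinner_diff_right complex_nonneg_Reals_iff)
  then show "inner (\<Lambda> a) (\<Lambda> (star u * u)) \<le> (norm (\<Lambda> (star u)))\<^sup>2"
    using cinner_square[OF a(1,2) assms(2)] by (simp add: inner_eq_Re_cinner cinner_self)
qed

definition Cn :: "nat \<Rightarrow> 'h set" where "Cn n = (\<lambda>v. (1 / Suc n) *\<^sub>R v) ` C"

lemma Cn_iff: "v \<in> Cn n \<longleftrightarrow> Suc n *\<^sub>R v \<in> C"
proof
  assume "v \<in> Cn n"
  then obtain w where "w \<in> C" "v = (1 / Suc n) *\<^sub>R w" unfolding Cn_def by blast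
  then show "Suc n *\<^sub>R v \<in> C" by (simp del: of_nat_Suc)
next
  assume "Suc n *\<^sub>R v \<in> C"
  moreover have "v = (1 / Suc n) *\<^sub>R (Suc n *\<^sub>R v)" by (simp del: of_nat_Suc)
  ultimately show "v \<in> Cn n" unfolding Cn_def by (metis imageI)
qed

lemma C_shrink:
  assumes "v \<in> C" "0 \<le> r" "r \<le> 1"
  shows "r *\<^sub>R v \<in> C"
  using convexD[OF C_convex assms(1) zero_in_C, of r "1 - r"] assms by simp

lemma Cn_dec:
  assumes "m \<le> n"
  shows "Cn n \<subseteq> Cn m"
proof
  fix v assume "v \<in> Cn n"
  then have "(Suc m / Suc n) *\<^sub>R (Suc n *\<^sub>R v) \<in> C"
    using assms by (intro C_shrink[of "Suc n *\<^sub>R v"]) (simp_all add: Cn_iff divide_le_eq del: of_nat_Suc)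
  then show "v \<in> Cn m" by (simp add: Cn_iff del: of_nat_Suc)
qed

text \<open>An element below \<open>1/(n+1)\<close> for every \<open>n\<close> is negative. In \<open>L\<^sup>2\<close>: the pairing of \<open>(n+1)\<xi>\<close> with a square
  \<open>u\<^sup>*u\<close> is bounded independently of \<open>n\<close>, so \<open>\<xi>\<close> pairs nonpositively with all squares, hence with the
  cone, and self-duality applies to \<open>-\<xi>\<close>.\<close>

lemma Inter_Cn: "(\<Inter>n. Cn n) = (\<lambda>v. (-1) *\<^sub>R v) ` K"
proof (intro equalityI subsetI)
  fix \<xi> assume \<xi>: "\<xi> \<in> (\<Inter>n. Cn n)"
  have \<xi>C: "Suc n *\<^sub>R \<xi> \<in> C" for n using \<xi> by (simp add: Cn_iff[symmetric] del: of_nat_Suc)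
  have "- \<xi> \<in> K"
  proof (rule K_selfdual)
    have "J \<xi> = \<xi>" using C_J[OF \<xi>C[of 0]] by simp
    then show "J (- \<xi>) = - \<xi>" using J_scaleR[of "-1" \<xi>] by simp
    fix k assume k: "k \<in> K"
    show "0 \<le> inner (- \<xi>) k"
    proof (rule closed_induct_K_square[of "\<lambda>k. 0 \<le> inner (- \<xi>) k", OF _ _ k])
      show "closed {k. 0 \<le> inner (- \<xi>) k}" by (intro closed_Collect_le continuous_intros)
      fix u assume u: "u \<in> trace_L2 \<tau>"
      let ?i = "inner \<xi> (\<Lambda> (star u * u))" and ?M = "(norm (\<Lambda> (star u)))\<^sup>2"
      have le: "Suc n * ?i \<le> ?M" for n
        using C_inner_le[OF \<xi>C u, of n] by (simp del: of_nat_Suc)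
      have "?i \<le> 0"
      proof (rule ccontr)
        assume "\<not> ?i \<le> 0"
        then obtain n where "?M < of_nat n * ?i" using reals_Archimedean3[of ?i] by auto
        moreover have "n * ?i \<le> Suc n * ?i" using \<open>\<not> ?i \<le> 0\<close> by (intro mult_right_mono) auto
        ultimately show False using le[of n] by linarith
      qed
      then show "0 \<le> inner (- \<xi>) (\<Lambda> (star u * u))" by simp
    qed
  qed
  then have "(-1) *\<^sub>R (- \<xi>) \<in> (\<lambda>v. (-1) *\<^sub>R v) ` K" by (rule imageI)
  then show "\<xi> \<in> (\<lambda>v. (-1) *\<^sub>R v) ` K" by simp
next
  fix \<xi> assume "\<xi> \<in> (\<lambda>v. (-1) *\<^sub>R v) ` K"
  then obtain v where v: "v \<in> K" "\<xi> = - v" by auto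
  have "\<xi> \<in> Cn n" for n
    using uminus_K_subset_C[OF K_scaleR[OF v(1), of "Suc n"]] by (simp add: Cn_iff v(2) del: of_nat_Suc)
  then show "\<xi> \<in> (\<Inter>n. Cn n)" by blast
qed

end

section \<open>Energy of the positive part and potentials\<close>

locale dirichlet_gns = tracial_gns \<tau> \<Lambda> + closed_nonneg_form F E
  for \<tau> :: "'a::cstar_algebra \<Rightarrow> ennreal" and \<Lambda> :: "'a \<Rightarrow> 'h::chilbert_space"
    and F :: "'h set" and E :: "'h \<Rightarrow> 'h \<Rightarrow> complex" +
  assumes real: "real_form (gns_conj \<tau> \<Lambda>) F (energy E)"
    and markovian: "markovian_form (gns_conj \<tau> \<Lambda>) (wedge_unit \<tau> \<Lambda>) F (energy E)"
    and regular: "regular_form \<tau> \<Lambda> F E"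
begin

abbreviation "pos_part \<xi> \<equiv> nearest dist K \<xi>"

lemma K_ne: "K \<noteq> {}" using zero_in_K by auto

lemma J_F: "\<xi> \<in> F \<Longrightarrow> J \<xi> \<in> F" and energy_J: "\<xi> \<in> F \<Longrightarrow> energy E (J \<xi>) = energy E \<xi>"
  using real by (simp_all add: real_form_def J_def)

lemma energy_scaleR: "\<xi> \<in> F \<Longrightarrow> energy E (r *\<^sub>R \<xi>) = r\<^sup>2 * energy E \<xi>"
  by (simp add: energy_def scaleR_scaleC E_scaleC_left E_scaleC_right F_scaleC power2_eq_square)

text \<open>The Markov property at \<open>-(n+1)\<xi>\<close>, rescaled, says that the projection of \<open>-\<xi>\<close> onto \<open>C/(n+1)\<close> has energy at
  most that of \<open>\<xi>\<close>. These projections converge to the projection of \<open>-\<xi>\<close> onto the negative cone,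
  which is minus the positive part of \<open>\<xi>\<close>.\<close>

lemma pos_part_energy:
  assumes \<xi>: "\<xi> \<in> F" "J \<xi> = \<xi>"
  shows "pos_part \<xi> \<in> F" "energy E (pos_part \<xi>) \<le> energy E \<xi>"
proof -
  define \<zeta> where "\<zeta> = (-1) *\<^sub>R \<xi>"
  have neC: "C \<noteq> {}" using zero_in_C by auto
  define x where "x = (\<lambda>n. nearest dist (Cn n) \<zeta>)"
  have x: "x n \<in> F \<and> energy E (x n) \<le> energy E \<xi>" for n
  proof -
    define \<eta> where "\<eta> = (- real (Suc n)) *\<^sub>R \<xi>"
    have \<eta>: "\<eta> \<in> F" "J \<eta> = \<eta>" using \<xi> by (simp_all only: \<eta>_def F_scaleR J_scaleR)
    have W: "nearest dist C \<eta> \<in> F" "energy E (nearest dist C \<eta>) \<le> energy E \<eta>"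
      using markovian \<eta> unfolding markovian_form_def wedge_unit_def J_def[symmetric] C_def below_unit_def by blast+
    have "x n = (1 / Suc n) *\<^sub>R nearest dist C ((1 / (1 / Suc n)) *\<^sub>R \<zeta>)"
      unfolding x_def Cn_def by (rule nearest_scaleR[OF C_closed C_convex neC]) simp
    also have "(1 / (1 / Suc n)) *\<^sub>R \<zeta> = \<eta>" by (simp add: \<zeta>_def \<eta>_def del: of_nat_Suc)
    finally have xn: "x n = (1 / Suc n) *\<^sub>R nearest dist C \<eta>" .
    have "energy E (x n) \<le> (1 / Suc n)\<^sup>2 * energy E \<eta>"
      unfolding xn energy_scaleR[OF W(1)] by (intro mult_left_mono W) simp
    also have "\<dots> = energy E \<xi>"
      unfolding \<eta>_def energy_scaleR[OF \<xi>(1)] by (simp add: power_divide del: of_nat_Suc)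
    finally show ?thesis using W(1) by (simp add: xn F_scaleR)
  qed
  have "(\<Inter>n. Cn n) \<noteq> {}" unfolding Inter_Cn using zero_in_K by auto
  then have "x \<longlonglongrightarrow> nearest dist (\<Inter>n. Cn n) \<zeta>"
    unfolding x_def
    by (intro nearest_Inter_tendsto Cn_dec) (simp_all add: Cn_def closed_scaling C_closed convex_scaling C_convex)
  moreover have "nearest dist (\<Inter>n. Cn n) \<zeta> = (-1) *\<^sub>R pos_part \<xi>"
    unfolding Inter_Cn using nearest_scaleR[OF K_closed K_convex K_ne, of "-1" \<zeta>] by (simp add: \<zeta>_def)
  ultimately have "x \<longlonglongrightarrow> (-1) *\<^sub>R pos_part \<xi>" by simp
  then have l: "(-1) *\<^sub>R pos_part \<xi> \<in> F" "energy E ((-1) *\<^sub>R pos_part \<xi>) \<le> energy E \<xi>"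
    using energy_lsc[of x "energy E \<xi>"] x by blast+
  then show F: "pos_part \<xi> \<in> F" using F_scaleR[OF l(1), of "-1"] by simp
  show "energy E (pos_part \<xi>) \<le> energy E \<xi>" using l(2) unfolding energy_scaleR[OF F] by simp
qed

lemma norm_J: "norm (J x) = norm x"
proof -
  have "(norm (J x))\<^sup>2 = (norm x)\<^sup>2" using J_cinner[of x x] unfolding cinner_self of_real_eq_iff .
  then show ?thesis by (simp add: power2_eq_iff_nonneg)
qed

lemma finner_J:
  assumes "x \<in> F" "y \<in> F"
  shows "finner (J x) (J y) = finner x y"
proof -
  have q: "finner (J v) (J v) = finner v v" if "v \<in> F" for v
    using that by (simp add: finner_self energy_J norm_J)
  have "finner (J (x + y)) (J (x + y)) = finner (x + y) (x + y)" by (rule q[OF F_add[OF assms]])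
  then have "finner (J x) (J x) + 2 * finner (J x) (J y) + finner (J y) (J y) = finner x x + 2 * finner x y + finner y y"
    using assms finner_commute[of y x] finner_commute[of "J y" "J x"] by (simp add: J_add J_F finner_simps)
  then show ?thesis using q[OF assms(1)] q[OF assms(2)] by simp
qed

lemma Im_form_inner: "x \<in> F \<Longrightarrow> y \<in> F \<Longrightarrow> Im (form_inner E x y) = - finner x (\<i> *\<^sub>C y)"
  by (simp add: finner_def form_inner_scaleC_right)

lemma form_norm_J: "x \<in> F \<Longrightarrow> form_norm E (J x) = form_norm E x"
  using finner_J[of x x] by (simp add: form_norm_def finner_def)

lemma form_norm_scaleR: "x \<in> F \<Longrightarrow> form_norm E (r *\<^sub>R x) = \<bar>r\<bar> * form_norm E x"
proof (rule power2_eq_imp_eq)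
  assume x: "x \<in> F"
  have "finner (r *\<^sub>R x) (r *\<^sub>R x) = r\<^sup>2 * finner x x"
    using x by (simp add: finner_simps power2_eq_square)
  then show "(form_norm E (r *\<^sub>R x))\<^sup>2 = (\<bar>r\<bar> * form_norm E x)\<^sup>2"
    using x by (simp add: form_norm_sq F_scaleR power_mult_distrib)
qed (simp_all add: form_norm_nonneg F_scaleR)

lemma regular_approx:
  assumes "\<xi> \<in> F" "e > 0"
  obtains b where "b \<in> trace_L2 \<tau>" "\<Lambda> b \<in> F" "form_norm E (\<xi> - \<Lambda> b) < e"
  using regular assms unfolding regular_form_def dirichlet_alg_def by blast

text \<open>The Dirichlet algebra is closed under positive parts, since the positive part of \<open>b\<close> is a projection in
  \<open>L\<^sup>2\<close>, which stays in \<open>F\<close>, and also an element of the algebra.\<close>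

lemma positive_part_dirichlet_alg:
  assumes b: "b \<in> trace_L2 \<tau>" "star b = b" "\<Lambda> b \<in> F"
  obtains y z where "\<Lambda> y \<in> \<Lambda> ` dirichlet_alg \<tau> \<Lambda> F \<inter> K" "\<Lambda> z \<in> \<Lambda> ` dirichlet_alg \<tau> \<Lambda> F \<inter> K"
    "\<Lambda> b = \<Lambda> y - \<Lambda> z" "pos_part (\<Lambda> b) = \<Lambda> y" "\<Lambda> y \<in> F" "\<Lambda> z \<in> F"
proof -
  obtain y z where yz: "b = y - z" "y \<in> cstar_pos" "z \<in> cstar_pos" "y \<in> trace_L2 \<tau>" "z \<in> trace_L2 \<tau>"
      "inner (\<Lambda> y) (\<Lambda> z) = 0" "pos_part (\<Lambda> b) = \<Lambda> y"
    using positive_part[OF b(1,2)] .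
  have eq: "\<Lambda> b = \<Lambda> y - \<Lambda> z" using yz by (simp add: \<Lambda>_diff)
  have yF: "\<Lambda> y \<in> F" using pos_part_energy(1)[OF b(3)] b J_\<Lambda>[OF b(1)] yz(7) by simp
  have "\<Lambda> z = \<Lambda> y - \<Lambda> b" by (simp add: eq)
  then have zF: "\<Lambda> z \<in> F" using F_diff[OF yF b(3)] by simp
  show ?thesis
    by (rule that[OF _ _ eq yz(7) yF zF])
      (use yz yF zF in \<open>simp_all add: dirichlet_alg_def \<Lambda>_in_K\<close>)
qed

text \<open>The vector \<open>\<delta> = \<xi> - J\<xi>\<close> satisfies \<open>J\<delta> = -\<delta>\<close>, so it is orthogonal in the real sense to self-adjoint
  vectors. It is also orthogonal to \<open>\<i>k\<close> for self-adjoint \<open>k\<close> in the Dirichlet algebra, because \<open>\<xi>\<close> pairs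
  to a real number with the two positive parts of \<open>k\<close>. By regularity \<open>\<delta> = 0\<close>.\<close>

lemma potential_selfadjoint:
  assumes "\<xi> \<in> potentials \<tau> \<Lambda> F E"
  shows "J \<xi> = \<xi>"
proof -
  have \<xi>: "\<xi> \<in> F" and pot: "\<And>b. b \<in> \<Lambda> ` dirichlet_alg \<tau> \<Lambda> F \<inter> K \<Longrightarrow> form_inner E \<xi> b \<in> \<real>\<^sub>\<ge>\<^sub>0"
    using assms by (simp_all add: potentials_def)
  define \<delta> where "\<delta> = \<xi> - J \<xi>"
  have \<delta>: "\<delta> \<in> F" unfolding \<delta>_def by (intro F_diff J_F \<xi>)
  have J\<delta>: "J \<delta> = (-1) *\<^sub>R \<delta>" by (simp add: \<delta>_def J_diff J_invol)
  have re: "finner \<delta> v = 0" if "v \<in> F" "J v = v" for v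
    using finner_J[OF \<delta> that(1)] finner_left(3)[OF \<delta> \<delta> that(1), of "-1"] that(2) by (simp add: J\<delta>)
  have im: "finner \<delta> (\<i> *\<^sub>C \<Lambda> k) = 0" if k: "k \<in> trace_L2 \<tau>" "star k = k" "\<Lambda> k \<in> F" for k
  proof -
    obtain y z where yz: "\<Lambda> y \<in> \<Lambda> ` dirichlet_alg \<tau> \<Lambda> F \<inter> K" "\<Lambda> z \<in> \<Lambda> ` dirichlet_alg \<tau> \<Lambda> F \<inter> K"
        "\<Lambda> k = \<Lambda> y - \<Lambda> z" "\<Lambda> y \<in> F" "\<Lambda> z \<in> F"
      using positive_part_dirichlet_alg[OF k] by metis
    have "form_inner E \<xi> (\<Lambda> y) = form_inner E \<xi> (\<Lambda> k) + form_inner E \<xi> (\<Lambda> z)"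
      using form_inner_add_right[OF \<xi> k(3) yz(5)] by (simp add: yz(3))
    then have "Im (form_inner E \<xi> (\<Lambda> k)) = 0"
      using pot[OF yz(1)] pot[OF yz(2)] by (simp add: complex_nonneg_Reals_iff)
    then have 1: "finner \<xi> (\<i> *\<^sub>C \<Lambda> k) = 0" using Im_form_inner[OF \<xi> k(3)] by simp
    have "J (\<i> *\<^sub>C \<Lambda> k) = (-1) *\<^sub>R (\<i> *\<^sub>C \<Lambda> k)"
      using k by (simp add: J_scaleC J_\<Lambda> scaleC_minus_left)
    then have "finner (J \<xi>) ((-1) *\<^sub>R (\<i> *\<^sub>C \<Lambda> k)) = 0"
      using finner_J[OF \<xi> F_scaleC[OF k(3), of \<i>]] 1 by simp
    then have "finner (J \<xi>) (\<i> *\<^sub>C \<Lambda> k) = 0"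
      using finner_scaleR_right[OF J_F[OF \<xi>] F_scaleC[OF k(3), of \<i>], of "-1"] by simp
    then show ?thesis
      using 1 finner_left(2)[OF \<xi> J_F[OF \<xi>] F_scaleC[OF k(3), of \<i>]] by (simp add: \<delta>_def)
  qed
  have all: "finner \<delta> (\<Lambda> b) = 0" if b: "b \<in> trace_L2 \<tau>" "\<Lambda> b \<in> F" for b
  proof -
    define h where "h = (1/2) *\<^sub>R (b + star b)"
    define k where "k = (- \<i> / 2) *\<^sub>C (b - star b)"
    have hk: "b = h + \<i> *\<^sub>C k"
    proof -
      have "\<i> *\<^sub>C k = (1/2) *\<^sub>R (b - star b)" by (simp add: k_def scaleC_scaleC scaleR_scaleC)
      then have "h + \<i> *\<^sub>C k = (1/2) *\<^sub>R (b + b)"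
        by (simp only: h_def scaleR_add_right[symmetric]) simp
      then show ?thesis by (simp add: scaleR_2[symmetric])
    qed
    have L: "h \<in> trace_L2 \<tau>" "k \<in> trace_L2 \<tau>"
      unfolding h_def k_def by (intro L2_scaleR L2_scaleC L2_add L2_diff L2_star b)+
    have sk: "star k = k"
    proof -
      have "star k = (\<i> / 2) *\<^sub>C (star b - b)" by (simp add: k_def star_scaleC star_diff star_star)
      also have "\<dots> = (\<i> / 2) *\<^sub>C (- (b - star b))" by simp
      also have "\<dots> = (- (\<i> / 2)) *\<^sub>C (b - star b)"
        by (simp only: scaleC_minus_right scaleC_minus_left)
      finally show ?thesis by (simp add: k_def)
    qed
    have sh: "star h = h" by (simp add: h_def star_simps add.commute)
    have F: "\<Lambda> h \<in> F" "\<Lambda> k \<in> F"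
    proof -
      have "\<Lambda> h = (1/2) *\<^sub>R (\<Lambda> b + J (\<Lambda> b))" "\<Lambda> k = (- \<i> / 2) *\<^sub>C (\<Lambda> b - J (\<Lambda> b))"
        using b by (simp_all add: h_def k_def \<Lambda>_scaleR \<Lambda>_scaleC \<Lambda>_add \<Lambda>_diff L2_add L2_diff L2_star J_\<Lambda>)
      then show "\<Lambda> h \<in> F" "\<Lambda> k \<in> F" using b by (simp_all add: F_scaleR F_scaleC F_add F_diff J_F)
    qed
    have "\<Lambda> b = \<Lambda> h + \<i> *\<^sub>C \<Lambda> k" by (subst hk) (simp add: \<Lambda>_add \<Lambda>_scaleC L L2_scaleC)
    then show ?thesis
      using re[OF F(1)] im[OF L(2) sk F(2)] \<delta> F L sh by (simp add: finner_add_right F_scaleC J_\<Lambda>)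
  qed
  have "finner \<delta> \<delta> \<le> 0 + e" if e: "e > 0" for e
  proof -
    define M where "M = form_norm E \<delta> + 1"
    have M: "M > 0" using form_norm_nonneg[OF \<delta>] by (simp add: M_def)
    obtain b where b: "b \<in> trace_L2 \<tau>" "\<Lambda> b \<in> F" "form_norm E (\<delta> - \<Lambda> b) < e / M"
      using regular_approx[OF \<delta>, of "e / M"] e M by auto
    have "finner \<delta> \<delta> = finner \<delta> (\<delta> - \<Lambda> b)" using all[OF b(1,2)] \<delta> b by (simp add: finner_diff_right)
    also have "\<dots> \<le> form_norm E \<delta> * form_norm E (\<delta> - \<Lambda> b)"
      using finner_Cauchy_Schwarz[OF \<delta> F_diff[OF \<delta> b(2)]] by linarith
    also have "\<dots> \<le> M * (e / M)"
      using b(3) form_norm_nonneg[OF \<delta>] form_norm_nonneg[OF F_diff[OF \<delta> b(2)]]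
      by (intro mult_mono) (simp_all add: M_def)
    finally show ?thesis using M by simp
  qed
  then have "finner \<delta> \<delta> \<le> 0" by (rule field_le_epsilon)
  then have "(norm \<delta>)\<^sup>2 \<le> 0" using norm_le_finner[OF \<delta>] by linarith
  then show ?thesis by (simp add: \<delta>_def)
qed

text \<open>Form-norm approximants of \<open>\<eta>\<close> from the Dirichlet algebra need not be positive. Their positive parts
  are positive and remain in the algebra, but converge to \<open>\<eta>\<close> only in \<open>L\<^sup>2\<close> with bounded energy, which is
  enough for a closed half-space condition.\<close>

lemma potential_finner_nonneg:
  assumes \<xi>: "\<xi> \<in> potentials \<tau> \<Lambda> F E" and \<eta>: "\<eta> \<in> F" "\<eta> \<in> K"
  shows "0 \<le> finner \<xi> \<eta>"
proof -
  have \<xi>F: "\<xi> \<in> F" and pot: "\<And>b. b \<in> \<Lambda> ` dirichlet_alg \<tau> \<Lambda> F \<inter> K \<Longrightarrow> form_inner E \<xi> b \<in> \<real>\<^sub>\<ge>\<^sub>0"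
    using \<xi> by (simp_all add: potentials_def)
  have "\<exists>a. a \<in> trace_L2 \<tau> \<and> star a = a \<and> \<Lambda> a \<in> F \<and> form_norm E (\<eta> - \<Lambda> a) < 1 / Suc n" for n
  proof -
    obtain b where b: "b \<in> trace_L2 \<tau>" "\<Lambda> b \<in> F" "form_norm E (\<eta> - \<Lambda> b) < 1 / Suc n"
      using regular_approx[OF \<eta>(1), of "1 / Suc n"] by auto
    define a where "a = (1/2) *\<^sub>R (b + star b)"
    define w where "w = \<eta> - \<Lambda> b"
    have wF: "w \<in> F" unfolding w_def by (intro F_diff \<eta> b)
    have \<Lambda>a: "\<Lambda> a = (1/2) *\<^sub>R (\<Lambda> b + J (\<Lambda> b))"
      using b by (simp add: a_def \<Lambda>_scaleR \<Lambda>_add L2_add L2_star J_\<Lambda>)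
    have "\<eta> - \<Lambda> a = (1/2) *\<^sub>R (\<eta> + \<eta>) - \<Lambda> a" by (simp add: scaleR_2[symmetric])
    also have "\<dots> = (1/2) *\<^sub>R w + (1/2) *\<^sub>R J w"
      unfolding w_def J_diff K_J[OF \<eta>(2)] \<Lambda>a by (simp add: algebra_simps)
    finally have "form_norm E (\<eta> - \<Lambda> a) \<le> (1/2) * form_norm E w + (1/2) * form_norm E (J w)"
      using form_norm_triangle[OF F_scaleR[OF wF, of "1/2"] F_scaleR[OF J_F[OF wF], of "1/2"]]
      by (simp add: form_norm_scaleR wF J_F)
    also have "\<dots> = form_norm E w" by (simp add: form_norm_J wF)
    finally have "form_norm E (\<eta> - \<Lambda> a) < 1 / Suc n" using b(3) by (simp add: w_def)
    moreover have "a \<in> trace_L2 \<tau>" "star a = a" "\<Lambda> a \<in> F"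
      using b by (simp_all add: \<Lambda>a F_scaleR F_add J_F)
        (simp_all add: a_def L2_scaleR L2_add L2_star star_simps add.commute)
    ultimately show ?thesis by blast
  qed
  then obtain a where a: "\<And>n::nat. a n \<in> trace_L2 \<tau>" "\<And>n. star (a n) = a n" "\<And>n. \<Lambda> (a n) \<in> F"
      "\<And>n. form_norm E (\<eta> - \<Lambda> (a n)) < 1 / Suc n" by metis
  have Ja: "J (\<Lambda> (a n)) = \<Lambda> (a n)" for n using a by (simp add: J_\<Lambda>)
  define x where "x = (\<lambda>n. pos_part (\<Lambda> (a n)))"
  have "(\<lambda>n. \<eta> - \<Lambda> (a n)) \<longlonglongrightarrow> 0"
  proof (rule Lim_null_comparison[OF _ LIMSEQ_Suc[OF lim_1_over_n]])
    have "norm (\<eta> - \<Lambda> (a n)) \<le> 1 / Suc n" for n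
      using norm_le_form_norm[OF F_diff[OF \<eta>(1) a(3)], of n] a(4)[of n] by linarith
    then show "\<forall>\<^sub>F n in sequentially. norm (\<eta> - \<Lambda> (a n)) \<le> 1 / of_nat (Suc n)" by simp
  qed
  from tendsto_diff[OF tendsto_const[of \<eta>] this] have "(\<lambda>n. \<Lambda> (a n)) \<longlonglongrightarrow> \<eta>" by simp
  then have lim: "x \<longlonglongrightarrow> pos_part \<eta>"
    unfolding x_def by (rule nearest_tendsto[OF K_closed K_convex K_ne])
  have fix_\<eta>: "pos_part \<eta> = \<eta>"
    by (rule nearest_eqI[OF K_closed K_convex \<eta>(2)]) simp
  have xF: "x n \<in> F" for n unfolding x_def by (rule pos_part_energy[OF a(3) Ja])
  have en: "energy E (x n) \<le> (form_norm E \<eta> + 1)\<^sup>2" for n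
  proof -
    have "energy E (x n) \<le> energy E (\<Lambda> (a n))" unfolding x_def by (rule pos_part_energy[OF a(3) Ja])
    also have "\<dots> \<le> (form_norm E (\<Lambda> (a n)))\<^sup>2" using form_norm_sq[OF a(3)] by (simp add: finner_self)
    also have "\<dots> \<le> (form_norm E \<eta> + 1)\<^sup>2"
    proof (rule power_mono)
      let ?w = "\<eta> - \<Lambda> (a n)"
      have wF: "?w \<in> F" by (intro F_diff \<eta> a)
      have "form_norm E (\<eta> + (-1) *\<^sub>R ?w) \<le> form_norm E \<eta> + form_norm E ((-1) *\<^sub>R ?w)"
        by (intro form_norm_triangle \<eta> F_scaleR wF)
      moreover have "form_norm E ((-1) *\<^sub>R ?w) = form_norm E ?w" using form_norm_scaleR[OF wF, of "-1"] by simp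
      moreover have "form_norm E ?w \<le> 1"
        using a(4)[of n] by (rule order_trans[OF less_imp_le]) simp
      ultimately show "form_norm E (\<Lambda> (a n)) \<le> form_norm E \<eta> + 1" by simp
    qed (rule form_norm_nonneg[OF a(3)])
    finally show ?thesis .
  qed
  have pos: "0 \<le> finner \<xi> (x n)" for n
  proof -
    obtain y z where "\<Lambda> y \<in> \<Lambda> ` dirichlet_alg \<tau> \<Lambda> F \<inter> K" "pos_part (\<Lambda> (a n)) = \<Lambda> y"
      using positive_part_dirichlet_alg[OF a(1-3)] by metis
    then show ?thesis using pot by (simp add: x_def finner_def complex_nonneg_Reals_iff)
  qed
  show ?thesis
    using finner_weak_limit_nonneg[OF \<xi>F xF en lim pos] by (simp add: fix_\<eta>)
qed

text \<open>Comparing \<open>\<xi>\<^sub>+ = \<xi> + \<xi>\<^sub>-\<close> with \<open>\<xi>\<close> in the Hilbert space \<open>F\<close>: the projection onto the cone makes the norm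
  smaller, adding \<open>\<xi>\<^sub>-\<close> makes it larger, so \<open>\<xi>\<^sub>- = 0\<close>.\<close>

lemma potentials_subset_K: "potentials \<tau> \<Lambda> F E \<subseteq> K"
proof
  fix \<xi> assume \<xi>: "\<xi> \<in> potentials \<tau> \<Lambda> F E"
  have \<xi>F: "\<xi> \<in> F" using \<xi> by (simp add: potentials_def)
  have J\<xi>: "J \<xi> = \<xi>" by (rule potential_selfadjoint[OF \<xi>])
  define p where "p = pos_part \<xi>"
  define m where "m = p - \<xi>"
  have pK: "p \<in> K" unfolding p_def by (rule nearest_in[OF K_closed K_convex K_ne])
  have pF: "p \<in> F" "energy E p \<le> energy E \<xi>" unfolding p_def by (rule pos_part_energy[OF \<xi>F J\<xi>])+
  have mF: "m \<in> F" unfolding m_def by (intro F_diff pF \<xi>F)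
  have mK: "m \<in> K" unfolding m_def p_def by (rule negative_part_in_K[OF J\<xi>])
  have "norm p \<le> norm \<xi>"
  proof -
    have "pos_part 0 = 0" by (rule nearest_eqI[OF K_closed K_convex zero_in_K]) simp
    then show ?thesis using nearest_nonexpansive[OF K_closed K_convex K_ne, of \<xi> 0] by (simp add: p_def)
  qed
  then have "finner p p \<le> finner \<xi> \<xi>"
    unfolding finner_self using pF(2) by (intro add_mono power_mono) simp_all
  moreover have "finner p p = finner \<xi> \<xi> + 2 * finner \<xi> m + finner m m"
  proof -
    have "p = \<xi> + m" by (simp add: m_def)
    then show ?thesis using \<xi>F mF finner_commute[OF mF \<xi>F] by (simp add: finner_simps)
  qed
  moreover have "0 \<le> finner \<xi> m" by (rule potential_finner_nonneg[OF \<xi> mF mK])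
  ultimately have "(norm m)\<^sup>2 \<le> 0" using norm_le_finner[OF mF] by linarith
  then have "p = \<xi>" by (simp add: m_def)
  then show "\<xi> \<in> K" using pK by simp
qed

end

theorem proposition3p7:
  fixes \<tau> :: "'a::cstar_algebra \<Rightarrow> ennreal"
    and \<Lambda> :: "'a \<Rightarrow> 'h::chilbert_space"
    and F :: "'h set" and E :: "'h \<Rightarrow> 'h \<Rightarrow> complex"
  assumes "separable_space (euclidean :: 'a topology)"
    and "positive_trace \<tau>" and "densely_defined_trace \<tau>" and "faithful_trace \<tau>"
    and "semifinite_trace \<tau>" and "lsc_trace \<tau>"
    and "gns_map \<tau> \<Lambda>"
    and "dirichlet_form \<tau> \<Lambda> F E"
  shows "potentials \<tau> \<Lambda> F E \<subseteq> L2_pos \<tau> \<Lambda>"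
proof -
  interpret dirichlet_gns \<tau> \<Lambda> F E
    using assms by unfold_locales (simp_all add: dirichlet_form_def)
  show ?thesis by (rule potentials_subset_K)
qed

end
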